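(* Let $k\ge 1$ and $\ell$ be integers with $1\le \ell\le k$ and $\gcd(\ell,k)=1$. Then for all sufficiently large $x$, $$\sum_{\substack{1<n\le x\\ p(n)\equiv \ell \pmod k}}\mu(n)\omega(n)\left\{\frac{x}{n}\right\}=O\!\left(\frac{x(\log\log x)^{5/2}}{\sqrt{\log x}}\right),$$ where $\{y\}=y-\lfloor y\rfloor$ denotes the fractional part of $y$ and the implied constant may depend on $k$ and $\ell$.
   Context: $\mu$ is the Möbius function, $\omega(n)$ is the number of distinct prime factors of $n$, and for $n\ge 2$, $p(n)$ is the smallest prime factor of $n$. *)

theory Defs
  imports "HOL-Computational_Algebra.Squarefree" "HOL-Number_Theory.Number_Theory" "HOL-Library.Landau_Symbols"
begin

definition distinct_primes :: "nat \<Rightarrow> nat" where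
  "distinct_primes n = card (prime_factors n)"

definition moebius_mu :: "nat \<Rightarrow> int" where
  "moebius_mu n = (if squarefree n then (- 1) ^ distinct_primes n else 0)"

(* Only meaningful for n >= 2: the prime factor set is empty for n = 0 and n = 1. *)
definition smallest_prime_factor :: "nat \<Rightarrow> nat" where
  "smallest_prime_factor n = Min (prime_factors n)"

end

theory Submission
  imports Defs "HOL-Complex_Analysis.Complex_Analysis" "HOL-Real_Asymp.Real_Asymp"
begin

text \<open>
  Write \<open>n = p m\<close> with \<open>p\<close> the smallest prime factor, so that \<open>\<mu>(n) \<omega>(n) = -\<mu>(m) (1 + \<omega>(m))\<close> where \<open>m\<close>
  has only prime factors above \<open>p\<close>, and cut at \<open>p = z = exp (sqrt (ln x))\<close>. The residue class of
  \<open>p\<close> plays no role, because the terms are bounded for each \<open>p\<close> separately.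

  For \<open>p > z\<close> an upper bound sieve gives \<open>O(x ln ln x / ln z)\<close>. For \<open>p \<le> z\<close> let \<open>U\<^sub>P(y)\<close> be the sum of
  \<open>\<mu>(m) {y/m}\<close> over the \<open>m \<le> y\<close> without prime factor in \<open>P\<close>. It satisfies
  \<open>U\<^sub>P\<^sub>q(y) = U\<^sub>P(y) + U\<^sub>P\<^sub>q(y/q)\<close>, where \<open>Pq\<close> stands for \<open>P\<close> together with a further prime \<open>q\<close>, and the sum
  weighted with \<open>\<omega>(m)\<close> is \<open>-\<Sum>\<^sub>q U\<^sub>P\<^sub>q(y/q)\<close>. Hence everything reduces to \<open>P = {}\<close>,
  where \<open>U(y) = y \<Sum>\<^bsub>n\<le>y\<^esub> \<mu>(n)/n - 1\<close>, and the recursion costs only a Mertens product. With the sieve it yields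
  \<open>U\<^sub>P(y) = O(y ln p / ln y)\<close> for the primes up to \<open>p\<close>, and summing over \<open>p \<le> z\<close> costs \<open>ln z\<close>; this balances
  with the sieve bound and gives \<open>O(x ln ln x / sqrt (ln x))\<close>.

  The input \<open>\<Sum>\<^bsub>n\<le>N\<^esub> \<mu>(n)/n = O(1/(ln N)\<^sup>2)\<close> comes from Newman's contour argument made quantitative by a
  lower bound for \<open>\<zeta>\<close> slightly to the left of the line \<open>Re s = 1\<close>; there the
  inequality \<open>3 + 4 cos t + cos 2t \<ge> 0\<close> and power bounds with small exponents suffice.
\<close>

section \<open>The Moebius function\<close>

text \<open>Why the Moebius sum has to save two powers of \<open>ln N\<close>: if the input saves
  \<open>(ln y)^A\<close>, removing the primes up to \<open>p\<close> costs
  \<open>(ln p)^(A + 1)\<close>. One factor is the Mertens product. The other \<open>A\<close> come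
  from the majorant \<open>y / (b + ln y)^A\<close> with \<open>b\<close> of size
  \<open>ln p\<close>, chosen so that replacing \<open>y\<close> by \<open>y/q\<close> for a removed
  prime \<open>q\<close> gains nearly the full factor \<open>1/q\<close>. With \<open>A = 1\<close>
  the sum over \<open>p \<le> z\<close> would be \<open>O(x)\<close> at
  \<open>ln z = sqrt (ln x)\<close>, which is trivial; \<open>A = 2\<close> is enough.

  The weight \<open>\<omega>\<close> forces an evaluation at \<open>x / (p q)\<close> down to
  arguments near 1, where a saving in \<open>ln y\<close> is void. There the sieve bound has to be
  combined with the analytic one, uniformly in \<open>y\<close>.

  A saving of two logarithms needs a contour of radius only \<open>(ln N)^2\<close>, so a zero-free
  strip of width a small power of the inverse height is good enough. Everything else about primes is
  an upper bound of Chebyshev type.\<close>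

lemma distinct_primes_prime_mult:
  assumes "prime q" "\<not> q dvd m" "m > 0"
  shows "distinct_primes (q * m) = Suc (distinct_primes m)"
proof -
  have "prime_factors (q * m) = insert q (prime_factors m)"
    using assms by (auto simp: prime_factors_product prime_factorization_prime)
  moreover have "q \<notin> prime_factors m"
    using assms by auto
  ultimately show ?thesis
    by (simp add: distinct_primes_def)
qed

lemma moebius_mu_1 [simp]: "moebius_mu (Suc 0) = 1"
  by (simp add: moebius_mu_def distinct_primes_def)

lemma moebius_mu_prime_mult:
  assumes "prime q" "\<not> q dvd m" "m > 0"
  shows "moebius_mu (q * m) = - moebius_mu m"
proof -
  have "coprime q m"
    using assms by (simp add: prime_imp_coprime)
  hence "squarefree (q * m) \<longleftrightarrow> squarefree m"
    using assms by (metis squarefree_mult_coprime squarefree_multD(2) squarefree_prime)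
  thus ?thesis
    using distinct_primes_prime_mult[OF assms] by (simp add: moebius_mu_def)
qed

lemma moebius_mu_prime_mult_eq_0:
  assumes "prime q" "q dvd m"
  shows "moebius_mu (q * m) = 0"
proof -
  have "q\<^sup>2 dvd q * m"
    using assms by (simp add: power2_eq_square)
  hence "\<not> squarefree (q * m)"
    using assms by (auto simp: squarefree_def)
  thus ?thesis by (simp add: moebius_mu_def)
qed

lemma abs_moebius_mu_le_1: "\<bar>moebius_mu n\<bar> \<le> 1"
  by (simp add: moebius_mu_def)

text \<open>A fixed prime \<open>q\<close> dividing \<open>n\<close> pairs each divisor
  \<open>d\<close> prime to \<open>q\<close> with \<open>q * d\<close>, which has the opposite
  value; divisors divisible by \<open>q * q\<close> contribute 0.\<close>

lemma sum_moebius_mu_divisors: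
  assumes "n > 1"
  shows "(\<Sum>d | d dvd n. moebius_mu d) = 0"
proof -
  obtain q where q: "prime q" "q dvd n"
    using assms by (metis less_irrefl prime_factor_nat)
  have fin: "finite {d. d dvd n}"
    using assms by simp
  let ?A = "{d. d dvd n \<and> \<not> q dvd d}"
  have [simp]: "finite ?A"
    by (rule finite_subset[OF _ fin]) auto
  have split: "{d. d dvd n} = ?A \<union> {d. d dvd n \<and> q dvd d}"
    by auto
  have "(\<Sum>d | d dvd n \<and> q dvd d. moebius_mu d) = (\<Sum>d\<in>(\<lambda>d. q * d) ` ?A. moebius_mu d)"
  proof (rule sum.mono_neutral_right)
    show "finite {d. d dvd n \<and> q dvd d}"
      by (rule finite_subset[OF _ fin]) auto
    show "(\<lambda>d. q * d) ` ?A \<subseteq> {d. d dvd n \<and> q dvd d}"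
    proof safe
      fix d assume "d dvd n" "\<not> q dvd d"
      hence "coprime q d" using q by (simp add: prime_imp_coprime)
      thus "q * d dvd n" using q \<open>d dvd n\<close> by (simp add: divides_mult)
    qed auto
    show "\<forall>d\<in>{d. d dvd n \<and> q dvd d} - (\<lambda>d. q * d) ` ?A. moebius_mu d = 0"
    proof
      fix d assume d: "d \<in> {d. d dvd n \<and> q dvd d} - (\<lambda>d. q * d) ` ?A"
      then obtain e where e: "d = q * e" by auto
      hence "q dvd e" using d by (auto dest: dvd_mult_right)
      thus "moebius_mu d = 0" using e q moebius_mu_prime_mult_eq_0 by auto
    qed
  qed
  also have "\<dots> = (\<Sum>d\<in>?A. moebius_mu (q * d))"
    using q by (subst sum.reindex) (auto simp: inj_on_def prime_gt_0_nat)
  also have "\<dots> = (\<Sum>d\<in>?A. - moebius_mu d)"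
    using q assms by (intro sum.cong) (auto intro!: moebius_mu_prime_mult intro: Nat.gr0I)
  finally have "(\<Sum>d | d dvd n \<and> q dvd d. moebius_mu d) = - (\<Sum>d\<in>?A. moebius_mu d)"
    by (simp add: sum_negf)
  moreover have "(\<Sum>d | d dvd n. moebius_mu d)
      = (\<Sum>d\<in>?A. moebius_mu d) + (\<Sum>d | d dvd n \<and> q dvd d. moebius_mu d)"
    unfolding split by (rule sum.union_disjoint) (auto intro: finite_subset[OF _ fin])
  ultimately show ?thesis by simp
qed

text \<open>Counting multiples of \<open>n\<close> up to \<open>N\<close> turns the left side into a
  sum of divisor sums, of which only the one for \<open>k = 1\<close> survives. This evaluates the
  floor part in \<open>moebius_frac_sum_empty\<close>.\<close>

lemma sum_moebius_mu_floor:
  assumes "N > 0"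
  shows "(\<Sum>n=1..N. moebius_mu n * int (N div n)) = 1"
proof -
  have "(\<Sum>n=1..N. moebius_mu n * int (N div n)) = (\<Sum>n=1..N. \<Sum>k | k \<in> {1..N} \<and> n dvd k. moebius_mu n)"
  proof (intro sum.cong refl)
    fix n assume n: "n \<in> {1..N}"
    have "{k. k \<in> {1..N} \<and> n dvd k} = (\<lambda>m. n * m) ` {1..N div n}"
      using n by (auto simp: image_iff less_eq_div_iff_mult_less_eq mult.commute elim!: dvdE)
    hence "card {k. k \<in> {1..N} \<and> n dvd k} = N div n"
      using n by (simp add: card_image inj_on_def)
    thus "moebius_mu n * int (N div n) = (\<Sum>k | k \<in> {1..N} \<and> n dvd k. moebius_mu n)"
      by simp
  qed
  also have "\<dots> = (\<Sum>k=1..N. \<Sum>n | n \<in> {1..N} \<and> n dvd k. moebius_mu n)"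
    by (rule sum.swap_restrict) auto
  also have "\<dots> = (\<Sum>k=1..N. if k = 1 then 1 else 0)"
  proof (intro sum.cong refl)
    fix k assume k: "k \<in> {1..N}"
    have "{n. n \<in> {1..N} \<and> n dvd k} = {n. n dvd k}"
      using k by (auto dest: dvd_imp_le intro: Nat.gr0I)
    thus "(\<Sum>n | n \<in> {1..N} \<and> n dvd k. moebius_mu n) = (if k = 1 then 1 else 0)"
      using k sum_moebius_mu_divisors[of k] by (cases "k = 1") auto
  qed
  finally show ?thesis using assms by simp
qed

section \<open>Dirichlet series and Euler products\<close>

definition coprime_set :: "nat set \<Rightarrow> nat set" where
  "coprime_set P = {n. n > 0 \<and> (\<forall>q\<in>P. \<not> q dvd n)}"

text \<open>An unordered sum, so that the index set can be split and rescaled by a prime freely. It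
  is used only for \<open>Re s > 1\<close>, where it converges absolutely.\<close>

definition dirichlet_sum :: "(nat \<Rightarrow> complex) \<Rightarrow> nat set \<Rightarrow> complex \<Rightarrow> complex" where
  "dirichlet_sum f A s = infsum (\<lambda>n. f n * of_nat n powr (-s)) A"

definition primes_le :: "real \<Rightarrow> nat set" where
  "primes_le z = {q. prime q \<and> real q \<le> z}"

lemma finite_primes_le [simp]: "finite (primes_le z)"
  by (rule finite_subset[of _ "{..nat \<lfloor>z\<rfloor>}"]) (auto simp: primes_le_def le_nat_floor)

lemma coprime_set_split:
  assumes "prime q" "q \<notin> P" "\<forall>p\<in>P. prime p"
  shows "coprime_set P = coprime_set (insert q P) \<union> (\<lambda>n. q * n) ` coprime_set P"
    and "coprime_set (insert q P) \<inter> (\<lambda>n. q * n) ` coprime_set P = {}"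
proof -
  have iff: "q * n \<in> coprime_set P \<longleftrightarrow> n \<in> coprime_set P" for n
    using assms by (auto simp: coprime_set_def prime_dvd_mult_iff prime_gt_0_nat dest: primes_dvd_imp_eq)
  show "coprime_set P = coprime_set (insert q P) \<union> (\<lambda>n. q * n) ` coprime_set P"
  proof (intro equalityI subsetI)
    fix n assume n: "n \<in> coprime_set P"
    show "n \<in> coprime_set (insert q P) \<union> (\<lambda>n. q * n) ` coprime_set P"
    proof (cases "q dvd n")
      case True
      then obtain m where "n = q * m" by (elim dvdE)
      thus ?thesis using n iff by auto
    qed (use n in \<open>auto simp: coprime_set_def\<close>)
  next
    fix n assume "n \<in> coprime_set (insert q P) \<union> (\<lambda>n. q * n) ` coprime_set P"
    thus "n \<in> coprime_set P" using iff prime_gt_0_nat[OF assms(1)] by (auto simp: coprime_set_def)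
  qed
qed (auto simp: coprime_set_def)

text \<open>Comparison with the integral of \<open>t powr (-1-x)\<close> in mean value form; the end
  point \<open>M\<close> stays in the bound so that the induction telescopes.\<close>

lemma sum_powr_tail_le:
  fixes x :: real
  assumes "x > 0" "N > 0" "M \<ge> N"
  shows "(\<Sum>n\<in>{N<..M}. real n powr (-1-x)) \<le> (real N powr (-x) - real M powr (-x)) / x"
  using assms(3)
proof (induction M rule: dec_induct)
  case (step M)
  have M: "M > 0" using assms step by simp
  have "\<exists>\<xi>. real M < \<xi> \<and> \<xi> < real (Suc M) \<and> real (Suc M) powr (-x) - real M powr (-x) = (real (Suc M) - real M) * (-x * \<xi> powr (-x-1))"
    using M by (intro MVT2) (auto intro!: derivative_eq_intros)
  moreover have "-x - 1 = -1 - x" by simp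
  ultimately obtain \<xi> where \<xi>: "real M < \<xi>" "\<xi> < real (Suc M)"
    "real (Suc M) powr (-x) - real M powr (-x) = -x * \<xi> powr (-1-x)" by (auto simp del: minus_diff_commute)
  have "real (Suc M) powr (-1-x) \<le> \<xi> powr (-1-x)"
    using \<xi> M assms by (intro powr_mono2') auto
  also have "\<dots> = (real M powr (-x) - real (Suc M) powr (-x)) / x"
    using \<xi> assms by (simp add: field_simps)
  finally have "real (Suc M) powr (-1-x) \<le> (real M powr (-x) - real (Suc M) powr (-x)) / x" .
  moreover have "{N<..Suc M} = insert (Suc M) {N<..M}" using step by auto
  ultimately show ?case using step by (simp add: diff_divide_distrib)
qed auto

lemma sum_powr_tail_finite_le:
  fixes x :: real
  assumes "x > 0" "N > 0" "finite F" "F \<subseteq> {N<..}"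
  shows "(\<Sum>n\<in>F. real n powr (-1-x)) \<le> real N powr (-x) / x"
proof -
  obtain M where M: "M \<ge> N" "F \<subseteq> {N<..M}"
    using assms(3,4) by (intro that[of "Max (insert N F)"]) auto
  have "(\<Sum>n\<in>F. real n powr (-1-x)) \<le> (\<Sum>n\<in>{N<..M}. real n powr (-1-x))"
    using M by (intro sum_mono2) auto
  also have "\<dots> \<le> (real N powr (-x) - real M powr (-x)) / x"
    using assms M by (intro sum_powr_tail_le) auto
  also have "\<dots> \<le> real N powr (-x) / x"
    using assms by (simp add: divide_right_mono)
  finally show ?thesis .
qed

lemma norm_of_nat_powr [simp]: "norm (of_nat n powr s :: complex) = real n powr Re s"
  by (cases "n = 0") (simp_all add: norm_powr_real_powr)

context
  fixes f :: "nat \<Rightarrow> complex"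
  assumes f_le_1: "\<And>n. norm (f n) \<le> 1"
begin

lemma dirichlet_term_le: "norm (f n * of_nat n powr (-s)) \<le> real n powr (- Re s)"
  using mult_right_mono[OF f_le_1[of n], of "real n powr (- Re s)"]
  by (simp add: norm_mult)

lemma abs_summable_dirichlet:
  assumes "Re s > 1"
  shows "(\<lambda>n. norm (f n * of_nat n powr (-s))) summable_on A"
proof -
  have "(\<lambda>n. real n powr (- Re s)) summable_on UNIV"
    using assms by (subst summable_on_UNIV_nonneg_real_iff) (auto simp: summable_real_powr_iff)
  hence "(\<lambda>n. real n powr (- Re s)) summable_on A"
    by (rule summable_on_subset) auto
  thus ?thesis
    by (rule summable_on_comparison_test) (use dirichlet_term_le in auto)
qed

lemma summable_dirichlet:
  assumes "Re s > 1"
  shows "(\<lambda>n. f n * of_nat n powr (-s)) summable_on A"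
  using abs_summable_dirichlet[OF assms] by (rule abs_summable_summable)

lemma norm_dirichlet_sum_tail_le:
  assumes "Re s > 1" "N > 0" "A \<subseteq> {N<..}"
  shows "norm (dirichlet_sum f A s) \<le> real N powr (1 - Re s) / (Re s - 1)"
proof -
  have "norm (dirichlet_sum f A s) \<le> infsum (\<lambda>n. norm (f n * of_nat n powr (-s))) A"
    unfolding dirichlet_sum_def by (rule norm_infsum_bound[OF abs_summable_dirichlet[OF assms(1)]])
  also have "\<dots> \<le> real N powr (1 - Re s) / (Re s - 1)"
  proof (rule infsum_le_finite_sums[OF abs_summable_dirichlet[OF assms(1)]])
    fix F assume F: "finite F" "F \<subseteq> A"
    have "(\<Sum>n\<in>F. norm (f n * of_nat n powr (-s))) \<le> (\<Sum>n\<in>F. real n powr (-1-(Re s - 1)))"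
      by (rule sum_mono) (use dirichlet_term_le in auto)
    also have "\<dots> \<le> real N powr (-(Re s - 1)) / (Re s - 1)"
      using F assms by (intro sum_powr_tail_finite_le) auto
    finally show "(\<Sum>n\<in>F. norm (f n * of_nat n powr (-s))) \<le> real N powr (1 - Re s) / (Re s - 1)"
      by simp
  qed
  finally show ?thesis .
qed

lemma dirichlet_sum_union:
  assumes "Re s > 1" "A \<inter> B = {}"
  shows "dirichlet_sum f (A \<union> B) s = dirichlet_sum f A s + dirichlet_sum f B s"
  unfolding dirichlet_sum_def using assms by (intro infsum_Un_disjoint summable_dirichlet)

text \<open>Serves both Euler products: \<open>c = 1\<close> for constant coefficients,
  \<open>c = -1\<close> for the Moebius function on integers prime to \<open>q\<close>.\<close>

lemma dirichlet_sum_prime_mult: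
  assumes "prime q" "\<And>n. n \<in> A \<Longrightarrow> f (q * n) = c * g n" "Re s > 1"
  shows "dirichlet_sum f ((\<lambda>n. q * n) ` A) s = c * of_nat q powr (-s) * dirichlet_sum g A s"
proof -
  have "inj_on (\<lambda>n. q * n) A" using assms by (auto simp: inj_on_def)
  hence "dirichlet_sum f ((\<lambda>n. q * n) ` A) s
     = infsum ((\<lambda>n. f n * of_nat n powr (-s)) \<circ> (\<lambda>n. q * n)) A"
    unfolding dirichlet_sum_def by (rule infsum_reindex)
  also have "\<dots> = infsum (\<lambda>n. (c * of_nat q powr (-s)) * (g n * of_nat n powr (-s))) A"
    by (rule infsum_cong) (use assms(2) in \<open>simp add: powr_times_real\<close>)
  also have "\<dots> = c * of_nat q powr (-s) * dirichlet_sum g A s"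
    unfolding dirichlet_sum_def by (rule infsum_cmult_right')
  finally show ?thesis .
qed

text \<open>Without prime factors up to \<open>N\<close>, only 1 and integers beyond
  \<open>N\<close> remain. This tail estimate gives the convergence of both Euler products.\<close>

lemma norm_dirichlet_sum_coprime_sub_1_le:
  assumes "Re s > 1" "N > 0" "f 1 = 1"
  shows "norm (dirichlet_sum f (coprime_set (primes_le (real N))) s - 1) \<le> real N powr (1 - Re s) / (Re s - 1)"
proof -
  let ?P = "coprime_set (primes_le (real N))"
  have eq: "?P = {1} \<union> (?P - {1})"
    by (auto simp: coprime_set_def primes_le_def)
  have "dirichlet_sum f ?P s = dirichlet_sum f {1} s + dirichlet_sum f (?P - {1}) s"
    by (subst eq, rule dirichlet_sum_union) (use assms in auto)
  moreover have "dirichlet_sum f {1} s = 1"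
    using assms by (simp add: dirichlet_sum_def)
  moreover have "?P - {1} \<subseteq> {N<..}"
  proof
    fix n assume n: "n \<in> ?P - {1}"
    then obtain q where q: "prime q" "q dvd n" using prime_factor_nat[of n] by auto
    hence "q > N" using n by (auto simp: coprime_set_def primes_le_def)
    moreover have "q \<le> n" using q n by (intro dvd_imp_le) (auto simp: coprime_set_def)
    ultimately show "n \<in> {N<..}" by simp
  qed
  ultimately show ?thesis using norm_dirichlet_sum_tail_le[OF assms(1,2)] by simp
qed

end

definition zeta :: "complex \<Rightarrow> complex" where
  "zeta s = dirichlet_sum (\<lambda>_. 1) {0<..} s"

definition moebius_series :: "complex \<Rightarrow> complex" where
  "moebius_series s = dirichlet_sum (\<lambda>n. of_int (moebius_mu n)) {0<..} s"

lemma norm_moebius_mu_le_1: "norm (of_int (moebius_mu n) :: complex) \<le> 1"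
  using abs_moebius_mu_le_1[of n] by (simp only: norm_of_int)

lemma zeta_euler_factor:
  assumes "finite P" "\<forall>p\<in>P. prime p" "Re s > 1"
  shows "dirichlet_sum (\<lambda>_. 1) (coprime_set P) s = (\<Prod>q\<in>P. 1 - of_nat q powr (-s)) * zeta s"
  using assms(1,2)
proof (induction P rule: finite_induct)
  case empty
  have "coprime_set {} = {0<..}" by (auto simp: coprime_set_def)
  thus ?case by (simp add: zeta_def)
next
  case (insert q P)
  let ?S = "\<lambda>A. dirichlet_sum (\<lambda>_. 1) A s"
  have "?S (coprime_set P) = ?S (coprime_set (insert q P)) + ?S ((\<lambda>n. q * n) ` coprime_set P)"
  proof -
    have "?S (coprime_set P) = ?S (coprime_set (insert q P) \<union> (\<lambda>n. q * n) ` coprime_set P)"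
      by (rule arg_cong[where f = "\<lambda>A. ?S A"], rule coprime_set_split(1)) (use insert in auto)
    also have "\<dots> = ?S (coprime_set (insert q P)) + ?S ((\<lambda>n. q * n) ` coprime_set P)"
      by (rule dirichlet_sum_union) (use insert assms coprime_set_split(2)[of q P] in simp_all)
    finally show ?thesis .
  qed
  also have "?S ((\<lambda>n. q * n) ` coprime_set P) = 1 * of_nat q powr (-s) * ?S (coprime_set P)"
    using insert assms by (intro dirichlet_sum_prime_mult) auto
  finally have "?S (coprime_set (insert q P)) = (1 - of_nat q powr (-s)) * ?S (coprime_set P)"
    by (simp add: algebra_simps)
  thus ?case using insert by simp
qed

lemma moebius_euler_factor:
  assumes "finite P" "\<forall>p\<in>P. prime p" "Re s > 1"
  shows "moebius_series s = (\<Prod>q\<in>P. 1 - of_nat q powr (-s)) * dirichlet_sum (\<lambda>n. of_int (moebius_mu n)) (coprime_set P) s"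
  using assms(1,2)
proof (induction P rule: finite_induct)
  case empty
  have "coprime_set {} = {0<..}" by (auto simp: coprime_set_def)
  thus ?case by (simp add: moebius_series_def)
next
  case (insert q P)
  let ?S = "\<lambda>A. dirichlet_sum (\<lambda>n. of_int (moebius_mu n)) A s"
  \<comment> \<open>The multiples of \<open>q\<close> are split into those divisible by
    \<open>q\<close> once, a copy of \<open>?Q\<close>, and \<open>?D\<close>, the multiples of
    \<open>q * q\<close>, where the Moebius function vanishes.\<close>
  let ?Q = "coprime_set (insert q P)" and ?D = "(\<lambda>n. q * n) ` (coprime_set P - coprime_set (insert q P))"
  have inj: "inj (\<lambda>n. q * n)" using insert by (auto simp: inj_on_def)
  have split: "coprime_set P = (?Q \<union> (\<lambda>n. q * n) ` ?Q) \<union> ?D"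
  proof -
    have "?Q \<subseteq> coprime_set P" by (auto simp: coprime_set_def)
    hence "(\<lambda>n. q * n) ` coprime_set P = (\<lambda>n. q * n) ` ?Q \<union> ?D" by auto
    thus ?thesis using coprime_set_split(1)[of q P] insert by auto
  qed
  have "?S ?D = infsum (\<lambda>_. 0) ?D"
    unfolding dirichlet_sum_def
    using insert by (intro infsum_cong) (auto simp: coprime_set_def moebius_mu_prime_mult_eq_0)
  hence D: "?S ?D = 0" by simp
  have disj: "(?Q \<union> (\<lambda>n. q * n) ` ?Q) \<inter> ?D = {}" "?Q \<inter> (\<lambda>n. q * n) ` ?Q = {}"
    using insert by (auto simp: coprime_set_def)
  have "?S (coprime_set P) = ?S ?Q + ?S ((\<lambda>n. q * n) ` ?Q) + ?S ?D"
    by (subst split) (use disj assms norm_moebius_mu_le_1 in \<open>simp add: dirichlet_sum_union del: norm_of_int\<close>)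
  also have "?S ((\<lambda>n. q * n) ` ?Q) = (-1) * of_nat q powr (-s) * ?S ?Q"
    using insert assms norm_moebius_mu_le_1
    by (intro dirichlet_sum_prime_mult) (auto simp: coprime_set_def moebius_mu_prime_mult simp del: norm_of_int)
  finally have "?S (coprime_set P) = (1 - of_nat q powr (-s)) * ?S ?Q"
    using D by (simp add: algebra_simps)
  thus ?case using insert by simp
qed

lemma powr_tail_tendsto_0:
  fixes \<sigma> :: real
  assumes "\<sigma> > 1"
  shows "(\<lambda>N. real (Suc N) powr (1 - \<sigma>) / (\<sigma> - 1)) \<longlonglongrightarrow> 0"
  using assms by real_asymp

text \<open>The finite product is multiplied onto \<open>zeta s\<close>, so that neither an infinite
  product nor \<open>zeta s \<noteq> 0\<close> has to be available beforehand.\<close>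

lemma euler_product:
  assumes "Re s > 1"
  shows "(\<lambda>N. (\<Prod>q\<in>primes_le (real (Suc N)). 1 - of_nat q powr (-s)) * zeta s) \<longlonglongrightarrow> 1"
proof (rule LIM_zero_cancel, rule Lim_null_comparison)
  have "((\<Prod>q\<in>primes_le (real (Suc N)). 1 - of_nat q powr (-s)) * zeta s) =
      dirichlet_sum (\<lambda>_. 1) (coprime_set (primes_le (real (Suc N)))) s" for N
    using assms by (subst zeta_euler_factor) (simp_all, simp add: primes_le_def)
  thus "\<forall>\<^sub>F N in sequentially. norm ((\<Prod>q\<in>primes_le (real (Suc N)). 1 - of_nat q powr (-s)) * zeta s - 1)
     \<le> real (Suc N) powr (1 - Re s) / (Re s - 1)"
    using norm_dirichlet_sum_coprime_sub_1_le[of "\<lambda>_. 1" s "Suc _"] assms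
    by (intro always_eventually allI) simp
qed (rule powr_tail_tendsto_0[OF assms])

text \<open>The finite product \<open>?E N\<close> times the rough Moebius series
  \<open>?M N\<close> is \<open>moebius_series s\<close> for every \<open>N\<close>, while
  \<open>?E N * zeta s\<close> and \<open>?M N\<close> both tend to 1.\<close>

lemma zeta_mult_moebius_series:
  assumes "Re s > 1"
  shows "zeta s * moebius_series s = 1"
proof -
  let ?M = "\<lambda>N. dirichlet_sum (\<lambda>n. of_int (moebius_mu n)) (coprime_set (primes_le (real (Suc N)))) s"
  let ?E = "\<lambda>N. \<Prod>q\<in>primes_le (real (Suc N)). 1 - of_nat q powr (-s)"
  have "(\<lambda>N. ?M N) \<longlonglongrightarrow> 1"
  proof (rule LIM_zero_cancel, rule Lim_null_comparison)
    show "\<forall>\<^sub>F N in sequentially. norm (?M N - 1) \<le> real (Suc N) powr (1 - Re s) / (Re s - 1)"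
      using norm_dirichlet_sum_coprime_sub_1_le[of "\<lambda>n. of_int (moebius_mu n)" s "Suc _"] assms norm_moebius_mu_le_1
      by (intro always_eventually allI) (simp del: norm_of_int)
  qed (rule powr_tail_tendsto_0[OF assms])
  hence "(\<lambda>N. ?E N * zeta s * ?M N) \<longlonglongrightarrow> 1 * 1"
    by (intro tendsto_mult euler_product assms)
  moreover have "?E N * zeta s * ?M N = zeta s * moebius_series s" for N
    using assms by (subst moebius_euler_factor[of "primes_le (real (Suc N))"]) (simp_all, simp add: primes_le_def)
  ultimately have "(\<lambda>N::nat. zeta s * moebius_series s) \<longlonglongrightarrow> 1 * 1" by (simp only:)
  thus ?thesis by (simp add: LIMSEQ_const_iff)
qed

section \<open>The zeta function near the line \<open>Re s = 1\<close>\<close>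

text \<open>For \<open>Re s > 1\<close> the series telescopes to \<open>(s - 1) \<zeta>(s)\<close>. Its terms compare \<open>n powr (-s)\<close> with the integral
  over \<open>[n, n + 1]\<close>, so it converges further to the left, and there is no pole.\<close>

definition zeta_term :: "nat \<Rightarrow> complex \<Rightarrow> complex" where
  "zeta_term n s = (s - 1) * of_nat (Suc n) powr (-s) + of_nat (Suc (Suc n)) powr (1 - s) - of_nat (Suc n) powr (1 - s)"

text \<open>The leading 1 offsets the boundary term of the telescoping powers. This is the
  continuation of \<open>(s - 1) * zeta s\<close> and stands in for \<open>zeta\<close> to the left
  of the line.\<close>

definition reg_zeta :: "complex \<Rightarrow> complex" where
  "reg_zeta s = 1 + (\<Sum>n. zeta_term n s)"

lemma norm_of_real_powr:
  assumes "t > 0"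
  shows "norm (complex_of_real t powr s) = t powr Re s"
  using assms by (simp add: norm_powr_real_powr)

text \<open>Interpolation with weight \<open>\<theta>\<close> between the trivial bound
  \<open>2 * m powr (- Re s)\<close> and the derivative bound
  \<open>norm s * m powr (- Re s - 1)\<close>; the case split picks the smaller order.\<close>

lemma norm_powr_diff_le:
  fixes m t :: real
  assumes "m \<ge> 1" "m \<le> t" "t \<le> m + 1" "Re s \<ge> 0" "0 \<le> \<theta>" "\<theta> \<le> 1"
  shows "norm (complex_of_real m powr (-s) - complex_of_real t powr (-s)) \<le> 2 * norm s powr \<theta> * m powr (- Re s - \<theta>)"
proof (cases "norm s \<le> m")
  case True
  let ?S = "closed_segment (complex_of_real m) (complex_of_real t)"
  have S: "\<exists>u. z = of_real u \<and> m \<le> u \<and> u \<le> t" if z: "z \<in> ?S" for z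
  proof -
    obtain u where u: "z = of_real u" "u \<in> closed_segment m t"
      by (rule imageE[OF z[unfolded closed_segment_of_real]])
    moreover have "m \<le> u" "u \<le> t"
      using u(2) assms(2) by (simp_all add: closed_segment_eq_real_ivl1)
    ultimately show ?thesis by blast
  qed
  have "norm (complex_of_real t powr (-s) - complex_of_real m powr (-s)) \<le> (norm s * m powr (- Re s - 1)) * norm (complex_of_real t - complex_of_real m)"
  proof (rule field_differentiable_bound[where S = ?S and f = "\<lambda>z. z powr (-s)" and f' = "\<lambda>z. -s * z powr (-s - 1)"])
    show "((\<lambda>z. z powr (-s)) has_field_derivative (-s * z powr (-s - 1))) (at z within ?S)" if z: "z \<in> ?S" for z
      by (rule has_field_derivative_at_within, intro has_field_derivative_powr)
         (use S[OF z] assms in \<open>auto simp: complex_nonpos_Reals_iff\<close>)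
    show "norm (-s * z powr (-s - 1)) \<le> norm s * m powr (- Re s - 1)" if z: "z \<in> ?S" for z
    proof -
      obtain u where u: "z = of_real u" "m \<le> u" "u \<le> t" using S[OF z] by blast
      have "norm (z powr (-s - 1)) = u powr (- Re s - 1)"
        using u assms by (simp add: norm_of_real_powr)
      also have "\<dots> \<le> m powr (- Re s - 1)"
        using u assms by (intro powr_mono2') auto
      finally show ?thesis by (simp add: norm_mult mult_left_mono)
    qed
  qed auto
  also have "\<dots> \<le> (norm s * m powr (- Re s - 1)) * 1"
  proof (rule mult_left_mono)
    have "norm (complex_of_real t - complex_of_real m) = \<bar>t - m\<bar>"
      by (metis norm_of_real of_real_diff)
    thus "norm (complex_of_real t - complex_of_real m) \<le> 1" using assms by simp
  qed auto
  also have "\<dots> = norm s * m powr (- Re s - 1)" by simp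
  also have "\<dots> = m powr (- Re s) * (norm s / m)"
    using assms by (simp add: powr_diff)
  also have "\<dots> \<le> m powr (- Re s) * (norm s / m) powr \<theta>"
  proof (rule mult_left_mono)
    have "(norm s / m) powr 1 \<le> (norm s / m) powr \<theta>"
      using True assms by (intro powr_mono') auto
    thus "norm s / m \<le> (norm s / m) powr \<theta>"
      using assms by simp
  qed auto
  also have "\<dots> = norm s powr \<theta> * m powr (- Re s - \<theta>)"
    using assms by (simp add: powr_divide powr_diff)
  also have "\<dots> \<le> 2 * norm s powr \<theta> * m powr (- Re s - \<theta>)" by simp
  finally show ?thesis by (simp add: norm_minus_commute)
next
  case False
  have "norm (complex_of_real m powr (-s) - complex_of_real t powr (-s)) \<le> m powr (- Re s) + t powr (- Re s)"
    using norm_triangle_ineq4[of "complex_of_real m powr (-s)" "complex_of_real t powr (-s)"] assms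
    by (simp add: norm_of_real_powr)
  moreover have "t powr (- Re s) \<le> m powr (- Re s)"
    using assms by (intro powr_mono2') auto
  ultimately have "norm (complex_of_real m powr (-s) - complex_of_real t powr (-s)) \<le> 2 * m powr (- Re s) * 1" by simp
  also have "\<dots> \<le> 2 * m powr (- Re s) * (norm s / m) powr \<theta>"
    using False assms by (intro mult_left_mono ge_one_powr_ge_zero) auto
  also have "\<dots> = 2 * norm s powr \<theta> * m powr (- Re s - \<theta>)"
    using assms by (simp add: powr_divide powr_diff)
  finally show ?thesis .
qed

lemma norm_zeta_term_le:
  assumes "Re s \<ge> 0" "0 \<le> \<theta>" "\<theta> \<le> 1"
  shows "norm (zeta_term n s) \<le> 2 * norm (s - 1) * norm s powr \<theta> * real (Suc n) powr (- Re s - \<theta>)"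
proof -
  define m where "m = real (Suc n)"
  have m: "m \<ge> 1" by (simp add: m_def)
  let ?S = "closed_segment (complex_of_real m) (complex_of_real (m + 1))"
  \<comment> \<open>The increment of \<open>?f\<close> over the unit interval is
    \<open>zeta_term n s\<close>, and its derivative is \<open>s - 1\<close> times a difference that
    \<open>norm_powr_diff_le\<close> controls.\<close>
  let ?f = "\<lambda>z. z powr (1 - s) + (s - 1) * of_real m powr (-s) * z"
  have S: "\<exists>u. z = of_real u \<and> m \<le> u \<and> u \<le> m + 1" if z: "z \<in> ?S" for z
  proof -
    obtain u where u: "z = of_real u" "u \<in> closed_segment m (m + 1)"
      by (rule imageE[OF z[unfolded closed_segment_of_real]])
    moreover have "m \<le> u" "u \<le> m + 1"
      using u(2) by (simp_all add: closed_segment_eq_real_ivl1)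
    ultimately show ?thesis by blast
  qed
  have "norm (?f (of_real (m + 1)) - ?f (of_real m)) \<le>
      (norm (s - 1) * (2 * norm s powr \<theta> * m powr (- Re s - \<theta>))) * norm (complex_of_real (m + 1) - complex_of_real m)"
  proof (rule field_differentiable_bound[where S = ?S and f = ?f and f' = "\<lambda>z. (1 - s) * z powr (1 - s - 1) + (s - 1) * of_real m powr (-s)"])
    show "(?f has_field_derivative ((1 - s) * z powr (1 - s - 1) + (s - 1) * of_real m powr (-s))) (at z within ?S)" if z: "z \<in> ?S" for z
      by (rule has_field_derivative_at_within, intro DERIV_add has_field_derivative_powr DERIV_cmult_Id)
         (use S[OF z] m in \<open>auto simp: complex_nonpos_Reals_iff\<close>)
    show "norm ((1 - s) * z powr (1 - s - 1) + (s - 1) * of_real m powr (-s)) \<le> norm (s - 1) * (2 * norm s powr \<theta> * m powr (- Re s - \<theta>))" if z: "z \<in> ?S" for z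
    proof -
      obtain u where u: "z = of_real u" "m \<le> u" "u \<le> m + 1" using S[OF z] by blast
      have "(1 - s) * z powr (1 - s - 1) + (s - 1) * of_real m powr (-s) = (s - 1) * (of_real m powr (-s) - z powr (-s))"
        by (simp add: algebra_simps)
      also have "norm \<dots> \<le> norm (s - 1) * (2 * norm s powr \<theta> * m powr (- Re s - \<theta>))"
        unfolding norm_mult using u m assms by (intro mult_left_mono) (auto intro!: norm_powr_diff_le)
      finally show ?thesis .
    qed
  qed auto
  moreover have "?f (of_real (m + 1)) - ?f (of_real m) = zeta_term n s"
    by (simp add: zeta_term_def m_def algebra_simps)
  ultimately show ?thesis by (simp add: m_def mult.assoc mult.left_commute)
qed

text \<open>The choice \<open>\<theta> = 1/20\<close> makes the series converge for \<open>Re s \<ge> 39/40\<close> while \<open>\<zeta>(s)\<close> grows at most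
  like \<open>\<bar>s\<bar> powr (1/20)\<close>.\<close>

lemma norm_zeta_term_le':
  assumes "Re s \<ge> 39/40"
  shows "norm (zeta_term n s) \<le> 2 * norm (s - 1) * norm s powr (1/20) * real (Suc n) powr (-41/40)"
proof -
  have "norm (zeta_term n s) \<le> 2 * norm (s - 1) * norm s powr (1/20) * real (Suc n) powr (- Re s - 1/20)"
    using assms by (intro norm_zeta_term_le) auto
  \<comment> \<open>\<open>39/40 + 1/20 = 41/40\<close>, so the decay in \<open>n\<close> stays
    summable.\<close>
  also have "\<dots> \<le> 2 * norm (s - 1) * norm s powr (1/20) * real (Suc n) powr (-41/40)"
    using assms by (intro mult_left_mono powr_mono) auto
  finally show ?thesis .
qed

lemma summable_Suc_powr: "summable (\<lambda>n. real (Suc n) powr (-41/40))"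
  by (subst summable_Suc_iff) (simp add: summable_real_powr_iff)

lemma holomorphic_zeta_term [holomorphic_intros]: "zeta_term n holomorphic_on A"
  unfolding zeta_term_def by (intro holomorphic_intros) (auto simp: complex_nonpos_Reals_iff)

lemma holomorphic_reg_zeta: "reg_zeta holomorphic_on {s. Re s > 39/40}"
proof -
  let ?g = "\<lambda>s. \<Sum>n. zeta_term n s"
  have "open {s. Re s > 39/40}" by (rule open_halfspace_Re_gt)
  hence "?g holomorphic_on {s. Re s > 39/40}"
  proof (rule holomorphic_uniform_sequence)
    show "(\<lambda>s. \<Sum>n<N. zeta_term n s) holomorphic_on {s. Re s > 39/40}" for N
      by (intro holomorphic_intros)
    fix s :: complex assume s: "s \<in> {s. Re s > 39/40}"
    obtain d where d: "d > 0" "cball s d \<subseteq> {s. Re s > 39/40}"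
      using s \<open>open _\<close> open_contains_cball by blast
    have "uniform_limit (cball s d) (\<lambda>N x. \<Sum>n<N. zeta_term n x) ?g sequentially"
    proof (rule Weierstrass_m_test)
      fix n x assume x: "x \<in> cball s d"
      have n: "norm x \<le> norm s + d"
        using x norm_triangle_ineq2[of x s] by (simp add: dist_norm norm_minus_commute)
      have "norm (zeta_term n x) \<le> 2 * norm (x - 1) * norm x powr (1/20) * real (Suc n) powr (-41/40)"
        using x d by (intro norm_zeta_term_le') auto
      also have "\<dots> \<le> 2 * (norm s + d + 1) * (norm s + d) powr (1/20) * real (Suc n) powr (-41/40)"
        using n norm_triangle_ineq4[of x 1] d(1) norm_ge_zero[of s]
        by (intro mult_right_mono mult_mono powr_mono2) auto
      finally show "norm (zeta_term n x) \<le> 2 * (norm s + d + 1) * (norm s + d) powr (1/20) * real (Suc n) powr (-41/40)" .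
    qed (intro summable_mult summable_Suc_powr)
    thus "\<exists>d>0. cball s d \<subseteq> {s. Re s > 39/40} \<and> uniform_limit (cball s d) (\<lambda>N x. \<Sum>n<N. zeta_term n x) ?g sequentially"
      using d by blast
  qed
  thus ?thesis unfolding reg_zeta_def[abs_def] by (intro holomorphic_intros)
qed

lemma reg_zeta_1: "reg_zeta 1 = 1"
proof -
  have "zeta_term n 1 = 0" for n
    by (simp add: zeta_term_def of_nat_neq_0 del: of_nat_Suc)
  thus ?thesis by (simp add: reg_zeta_def)
qed

lemma zeta_sums:
  assumes "Re s > 1"
  shows "(\<lambda>n. of_nat (Suc n) powr (-s)) sums zeta s"
proof -
  have "((\<lambda>n. 1 * of_nat n powr (-s)) has_sum zeta s) {0<..}"
    unfolding zeta_def dirichlet_sum_def using assms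
    by (intro has_sum_infsum summable_dirichlet) auto
  moreover have "{0<..} = range Suc" by (auto simp: image_iff gr0_conv_Suc)
  ultimately have "((\<lambda>n. of_nat (Suc n) powr (-s)) has_sum zeta s) UNIV"
    by (simp add: has_sum_reindex o_def)
  thus ?thesis by (rule has_sum_imp_sums)
qed

lemma reg_zeta_eq:
  assumes "Re s > 1"
  shows "reg_zeta s = (s - 1) * zeta s"
proof -
  have "(\<lambda>n. of_nat (Suc n) powr (1 - s) :: complex) \<longlonglongrightarrow> 0"
  proof (rule tendsto_norm_zero_cancel)
    have "(\<lambda>n. real (Suc n) powr (1 - Re s)) \<longlonglongrightarrow> 0" using assms by real_asymp
    thus "(\<lambda>n. norm (of_nat (Suc n) powr (1 - s) :: complex)) \<longlonglongrightarrow> 0" by (simp del: of_nat_Suc)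
  qed
  from telescope_sums[OF this]
  have "(\<lambda>n. of_nat (Suc (Suc n)) powr (1 - s) - of_nat (Suc n) powr (1 - s)) sums (0 - 1 :: complex)" by simp
  from sums_add[OF sums_mult[OF zeta_sums[OF assms], of "s - 1"] this]
  have "(\<lambda>n. zeta_term n s) sums ((s - 1) * zeta s - 1)"
    by (simp add: zeta_term_def add_diff_eq)
  thus ?thesis by (simp add: reg_zeta_def sums_iff)
qed

lemma reg_zeta_bound:
  obtains C where "C > 0"
    "\<And>s T. Re s \<ge> 39/40 \<Longrightarrow> norm s \<le> T \<Longrightarrow> T \<ge> 1 \<Longrightarrow> norm (reg_zeta s) \<le> C * T powr (21/20)"
proof -
  define c where "c = (\<Sum>n. real (Suc n) powr (-41/40))"
  have c: "c \<ge> 0" unfolding c_def by (intro suminf_nonneg summable_Suc_powr) auto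
  have "norm (reg_zeta s) \<le> (1 + 4 * c) * T powr (21/20)"
    if s: "Re s \<ge> 39/40" "norm s \<le> T" "T \<ge> 1" for s T
  proof -
    have "norm (\<Sum>n. zeta_term n s) \<le> (\<Sum>n. 2 * norm (s - 1) * norm s powr (1/20) * real (Suc n) powr (-41/40))"
      by (rule norm_suminf_le[OF norm_zeta_term_le'[OF s(1)]]) (intro summable_mult summable_Suc_powr)
    also have "\<dots> = 2 * norm (s - 1) * norm s powr (1/20) * c"
      unfolding c_def by (rule suminf_mult[OF summable_Suc_powr])
    also have "\<dots> \<le> 2 * (2 * T) * T powr (1/20) * c"
      using s c norm_triangle_ineq4[of s 1] by (intro mult_mono powr_mono2) auto
    also have "\<dots> = 4 * c * T powr (21/20)"
      using s powr_add[of T 1 "1/20"] by simp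
    finally have "norm (reg_zeta s) \<le> 1 + 4 * c * T powr (21/20)"
      unfolding reg_zeta_def using norm_triangle_ineq[of 1 "\<Sum>n. zeta_term n s"] by simp
    also have "1 \<le> T powr (21/20)" using s by (intro ge_one_powr_ge_zero) auto
    finally show ?thesis by (simp add: algebra_simps)
  qed
  thus ?thesis using c by (intro that[of "1 + 4 * c"]) auto
qed

text \<open>Cauchy's inequality on circles of radius \<open>1/100\<close>, on which
  \<open>Re\<close> is at least \<open>98/100 > 39/40\<close> and the norm at most
  \<open>2 * T\<close>.\<close>

lemma deriv_reg_zeta_bound:
  obtains C where "C > 0"
    "\<And>s T. Re s \<ge> 99/100 \<Longrightarrow> norm s \<le> T \<Longrightarrow> T \<ge> 1 \<Longrightarrow> norm (deriv reg_zeta s) \<le> C * T powr (21/20)"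
proof -
  obtain C where C: "C > 0" "\<And>s T. Re s \<ge> 39/40 \<Longrightarrow> norm s \<le> T \<Longrightarrow> T \<ge> 1 \<Longrightarrow> norm (reg_zeta s) \<le> C * T powr (21/20)"
    using reg_zeta_bound by blast
  have "norm (deriv reg_zeta s) \<le> (100 * C * 2 powr (21/20)) * T powr (21/20)"
    if s: "Re s \<ge> 99/100" "norm s \<le> T" "T \<ge> 1" for s T
  proof -
    have sub: "cball s (1/100) \<subseteq> {s. Re s > 39/40}"
    proof
      fix z assume "z \<in> cball s (1/100)"
      hence "\<bar>Re (s - z)\<bar> \<le> 1/100"
        using abs_Re_le_cmod[of "s - z"] by (simp add: dist_norm)
      thus "z \<in> {s. Re s > 39/40}" using s(1) unfolding mem_Collect_eq minus_complex.sel by linarith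
    qed
    have "norm ((deriv ^^ 1) reg_zeta s) \<le> fact 1 * (C * (2 * T) powr (21/20)) / (1/100) ^ 1"
    proof (rule Cauchy_inequality)
      show "reg_zeta holomorphic_on ball s (1/100)"
        by (rule holomorphic_on_subset[OF holomorphic_reg_zeta]) (use sub ball_subset_cball in blast)
      show "continuous_on (cball s (1/100)) reg_zeta"
        by (rule continuous_on_subset[OF holomorphic_on_imp_continuous_on[OF holomorphic_reg_zeta] sub])
      fix x assume x: "norm (s - x) = 1/100"
      hence "x \<in> cball s (1/100)" by (simp add: dist_norm)
      hence "Re x > 39/40" using sub by auto
      moreover have "norm x \<le> 2 * T"
        using x s norm_triangle_ineq2[of x s] by (simp add: norm_minus_commute)
      ultimately show "norm (reg_zeta x) \<le> C * (2 * T) powr (21/20)"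
        using C(2)[of x "2 * T"] s by simp
    qed auto
    thus ?thesis using s by (simp add: powr_mult)
  qed
  thus ?thesis using C(1) by (intro that[of "100 * C * 2 powr (21/20)"]) auto
qed

section \<open>The 3-4-1 inequality and lower bounds for zeta\<close>

lemma Re_of_real_mult': "Re (of_real a * z) = a * Re z"
  by simp

lemma norm_one_minus_of_real:
  assumes "r < 1"
  shows "norm (1 - complex_of_real r) = 1 - r"
proof -
  have "1 - complex_of_real r = of_real (1 - r)" by simp
  thus ?thesis using assms by (simp only: norm_of_real)
qed

text \<open>Expand each \<open>ln (norm (1 - r v))\<close> into the sum of
  \<open>- r^n Re (v^n) / n\<close>. The weights 3, 4, 1 combine to
  \<open>3 + 4 Re (w^n) + Re (w^(2n)) = 2 (1 + Re (w^n))^2\<close>. For a prime \<open>q\<close>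
  this is applied with \<open>r = q powr (-\<sigma>)\<close> and
  \<open>w = q powr (-it)\<close>.\<close>

lemma three_four_one_factor:
  fixes r :: real and w :: complex
  assumes "0 < r" "r < 1" "norm w = 1"
  shows "(1 - r) ^ 3 * norm (1 - of_real r * w) ^ 4 * norm (1 - of_real r * w\<^sup>2) \<le> 1"
proof -
  \<comment> \<open>The term for \<open>n = 0\<close> is a division by zero and therefore 0.\<close>
  have log_series: "(\<lambda>n. - (r ^ n * Re (v ^ n)) / real n) sums ln (norm (1 - of_real r * v))"
    and pos: "norm (1 - of_real r * v) > 0" if "norm v = 1" for v :: complex
  proof -
    have z: "norm (- of_real r * v) < 1"
      using assms that by (simp add: norm_mult)
    have nz: "1 - of_real r * v \<noteq> 0"
      using z by auto
    thus "norm (1 - of_real r * v) > 0" by simp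
    have "(\<lambda>n. (-1) ^ Suc n / of_nat n * (- of_real r * v) ^ n) sums Ln (1 + - of_real r * v)"
      by (rule Ln_series[OF z])
    hence "(\<lambda>n. Re ((-1) ^ Suc n / of_nat n * (- of_real r * v) ^ n)) sums Re (Ln (1 + - of_real r * v))"
      by (rule sums_Re)
    also have "(\<lambda>n. Re ((-1) ^ Suc n / of_nat n * (- of_real r * v) ^ n)) = (\<lambda>n. - (r ^ n * Re (v ^ n)) / real n)"
    proof
      fix n
      have "(-1) ^ Suc n / of_nat n * (- of_real r * v) ^ n = (-1) ^ Suc n * (-1) ^ n * (of_real (r ^ n) * v ^ n) / of_nat n"
        by (simp add: power_mult_distrib power_minus[of "of_real r * v"])
      also have "(-1) ^ Suc n * (-1) ^ n = (-1 :: complex)"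
        by (simp flip: power_mult_distrib)
      finally have "(-1) ^ Suc n / of_nat n * (- of_real r * v) ^ n = of_real (- (r ^ n) / real n) * v ^ n"
        by simp
      hence "Re ((-1) ^ Suc n / of_nat n * (- of_real r * v) ^ n) = Re (of_real (- (r ^ n) / real n) * v ^ n)"
        by (simp only:)
      thus "Re ((-1) ^ Suc n / of_nat n * (- of_real r * v) ^ n) = - (r ^ n * Re (v ^ n)) / real n"
        by (simp only: Re_of_real_mult') simp
    qed
    also have "Re (Ln (1 + - of_real r * v)) = ln (norm (1 - of_real r * v))"
      using nz by (simp add: Re_Ln)
    finally show "(\<lambda>n. - (r ^ n * Re (v ^ n)) / real n) sums ln (norm (1 - of_real r * v))" .
  qed
  have w2: "norm (w\<^sup>2) = 1" using assms by (simp add: norm_power)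
  have A: "(\<lambda>n. 3 * (- (r ^ n * Re ((1::complex) ^ n)) / real n) + 4 * (- (r ^ n * Re (w ^ n)) / real n) + (- (r ^ n * Re ((w\<^sup>2) ^ n)) / real n))
      sums (3 * ln (norm (1 - of_real r * (1::complex))) + 4 * ln (norm (1 - of_real r * w)) + ln (norm (1 - of_real r * w\<^sup>2)))"
    using assms w2 by (intro sums_add sums_mult log_series) simp_all
  have B: "3 * (- (r ^ n * Re ((1::complex) ^ n)) / real n) + 4 * (- (r ^ n * Re (w ^ n)) / real n) + (- (r ^ n * Re ((w\<^sup>2) ^ n)) / real n) \<le> 0" for n
  proof -
    have "norm (w ^ n) = 1" using assms by (simp add: norm_power)
    hence "(Re (w ^ n))\<^sup>2 + (Im (w ^ n))\<^sup>2 = 1" using cmod_power2[of "w ^ n"] by simp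
    moreover have "Re ((w\<^sup>2) ^ n) = (Re (w ^ n))\<^sup>2 - (Im (w ^ n))\<^sup>2"
      by (simp add: power_mult[symmetric] mult.commute[of 2 n]) (simp add: power_mult power2_eq_square)
    ultimately have "3 + 4 * Re (w ^ n) + Re ((w\<^sup>2) ^ n) = 2 * (1 + Re (w ^ n))\<^sup>2"
      by (simp add: power2_eq_square algebra_simps)
    hence *: "3 + 4 * Re (w ^ n) + Re ((w\<^sup>2) ^ n) \<ge> 0" by simp
    have "3 * (- (r ^ n * Re ((1::complex) ^ n)) / real n) + 4 * (- (r ^ n * Re (w ^ n)) / real n) + (- (r ^ n * Re ((w\<^sup>2) ^ n)) / real n)
        = - (r ^ n * (3 + 4 * Re (w ^ n) + Re ((w\<^sup>2) ^ n)) / real n)"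
      by (simp add: algebra_simps add_divide_distrib diff_divide_distrib)
    thus ?thesis using * assms by simp
  qed
  have le: "3 * ln (norm (1 - of_real r * (1::complex))) + 4 * ln (norm (1 - of_real r * w)) + ln (norm (1 - of_real r * w\<^sup>2)) \<le> 0"
    using sums_le[OF B A sums_zero] by simp
  have n1: "norm (1 - of_real r * (1::complex)) = 1 - r"
    using assms by (simp add: norm_one_minus_of_real)
  have p: "norm (1 - of_real r * w) > 0" "norm (1 - of_real r * w\<^sup>2) > 0" "1 - r > 0"
    using pos[OF assms(3)] pos[OF w2] assms by auto
  have "ln ((1 - r) ^ 3 * norm (1 - of_real r * w) ^ 4 * norm (1 - of_real r * w\<^sup>2)) \<le> 0"
    using le p by (simp add: ln_mult ln_realpow n1[simplified] del: power2_eq_square)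
  thus ?thesis using p by (subst (asm) ln_le_zero_iff) (auto intro!: mult_pos_pos)
qed

text \<open>The combination of the finite products is at most 1, prime by prime. Multiplied by the
  zeta values it tends to 1, so the zeta values must make up for it.\<close>

lemma three_four_one:
  fixes \<sigma> t :: real
  assumes "\<sigma> > 1"
  shows "norm (zeta (of_real \<sigma>)) ^ 3 * norm (zeta (Complex \<sigma> t)) ^ 4 * norm (zeta (Complex \<sigma> (2 * t))) \<ge> 1"
proof -
  let ?E = "\<lambda>s N. \<Prod>q\<in>primes_le (real (Suc N)). 1 - of_nat q powr (-s)"
  let ?s1 = "complex_of_real \<sigma>" and ?s2 = "Complex \<sigma> t" and ?s3 = "Complex \<sigma> (2 * t)"
  have lim: "(\<lambda>N. norm (?E s N * zeta s)) \<longlonglongrightarrow> 1" if "Re s > 1" for s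
    using tendsto_norm[OF euler_product[OF that]] by simp
  have "(\<lambda>N. norm (?E ?s1 N * zeta ?s1) ^ 3 * norm (?E ?s2 N * zeta ?s2) ^ 4 * norm (?E ?s3 N * zeta ?s3)) \<longlonglongrightarrow> 1 ^ 3 * 1 ^ 4 * 1"
    using assms by (intro tendsto_mult tendsto_power lim) auto
  hence L: "(\<lambda>N. norm (?E ?s1 N * zeta ?s1) ^ 3 * norm (?E ?s2 N * zeta ?s2) ^ 4 * norm (?E ?s3 N * zeta ?s3)) \<longlonglongrightarrow> 1"
    by simp
  have E: "norm (?E ?s1 N) ^ 3 * norm (?E ?s2 N) ^ 4 * norm (?E ?s3 N) \<le> 1" for N
  proof -
    have "norm (?E ?s1 N) ^ 3 * norm (?E ?s2 N) ^ 4 * norm (?E ?s3 N) =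
       (\<Prod>q\<in>primes_le (real (Suc N)). norm (1 - of_nat q powr (-?s1)) ^ 3 * norm (1 - of_nat q powr (-?s2)) ^ 4 * norm (1 - of_nat q powr (-?s3)))"
      by (simp only: prod.distrib prod_power_distrib prod_norm[symmetric])
    also have "\<dots> \<le> 1"
    proof (rule prod_le_1)
      fix q assume "q \<in> primes_le (real (Suc N))"
      hence "prime q" by (simp add: primes_le_def)
      hence q: "q > 1" by (rule prime_gt_1_nat)
      define r where "r = real q powr (-\<sigma>)"
      define w where "w = complex_of_nat q powr (Complex 0 (-t))"
      have r: "0 < r" "r < 1" using q assms by (auto simp: r_def powr_less_one)
      have w: "norm w = 1" using q by (simp add: w_def)
      have qr: "complex_of_nat q powr (-?s1) = of_real r"
        using powr_of_real[of "real q" "-\<sigma>"] by (simp add: r_def)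
      have "-?s2 = -?s1 + Complex 0 (-t)" "-?s3 = -?s1 + (Complex 0 (-t) + Complex 0 (-t))"
        by (auto simp: complex_eq_iff)
      hence "complex_of_nat q powr (-?s2) = of_real r * w" "complex_of_nat q powr (-?s3) = of_real r * w\<^sup>2"
        using q by (simp_all only: powr_add qr w_def power2_eq_square)
      moreover have "norm (1 - complex_of_real r) = 1 - r"
        using r by (simp add: norm_one_minus_of_real)
      ultimately show "0 \<le> norm (1 - of_nat q powr (-?s1)) ^ 3 * norm (1 - of_nat q powr (-?s2)) ^ 4 * norm (1 - of_nat q powr (-?s3)) \<and>
          norm (1 - of_nat q powr (-?s1)) ^ 3 * norm (1 - of_nat q powr (-?s2)) ^ 4 * norm (1 - of_nat q powr (-?s3)) \<le> 1"
        using three_four_one_factor[OF r w]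
        by (intro conjI mult_nonneg_nonneg zero_le_power norm_ge_zero) (simp add: qr)
    qed
    finally show ?thesis .
  qed
  show ?thesis
  proof (rule LIMSEQ_le_const2[OF L], intro exI allI impI)
    fix N :: nat
    have "norm (?E ?s1 N * zeta ?s1) ^ 3 * norm (?E ?s2 N * zeta ?s2) ^ 4 * norm (?E ?s3 N * zeta ?s3)
        = (norm (?E ?s1 N) ^ 3 * norm (?E ?s2 N) ^ 4 * norm (?E ?s3 N)) * (norm (zeta ?s1) ^ 3 * norm (zeta ?s2) ^ 4 * norm (zeta ?s3))"
      by (simp only: norm_mult power_mult_distrib mult_ac)
    also have "\<dots> \<le> 1 * (norm (zeta ?s1) ^ 3 * norm (zeta ?s2) ^ 4 * norm (zeta ?s3))"
      by (intro mult_right_mono E) auto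
    finally show "norm (?E ?s1 N * zeta ?s1) ^ 3 * norm (?E ?s2 N * zeta ?s2) ^ 4 * norm (?E ?s3 N * zeta ?s3)
       \<le> norm (zeta ?s1) ^ 3 * norm (zeta ?s2) ^ 4 * norm (zeta ?s3)" by simp
  qed
qed

text \<open>The 3-4-1 inequality solved for its middle factor: \<open>zeta (1 + \<eta>)\<close> is
  at most \<open>K1 / \<eta>\<close>, the value at height \<open>2 * t\<close> at most
  \<open>K3 * R powr (1/20)\<close>, and fourth roots give the exponents \<open>3/4\<close> and
  \<open>-1/80\<close>. The distance \<open>r\<close> from the real axis keeps away from the
  pole.\<close>

lemma reg_zeta_lower_right:
  assumes r: "0 < r" "r \<le> 1"
  obtains A where "A > 0"
    "\<And>\<eta> t R. 0 < \<eta> \<Longrightarrow> \<eta> \<le> 1 \<Longrightarrow> r \<le> \<bar>t\<bar> \<Longrightarrow> \<bar>t\<bar> \<le> R \<Longrightarrow> R \<ge> 1 \<Longrightarrow>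
       norm (reg_zeta (Complex (1 + \<eta>) t)) \<ge> A * \<eta> powr (3/4) * \<bar>t\<bar> * R powr (-1/80)"
proof -
  obtain C where C: "C > 0" "\<And>s T. Re s \<ge> 39/40 \<Longrightarrow> norm s \<le> T \<Longrightarrow> T \<ge> 1 \<Longrightarrow> norm (reg_zeta s) \<le> C * T powr (21/20)"
    using reg_zeta_bound by blast
  \<comment> \<open>Chosen so that
    \<open>2 + 2 * \<bar>t\<bar> \<le> \<kappa> * \<bar>t\<bar>\<close> once
    \<open>\<bar>t\<bar> \<ge> r\<close>, which bounds the norm of \<open>?s3\<close> by a multiple
    of its height.\<close>
  define \<kappa> where "\<kappa> = 2 + 2 / r"
  define K1 where "K1 = C * 2 powr (21/20)"
  define K3 where "K3 = C * \<kappa> powr (21/20)"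
  have \<kappa>: "\<kappa> > 0" using r by (simp add: \<kappa>_def add_pos_pos)
  have K: "K1 > 0" "K3 > 0" using C \<kappa> by (auto simp: K1_def K3_def)
  define A where "A = (K1 ^ 3 * K3) powr (-1/4)"
  have "A > 0" using K by (simp add: A_def)
  moreover have "norm (reg_zeta (Complex (1 + \<eta>) t)) \<ge> A * \<eta> powr (3/4) * \<bar>t\<bar> * R powr (-1/80)"
    if \<eta>: "0 < \<eta>" "\<eta> \<le> 1" and t: "r \<le> \<bar>t\<bar>" "\<bar>t\<bar> \<le> R" "R \<ge> 1" for \<eta> t R
  proof -
    let ?s1 = "complex_of_real (1 + \<eta>)" and ?s2 = "Complex (1 + \<eta>) t" and ?s3 = "Complex (1 + \<eta>) (2 * t)"
    have t0: "\<bar>t\<bar> > 0" using t r by linarith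
    have z1: "norm (zeta ?s1) \<le> K1 / \<eta>"
    proof -
      have "norm (reg_zeta ?s1) \<le> C * 2 powr (21/20)"
        using \<eta> norm_of_real[of "1 + \<eta>", where 'a = complex] by (intro C(2)) (auto simp del: norm_of_real of_real_add)
      moreover have "norm (reg_zeta ?s1) = \<eta> * norm (zeta ?s1)"
        using \<eta> by (subst reg_zeta_eq) (auto simp: norm_mult)
      ultimately show ?thesis using \<eta> by (simp add: K1_def field_simps)
    qed
    have z2: "norm (zeta ?s2) \<le> norm (reg_zeta ?s2) / \<bar>t\<bar>"
    proof -
      have "\<bar>t\<bar> * norm (zeta ?s2) \<le> norm (?s2 - 1) * norm (zeta ?s2)"
        using abs_Im_le_cmod[of "?s2 - 1"] by (intro mult_right_mono) auto
      also have "\<dots> = norm (reg_zeta ?s2)"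
        using \<eta> by (subst reg_zeta_eq) (auto simp: norm_mult)
      finally show ?thesis using t0 by (simp add: field_simps)
    qed
    have z3: "norm (zeta ?s3) \<le> K3 * R powr (1/20)"
    proof -
      have T: "2 + 2 * \<bar>t\<bar> \<le> \<kappa> * \<bar>t\<bar>"
      proof -
        have "2 \<le> 2 / r * \<bar>t\<bar>" using t r by (simp add: field_simps)
        thus ?thesis by (simp add: \<kappa>_def algebra_simps)
      qed
      have "norm ?s3 \<le> \<bar>1 + \<eta>\<bar> + \<bar>2 * t\<bar>" using cmod_le[of ?s3] by simp
      hence "norm (reg_zeta ?s3) \<le> C * (\<kappa> * \<bar>t\<bar>) powr (21/20)"
        using T \<eta> by (intro C(2)) auto
      also have "\<dots> = K3 * \<bar>t\<bar> powr (1/20) * \<bar>t\<bar>"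
        using \<kappa> t0 powr_add[of "\<bar>t\<bar>" "1/20" 1] by (simp add: powr_mult K3_def)
      also have "\<dots> \<le> K3 * R powr (1/20) * \<bar>t\<bar>"
        using K t by (intro mult_right_mono mult_left_mono powr_mono2) auto
      finally have "norm (reg_zeta ?s3) \<le> K3 * R powr (1/20) * \<bar>t\<bar>" .
      moreover have "\<bar>t\<bar> * norm (zeta ?s3) \<le> norm (?s3 - 1) * norm (zeta ?s3)"
        using abs_Im_le_cmod[of "?s3 - 1"] by (intro mult_right_mono) auto
      moreover have "norm (?s3 - 1) * norm (zeta ?s3) = norm (reg_zeta ?s3)"
        using \<eta> by (subst reg_zeta_eq) (auto simp: norm_mult)
      ultimately have "\<bar>t\<bar> * norm (zeta ?s3) \<le> \<bar>t\<bar> * (K3 * R powr (1/20))" by (simp add: mult_ac)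
      thus ?thesis using t0 by simp
    qed
    let ?Z = "norm (reg_zeta ?s2)"
    have "1 \<le> norm (zeta ?s1) ^ 3 * norm (zeta ?s2) ^ 4 * norm (zeta ?s3)"
      using \<eta> by (intro three_four_one) auto
    also have "\<dots> \<le> (K1 / \<eta>) ^ 3 * (?Z / \<bar>t\<bar>) ^ 4 * (K3 * R powr (1/20))"
      using z1 z2 z3 \<eta> K by (intro mult_mono power_mono) auto
    also have "\<dots> = ?Z ^ 4 * (K1 ^ 3 * K3 * R powr (1/20)) / (\<eta> ^ 3 * \<bar>t\<bar> ^ 4)"
      by (simp add: power_divide)
    finally have le: "\<eta> ^ 3 * \<bar>t\<bar> ^ 4 \<le> ?Z ^ 4 * (K1 ^ 3 * K3 * R powr (1/20))"
      using \<eta> t0 by (simp add: le_divide_eq split: if_splits)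
    have p4: "(x powr a) ^ 4 = x powr (4 * a)" if "x > 0" for x a :: real
      using that powr_realpow[of "x powr a" 4] by (simp add: powr_powr mult.commute)
    have "(A * \<eta> powr (3/4) * \<bar>t\<bar> * R powr (-1/80)) ^ 4 = (K1 ^ 3 * K3) powr (-1) * \<eta> powr 3 * \<bar>t\<bar> ^ 4 * R powr (-1/20)"
      unfolding power_mult_distrib A_def using K \<eta> t by (simp add: p4)
    also have "\<dots> = (\<eta> ^ 3 * \<bar>t\<bar> ^ 4) / (K1 ^ 3 * K3 * R powr (1/20))"
      using K \<eta> t by (simp add: powr_minus divide_simps powr_numeral)
    also have "\<dots> \<le> ?Z ^ 4"
      using le K t by (simp add: divide_le_eq)
    finally show ?thesis
      using \<open>A > 0\<close> by (subst (asm) power_mono_iff) auto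
  qed
  ultimately show ?thesis by (rule that)
qed

text \<open>Near \<open>s = 1\<close> continuity and \<open>reg_zeta 1 = 1\<close> suffice.
  Elsewhere \<open>s\<close> is compared with \<open>1 + \<eta> + it\<close> at the same height: the
  value there has order \<open>\<eta>^(3/4) R^(-1/80) |t|\<close>, the derivative costs order
  \<open>\<eta> R^(1/20) |t|\<close>. As \<open>1/20 + 1/80 = 1/16\<close>, the choice
  \<open>\<eta> = c R^(-1/4)\<close> keeps the cost below half the value, and
  \<open>R^(-3/16 - 1/80) = R^(-1/5)\<close> remains.\<close>

lemma reg_zeta_lower:
  obtains c d :: real where "0 < c" "c \<le> 1/100" "d > 0"
    "\<And>R s. R \<ge> 1 \<Longrightarrow> \<bar>Re s - 1\<bar> \<le> c * R powr (-1/4) \<Longrightarrow> \<bar>Im s\<bar> \<le> R \<Longrightarrow>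
       norm (reg_zeta s) \<ge> d * (1 + \<bar>Im s\<bar>) * R powr (-1/5)"
proof -
  have op: "open {s. Re s > 39/40}" by (rule open_halfspace_Re_gt)
  have "continuous_on {s. Re s > 39/40} reg_zeta"
    by (rule holomorphic_on_imp_continuous_on[OF holomorphic_reg_zeta])
  moreover have "1 \<in> {s. Re s > 39/40}" by simp
  ultimately have "isCont reg_zeta 1"
    using continuous_on_eq_continuous_at[OF op] by blast
  then obtain r0 where r0: "r0 > 0" "\<And>s. dist s 1 < r0 \<Longrightarrow> dist (reg_zeta s) (reg_zeta 1) < 1/2"
    unfolding continuous_at_eps_delta by (metis half_gt_zero zero_less_one)
  define r where "r = min 1 (r0 / 2)"
  have r: "0 < r" "r \<le> 1" "2 * r \<le> r0" using r0 by (auto simp: r_def)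
  obtain A where A: "A > 0" "\<And>\<eta> t R. 0 < \<eta> \<Longrightarrow> \<eta> \<le> 1 \<Longrightarrow> r \<le> \<bar>t\<bar> \<Longrightarrow> \<bar>t\<bar> \<le> R \<Longrightarrow> R \<ge> 1 \<Longrightarrow>
       norm (reg_zeta (Complex (1 + \<eta>) t)) \<ge> A * \<eta> powr (3/4) * \<bar>t\<bar> * R powr (-1/80)"
    using reg_zeta_lower_right[OF r(1,2)] by blast
  obtain D where D: "D > 0" "\<And>s T. Re s \<ge> 99/100 \<Longrightarrow> norm s \<le> T \<Longrightarrow> T \<ge> 1 \<Longrightarrow> norm (deriv reg_zeta s) \<le> D * T powr (21/20)"
    using deriv_reg_zeta_bound by blast
  define \<kappa> where "\<kappa> = 2 + 2 / r"
  have \<kappa>: "\<kappa> > 0" using r by (simp add: \<kappa>_def add_pos_pos)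
  define K where "K = 2 * D * \<kappa> powr (21/20)"
  have K: "K > 0" using D \<kappa> by (simp add: K_def)
  \<comment> \<open>The fourth power yields \<open>K * c powr (1/4) \<le> A / 2\<close>, the
    comparison of cost and value; \<open>1/100\<close> keeps the segment inside the range of the
    derivative bound, and \<open>r\<close> keeps points of small height close to 1.\<close>
  define c where "c = min (min (1/100) r) ((A / (2 * K)) ^ 4)"
  have c: "0 < c" "c \<le> 1/100" "c \<le> r" "c \<le> (A / (2 * K)) ^ 4"
    using r A K by (auto simp: c_def)
  define d where "d = min (1/4) (A / 2 * c powr (3/4) * (r / 2))"
  have d: "0 < d" "d \<le> 1/4" "d \<le> A / 2 * c powr (3/4) * (r / 2)"
    using r A c by (auto simp: d_def)
  have "norm (reg_zeta s) \<ge> d * (1 + \<bar>Im s\<bar>) * R powr (-1/5)"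
    if s: "R \<ge> 1" "\<bar>Re s - 1\<bar> \<le> c * R powr (-1/4)" "\<bar>Im s\<bar> \<le> R" for R s
  proof (cases "\<bar>Im s\<bar> < r")
    case True
    have Rle: "R powr (-1/4) \<le> 1" "R powr (-1/5) \<le> 1"
      using s powr_mono[of "-1/4" 0 R] powr_mono[of "-1/5" 0 R] by auto
    have "c * R powr (-1/4) \<le> c * 1"
      using c Rle by (intro mult_left_mono) auto
    with s(2) have "\<bar>Re s - 1\<bar> \<le> c * 1" by (rule order_trans)
    hence "\<bar>Re (s - 1)\<bar> \<le> r" using c by simp
    moreover have "dist s 1 \<le> \<bar>Re (s - 1)\<bar> + \<bar>Im (s - 1)\<bar>"
      unfolding dist_norm by (rule cmod_le)
    ultimately have "dist s 1 < r0" using True r by simp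
    hence "norm (reg_zeta s - 1) < 1/2" using r0(2)[of s] by (simp add: dist_norm reg_zeta_1)
    hence "norm (reg_zeta s) \<ge> 1/2" using norm_triangle_ineq2[of 1 "1 - reg_zeta s"]
      by (simp add: norm_minus_commute)
    moreover have "d * (1 + \<bar>Im s\<bar>) * R powr (-1/5) \<le> (1/4) * 2 * 1"
      using d True r Rle by (intro mult_mono) auto
    ultimately show ?thesis by simp
  next
    case False
    define t where "t = Im s"
    have t: "r \<le> \<bar>t\<bar>" "\<bar>t\<bar> \<le> R" "\<bar>t\<bar> > 0" using False s r by (auto simp: t_def)
    define \<eta> where "\<eta> = c * R powr (-1/4)"
    have Rle: "R powr (-1/4) \<le> 1"
      using s powr_mono[of "-1/4" 0 R] by auto
    have \<eta>: "0 < \<eta>" "\<eta> \<le> 1/100" "\<bar>Re s - 1\<bar> \<le> \<eta>"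
      using c s Rle mult_mono[OF c(2) Rle] by (auto simp: \<eta>_def)
    let ?s' = "Complex (1 + \<eta>) t"
    let ?S = "closed_segment s ?s'"
    have z: "Im z = t \<and> Re z \<ge> 99/100 \<and> Re z \<le> 2" if "z \<in> ?S" for z
    proof -
      have "?S \<subseteq> {z. Im z \<le> t} \<inter> {z. Im z \<ge> t} \<inter> {z. Re z \<ge> 99/100} \<inter> {z. Re z \<le> 2}"
        using \<eta> by (intro closed_segment_subset convex_Int convex_halfspace_Im_le convex_halfspace_Im_ge convex_halfspace_Re_le convex_halfspace_Re_ge)
          (auto simp: t_def abs_le_iff)
      from subsetD[OF this that] show ?thesis by auto
    qed
    have T: "2 + 2 * \<bar>t\<bar> \<le> \<kappa> * \<bar>t\<bar>"
    proof -
      have "2 \<le> 2 / r * \<bar>t\<bar>" using t r by (simp add: field_simps)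
      thus ?thesis by (simp add: \<kappa>_def algebra_simps)
    qed
    have "norm (reg_zeta s - reg_zeta ?s') \<le> (D * (\<kappa> * \<bar>t\<bar>) powr (21/20)) * norm (s - ?s')"
    proof (rule field_differentiable_bound[where S = ?S and f = reg_zeta and f' = "deriv reg_zeta"])
      fix z assume "z \<in> ?S"
      hence zt: "Im z = t" "Re z \<ge> 99/100" "Re z \<le> 2" using z by auto
      show "(reg_zeta has_field_derivative deriv reg_zeta z) (at z within ?S)"
        by (rule has_field_derivative_at_within, rule holomorphic_derivI[OF holomorphic_reg_zeta op]) (use zt in auto)
      show "norm (deriv reg_zeta z) \<le> D * (\<kappa> * \<bar>t\<bar>) powr (21/20)"
        using zt T cmod_le[of z] by (intro D(2)) auto
    qed auto
    also have "\<dots> \<le> (D * (\<kappa> * \<bar>t\<bar>) powr (21/20)) * (2 * \<eta>)"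
    proof (rule mult_left_mono)
      have "norm (s - ?s') \<le> \<bar>Re (s - ?s')\<bar> + \<bar>Im (s - ?s')\<bar>" by (rule cmod_le)
      also have "\<dots> \<le> 2 * \<eta>" using \<eta> by (simp add: t_def)
      finally show "norm (s - ?s') \<le> 2 * \<eta>" .
    qed (use D in auto)
    also have "\<dots> = K * \<eta> * \<bar>t\<bar> powr (1/20) * \<bar>t\<bar>"
      using \<kappa> t powr_add[of "\<bar>t\<bar>" "1/20" 1] by (simp add: powr_mult K_def)
    also have "\<dots> \<le> K * \<eta> * R powr (1/20) * \<bar>t\<bar>"
      using K \<eta> t by (intro mult_right_mono mult_left_mono powr_mono2) auto
    also have "\<dots> \<le> A / 2 * \<eta> powr (3/4) * R powr (-1/80) * \<bar>t\<bar>"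
    proof (rule mult_right_mono)
      have "c powr (1/4) \<le> ((A / (2 * K)) ^ 4) powr (1/4)"
        using c by (intro powr_mono2) auto
      also have "(A / (2 * K)) ^ 4 = (A / (2 * K)) powr 4"
        using A K by simp
      also have "\<dots> powr (1/4) = A / (2 * K)"
        using A K by (subst powr_powr) simp
      finally have ck: "K * c powr (1/4) \<le> A / 2" using K by (simp add: field_simps)
      have "\<eta> = \<eta> powr (3/4) * \<eta> powr (1/4)"
        using \<eta> by (simp flip: powr_add)
      also have "\<eta> powr (1/4) = c powr (1/4) * R powr (-1/16)"
        using c by (simp add: \<eta>_def powr_mult powr_powr)
      finally have e: "\<eta> = \<eta> powr (3/4) * (c powr (1/4) * R powr (-1/16))" .
      have R80: "R powr (-1/16) * R powr (1/20) = R powr (-1/80)"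
        by (simp flip: powr_add)
      have "K * \<eta> * R powr (1/20) = (K * c powr (1/4)) * \<eta> powr (3/4) * (R powr (-1/16) * R powr (1/20))"
        using arg_cong[OF e, of "\<lambda>x. K * x * R powr (1/20)"] by (simp only: mult_ac)
      also note R80
      also have "(K * c powr (1/4)) * \<eta> powr (3/4) * R powr (-1/80) \<le> (A / 2) * \<eta> powr (3/4) * R powr (-1/80)"
        using ck by (intro mult_right_mono) auto
      finally show "K * \<eta> * R powr (1/20) \<le> A / 2 * \<eta> powr (3/4) * R powr (-1/80)" .
    qed auto
    finally have diff: "norm (reg_zeta s - reg_zeta ?s') \<le> A / 2 * \<eta> powr (3/4) * R powr (-1/80) * \<bar>t\<bar>" .
    have "A * \<eta> powr (3/4) * \<bar>t\<bar> * R powr (-1/80) \<le> norm (reg_zeta ?s')"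
      using \<eta> t s by (intro A(2)) auto
    also have "norm (reg_zeta ?s') \<le> norm (reg_zeta s) + norm (reg_zeta s - reg_zeta ?s')"
      using norm_triangle_ineq4[of "reg_zeta s" "reg_zeta s - reg_zeta ?s'"] by simp
    finally have "norm (reg_zeta s) \<ge> A / 2 * (\<eta> powr (3/4) * R powr (-1/80)) * \<bar>t\<bar>"
      using diff by (simp add: algebra_simps)
    also have "\<eta> powr (3/4) * R powr (-1/80) = c powr (3/4) * R powr (-1/5)"
      using c s by (simp add: \<eta>_def powr_mult powr_powr flip: powr_add)
    finally have low: "norm (reg_zeta s) \<ge> A / 2 * (c powr (3/4) * R powr (-1/5)) * \<bar>t\<bar>" .
    have "r / 2 * (1 + \<bar>t\<bar>) \<le> \<bar>t\<bar>"
    proof -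
      have "r * \<bar>t\<bar> \<le> 1 * \<bar>t\<bar>" using r by (intro mult_right_mono) auto
      hence "r + r * \<bar>t\<bar> \<le> 2 * \<bar>t\<bar>" using t(1) by linarith
      thus ?thesis by (simp add: algebra_simps)
    qed
    hence "A / 2 * c powr (3/4) * R powr (-1/5) * (r / 2 * (1 + \<bar>t\<bar>)) \<le> A / 2 * c powr (3/4) * R powr (-1/5) * \<bar>t\<bar>"
      using A by (intro mult_left_mono) auto
    moreover have "d * ((1 + \<bar>t\<bar>) * R powr (-1/5)) \<le> (A / 2 * c powr (3/4) * (r / 2)) * ((1 + \<bar>t\<bar>) * R powr (-1/5))"
      using d by (intro mult_right_mono) auto
    ultimately show ?thesis using low by (simp add: t_def mult_ac)
  qed
  thus ?thesis using c d by (intro that[of c d]) auto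
qed

section \<open>Partial sums of the Moebius series\<close>

text \<open>\<open>t powr (a - 1)\<close> decreases for \<open>a \<le> 1\<close> and increases
  otherwise, so the integral is compared from opposite sides; the last summand is the end term left
  over in the increasing case. On Newman's left half circle \<open>a\<close> can be as large as
  \<open>R\<close>.\<close>

lemma sum_powr_le:
  fixes a :: real
  assumes "a > 0" "N > 0"
  shows "(\<Sum>n=1..N. real n powr (a - 1)) \<le> real N powr a / a + real N powr (a - 1)"
proof -
  have mvt: "\<exists>\<xi>. real n < \<xi> \<and> \<xi> < real (Suc n) \<and> real (Suc n) powr a - real n powr a = a * \<xi> powr (a - 1)" if "n > 0" for n
  proof -
    have "\<exists>\<xi>. real n < \<xi> \<and> \<xi> < real (Suc n) \<and> real (Suc n) powr a - real n powr a = (real (Suc n) - real n) * (a * \<xi> powr (a - 1))"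
      using that by (intro MVT2) (auto intro!: derivative_eq_intros)
    thus ?thesis by simp
  qed
  show ?thesis
  proof (cases "a \<le> 1")
    case True
    have "(\<Sum>n=1..N. real n powr (a - 1)) \<le> real N powr a / a"
      using assms(2)
    proof (induction N rule: nat_induct_non_zero)
      case 1
      show ?case using True assms by (simp add: field_simps)
    next
      case (Suc n)
      obtain \<xi> where \<xi>: "real n < \<xi>" "\<xi> < real (Suc n)" "real (Suc n) powr a - real n powr a = a * \<xi> powr (a - 1)"
        using mvt[OF Suc(1)] by blast
      have "real (Suc n) powr (a - 1) \<le> \<xi> powr (a - 1)"
        using \<xi> True Suc by (intro powr_mono2') auto
      also have "\<dots> = (real (Suc n) powr a - real n powr a) / a"
        using \<xi> assms by simp
      finally show ?case using Suc by (simp add: diff_divide_distrib)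
    qed
    thus ?thesis by (simp add: add_increasing2)
  next
    case False
    have "(\<Sum>n=1..<N. real n powr (a - 1)) \<le> real N powr a / a"
      using assms(2)
    proof (induction N rule: nat_induct_non_zero)
      case 1
      show ?case using assms by simp
    next
      case (Suc n)
      obtain \<xi> where \<xi>: "real n < \<xi>" "\<xi> < real (Suc n)" "real (Suc n) powr a - real n powr a = a * \<xi> powr (a - 1)"
        using mvt[OF Suc(1)] by blast
      have "real n powr (a - 1) \<le> \<xi> powr (a - 1)"
        using \<xi> False Suc by (intro powr_mono2) auto
      also have "\<dots> = (real (Suc n) powr a - real n powr a) / a"
        using \<xi> assms by simp
      finally have "real n powr (a - 1) \<le> (real (Suc n) powr a - real n powr a) / a" .
      moreover have "{1..<Suc n} = insert n {1..<n}" using Suc by auto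
      ultimately show ?case using Suc by (simp add: diff_divide_distrib)
    qed
    moreover have "{1..N} = insert N {1..<N}" using assms by auto
    ultimately show ?thesis by simp
  qed
qed

text \<open>Newman's kernel \<open>N powr w (1/w + w/R\<^sup>2)\<close> equals \<open>2 Re w N powr w / R\<^sup>2\<close> in modulus on the circle of radius \<open>R\<close>;
  the factor \<open>Re w\<close> compensates the tails on both half circles. The pole of the kernel cancels against the zero of
  \<open>1/\<zeta>(1 + w)\<close>, so the integral of \<open>h\<close> over the right half circle is a difference of values of a primitive \<open>G\<close>, which is
  estimated along three sides of a rectangle on the left.\<close>

lemma newman_contour_bound:
  fixes R \<delta> \<delta>' b b' :: real and N :: nat
  assumes R: "R \<ge> 1" "R \<le> real N" and \<delta>: "0 < \<delta>" "\<delta> < \<delta>'" "\<delta>' \<le> 1/100"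
    and nz: "\<And>s. Re s > 1 - \<delta>' \<Longrightarrow> \<bar>Im s\<bar> < 2 * R \<Longrightarrow> reg_zeta s \<noteq> 0"
    and b: "b > 0" "\<And>s. 1 - \<delta> \<le> Re s \<Longrightarrow> Re s \<le> 1 \<Longrightarrow> \<bar>Im s\<bar> = R \<Longrightarrow> norm (reg_zeta s) \<ge> b"
    and b': "b' > 0" "\<And>s. Re s = 1 - \<delta> \<Longrightarrow> \<bar>Im s\<bar> \<le> R \<Longrightarrow> norm (reg_zeta s) \<ge> b'"
  shows "\<bar>\<Sum>n=1..N. real_of_int (moebius_mu n) / real n\<bar> \<le> 4 / R + 6 / (R * b) + 18 * R * real N powr (-\<delta>) / b'"
proof -
  let ?\<mu> = "\<lambda>n. complex_of_int (moebius_mu n)"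
  \<comment> \<open>A convex open set around the rectangle and the right half circle, so that
    \<open>h\<close> has a primitive there; the doubled height leaves room beyond the sides at
    height \<open>R\<close>.\<close>
  define D where "D = {w. Re w > -\<delta>'} \<inter> {w. Im w < 2 * R} \<inter> {w. Im w > - (2 * R)}"
  define S where "S = (\<lambda>w. \<Sum>n=1..N. ?\<mu> n * of_nat n powr (-1 - w))"
  \<comment> \<open>\<open>E w / w\<close> is Newman's kernel. As
    \<open>1 / zeta (1 + w) = w / reg_zeta (1 + w)\<close>, \<open>h\<close> is the kernel times
    \<open>1 / zeta (1 + w)\<close> with the singularity at 0 removed, while \<open>f w / w\<close>
    is the kernel times the partial sum and has the wanted sum \<open>f 0\<close> as its
    residue.\<close>
  define E where "E = (\<lambda>w :: complex. of_nat N powr w * (1 + w\<^sup>2 / of_real R ^ 2))"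
  define h where "h = (\<lambda>w. E w / reg_zeta (1 + w))"
  define f where "f = (\<lambda>w. S w * E w)"
  have N: "N \<ge> 1" using R by simp
  have D: "convex D" "open D"
    unfolding D_def by (auto intro!: convex_Int open_Int convex_halfspace_Re_gt convex_halfspace_Im_lt convex_halfspace_Im_gt
       open_halfspace_Re_gt open_halfspace_Im_lt open_halfspace_Im_gt)
  have DI: "w \<in> D \<longleftrightarrow> Re w > -\<delta>' \<and> \<bar>Im w\<bar> < 2 * R" for w
    by (auto simp: D_def abs_less_iff)
  have E_hol [holomorphic_intros]: "E holomorphic_on A" for A
    unfolding E_def using R N by (intro holomorphic_intros) auto
  have S_hol [holomorphic_intros]: "S holomorphic_on A" for A
    unfolding S_def by (intro holomorphic_intros) auto
  have f_hol: "f holomorphic_on A" for A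
    unfolding f_def by (intro holomorphic_intros)
  have Z_hol: "(\<lambda>w. reg_zeta (1 + w)) holomorphic_on D"
  proof -
    have "(reg_zeta \<circ> (\<lambda>w. 1 + w)) holomorphic_on D"
      by (rule holomorphic_on_compose_gen[OF _ holomorphic_reg_zeta])
         (use \<delta> in \<open>auto simp: DI intro!: holomorphic_intros\<close>)
    thus ?thesis by (simp add: o_def)
  qed
  have "h holomorphic_on D"
    unfolding h_def using \<delta> by (intro holomorphic_intros Z_hol) (auto simp: DI nz)
  then obtain G where G: "\<And>x. x \<in> D \<Longrightarrow> (G has_field_derivative h x) (at x within D)"
    using holomorphic_convex_primitive'[OF D] by blast
  let ?iR = "\<i> * complex_of_real R"
  have iR: "?iR \<in> D" "- ?iR \<in> D" "complex_of_real R \<in> D"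
    using R \<delta> by (auto simp: DI)
  have E_norm: "norm (E w) = real N powr Re w * (norm (w - ?iR) * norm (w + ?iR)) / R ^ 2" for w
  proof -
    have "1 + w\<^sup>2 / of_real R ^ 2 = (w - ?iR) * (w + ?iR) / of_real R ^ 2"
      using R by (simp add: field_simps power2_eq_square)
    thus ?thesis using R by (simp add: E_def norm_mult norm_divide norm_power)
  qed
  have G_diff: "norm (G x - G y) \<le> B * norm (x - y)"
    if B: "closed_segment x y \<subseteq> D" "\<And>z. z \<in> closed_segment x y \<Longrightarrow> norm (h z) \<le> B" for x y B
    by (rule field_differentiable_bound[where S = "closed_segment x y" and f = G and f' = h])
       (use B G in \<open>auto intro: DERIV_subset\<close>)
  \<comment> \<open>\<open>E\<close> vanishes at \<open>?iR\<close> and \<open>- ?iR\<close>. On a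
    horizontal side one of the two linear factors is therefore at most 1 and the other at most
    \<open>3 * R\<close>, which saves a factor \<open>R\<close>.\<close>
  have horiz: "norm (G (Complex 0 y) - G (Complex (-\<delta>) y)) \<le> 3 / (R * b)" if y: "y = R \<or> y = -R" for y
  proof -
    have seg: "Im z = y \<and> -\<delta> \<le> Re z \<and> Re z \<le> 0" if "z \<in> closed_segment (Complex 0 y) (Complex (-\<delta>) y)" for z
    proof -
      have "closed_segment (Complex 0 y) (Complex (-\<delta>) y) \<subseteq> {z. Im z \<le> y} \<inter> {z. Im z \<ge> y} \<inter> {z. Re z \<ge> -\<delta>} \<inter> {z. Re z \<le> 0}"
        using \<delta> by (intro closed_segment_subset convex_Int convex_halfspace_Im_le convex_halfspace_Im_ge convex_halfspace_Re_le convex_halfspace_Re_ge)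
          auto
      from subsetD[OF this that] show ?thesis by auto
    qed
    have "norm (G (Complex 0 y) - G (Complex (-\<delta>) y)) \<le> (3 / (R * b)) * norm (Complex 0 y - Complex (-\<delta>) y)"
    proof (rule G_diff)
      show "closed_segment (Complex 0 y) (Complex (-\<delta>) y) \<subseteq> D"
        using seg \<delta> y R by (fastforce simp: DI)
      fix z assume "z \<in> closed_segment (Complex 0 y) (Complex (-\<delta>) y)"
      hence z: "Im z = y" "-\<delta> \<le> Re z" "Re z \<le> 0" using seg by auto
      have Zb: "norm (reg_zeta (1 + z)) \<ge> b" using z y R by (intro b) auto
      have 1: "norm (z - Complex 0 y) \<le> 1" "norm (z + Complex 0 y) \<le> 3 * R"
        using z \<delta> R y cmod_le[of "z - Complex 0 y"] cmod_le[of "z + Complex 0 y"] by auto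
      have "norm (z - ?iR) * norm (z + ?iR) = norm (z - Complex 0 y) * norm (z + Complex 0 y)"
      proof -
        have "?iR = Complex 0 R" "Complex 0 (-R) = - Complex 0 R" by (auto simp: complex_eq_iff)
        thus ?thesis using y by (auto simp: mult.commute)
      qed
      also have "\<dots> \<le> 1 * (3 * R)" using 1 by (intro mult_mono) auto
      finally have 2: "norm (z - ?iR) * norm (z + ?iR) \<le> 3 * R" by simp
      have "real N powr Re z \<le> 1"
        using z N powr_mono[of "Re z" 0 "real N"] by simp
      hence "norm (E z) \<le> 1 * (3 * R) / R ^ 2"
        unfolding E_norm using mult_mono[OF _ 2, of "real N powr Re z" 1] R by (intro divide_right_mono) auto
      also have "\<dots> = 3 / R" using R by (simp add: power2_eq_square)
      finally have "norm (E z) / norm (reg_zeta (1 + z)) \<le> (3 / R) / b"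
        using Zb b R by (intro frac_le) auto
      thus "norm (h z) \<le> 3 / (R * b)" by (simp add: h_def norm_divide)
    qed
    also have "\<dots> \<le> (3 / (R * b)) * 1"
    proof (rule mult_left_mono)
      have "Complex 0 y - Complex (-\<delta>) y = of_real \<delta>" by (simp add: complex_eq_iff)
      thus "norm (Complex 0 y - Complex (-\<delta>) y) \<le> 1" using \<delta> by simp
    qed (use R b in auto)
    finally show ?thesis by simp
  qed
  have vert: "norm (G (Complex (-\<delta>) R) - G (Complex (-\<delta>) (-R))) \<le> 18 * R * real N powr (-\<delta>) / b'"
  proof -
    have seg: "Re z = -\<delta> \<and> -R \<le> Im z \<and> Im z \<le> R" if "z \<in> closed_segment (Complex (-\<delta>) R) (Complex (-\<delta>) (-R))" for z
    proof -
      have "closed_segment (Complex (-\<delta>) R) (Complex (-\<delta>) (-R)) \<subseteq> {z. Im z \<le> R} \<inter> {z. Im z \<ge> -R} \<inter> {z. Re z \<ge> -\<delta>} \<inter> {z. Re z \<le> -\<delta>}"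
        using R by (intro closed_segment_subset convex_Int convex_halfspace_Im_le convex_halfspace_Im_ge convex_halfspace_Re_le convex_halfspace_Re_ge)
          auto
      from subsetD[OF this that] show ?thesis by auto
    qed
    have "norm (G (Complex (-\<delta>) R) - G (Complex (-\<delta>) (-R))) \<le> (9 * real N powr (-\<delta>) / b') * norm (Complex (-\<delta>) R - Complex (-\<delta>) (-R))"
    proof (rule G_diff)
      show "closed_segment (Complex (-\<delta>) R) (Complex (-\<delta>) (-R)) \<subseteq> D"
        using seg \<delta> R by (fastforce simp: DI)
      fix z assume "z \<in> closed_segment (Complex (-\<delta>) R) (Complex (-\<delta>) (-R))"
      hence z: "Re z = -\<delta>" "-R \<le> Im z" "Im z \<le> R" using seg by auto
      have Zb: "norm (reg_zeta (1 + z)) \<ge> b'" using z by (intro b') auto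
      have "norm (z - ?iR) \<le> 3 * R" "norm (z + ?iR) \<le> 3 * R"
        using z \<delta> R cmod_le[of "z - ?iR"] cmod_le[of "z + ?iR"] by auto
      hence "norm (z - ?iR) * norm (z + ?iR) \<le> (3 * R) * (3 * R)" using R by (intro mult_mono) auto
      hence "norm (E z) \<le> real N powr (-\<delta>) * ((3 * R) * (3 * R)) / R ^ 2"
        unfolding E_norm z(1) by (intro divide_right_mono mult_left_mono) auto
      also have "\<dots> = 9 * real N powr (-\<delta>)" using R by (simp add: power2_eq_square)
      finally have "norm (E z) / norm (reg_zeta (1 + z)) \<le> (9 * real N powr (-\<delta>)) / b'"
        using Zb b' by (intro frac_le) auto
      thus "norm (h z) \<le> 9 * real N powr (-\<delta>) / b'" by (simp add: h_def norm_divide)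
    qed
    also have "Complex (-\<delta>) R - Complex (-\<delta>) (-R) = of_real (2 * R) * \<i>"
      by (simp add: complex_eq_iff)
    finally show ?thesis using R by (simp add: norm_mult mult_ac)
  qed
  have tri: "norm (x + y - z) \<le> norm x + norm y + norm z" for x y z :: complex
    using norm_triangle_ineq4[of "x + y" z] norm_triangle_ineq[of x y] by linarith
  have Gd: "norm (G ?iR - G (- ?iR)) \<le> 6 / (R * b) + 18 * R * real N powr (-\<delta>) / b'"
  proof -
    have e: "?iR = Complex 0 R" "- ?iR = Complex 0 (-R)" by (auto simp: complex_eq_iff)
    have "G ?iR - G (- ?iR) = (G (Complex 0 R) - G (Complex (-\<delta>) R)) + (G (Complex (-\<delta>) R) - G (Complex (-\<delta>) (-R)))
        - (G (Complex 0 (-R)) - G (Complex (-\<delta>) (-R)))"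
      unfolding e(2) unfolding e(1) by simp
    also have "norm \<dots> \<le> 3 / (R * b) + 18 * R * real N powr (-\<delta>) / b' + 3 / (R * b)"
      using horiz[of R] horiz[of "-R"] vert by (intro order_trans[OF tri] add_mono) auto
    finally show ?thesis by simp
  qed
  have kernel: "norm (E w / w) = real N powr Re w * (2 * \<bar>Re w\<bar>) / R ^ 2" if w: "norm w = R" for w
  proof -
    have nz': "w \<noteq> 0" using w R by auto
    have "R ^ 2 = (Re w)\<^sup>2 + (Im w)\<^sup>2" using w cmod_power2[of w] by simp
    hence "of_real R ^ 2 + w\<^sup>2 = of_real (2 * Re w) * w"
      by (auto simp: complex_eq_iff power2_eq_square)
    hence "1 + w\<^sup>2 / of_real R ^ 2 = of_real (2 * Re w) * w / of_real R ^ 2"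
      using R by (simp add: field_simps)
    hence "E w / w = of_nat N powr w * of_real (2 * Re w) / of_real R ^ 2"
      using nz' by (simp add: E_def)
    thus ?thesis by (simp add: norm_mult norm_divide norm_power abs_mult)
  qed
  \<comment> \<open>The difference is the tail of the Moebius series times the kernel;
    \<open>real N powr (- Re w) / Re w\<close> from the tail cancels against the kernel.\<close>
  have right: "norm (h w - f w / w) \<le> 4 / R ^ 2" if w: "norm w = R" "Re w > 0" for w
  proof -
    have w0: "w \<noteq> 0" using w by auto
    have zm: "zeta (1 + w) * moebius_series (1 + w) = 1"
      using w by (intro zeta_mult_moebius_series) auto
    hence z0: "zeta (1 + w) \<noteq> 0" by auto
    have "reg_zeta (1 + w) = w * zeta (1 + w)"
      using w by (subst reg_zeta_eq) auto
    hence "1 / reg_zeta (1 + w) = (zeta (1 + w) * moebius_series (1 + w)) / (w * zeta (1 + w))"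
      using zm by simp
    also have "\<dots> = moebius_series (1 + w) / w"
      using z0 by simp
    finally have inv: "1 / reg_zeta (1 + w) = moebius_series (1 + w) / w" .
    have Un: "{0<..} = {1..N} \<union> {N<..}" by auto
    have "moebius_series (1 + w) = dirichlet_sum ?\<mu> {1..N} (1 + w) + dirichlet_sum ?\<mu> {N<..} (1 + w)"
      unfolding moebius_series_def Un
      by (rule dirichlet_sum_union[OF norm_moebius_mu_le_1]) (use w in auto)
    moreover have "dirichlet_sum ?\<mu> {1..N} (1 + w) = S w"
      by (simp add: dirichlet_sum_def S_def)
    ultimately have eq: "h w - f w / w = dirichlet_sum ?\<mu> {N<..} (1 + w) * (E w / w)"
    proof -
      assume "moebius_series (1 + w) = dirichlet_sum ?\<mu> {1..N} (1 + w) + dirichlet_sum ?\<mu> {N<..} (1 + w)"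
        "dirichlet_sum ?\<mu> {1..N} (1 + w) = S w"
      moreover have "h w = moebius_series (1 + w) * (E w / w)"
        using inv by (simp add: h_def divide_inverse mult_ac)
      ultimately show ?thesis by (simp add: f_def algebra_simps)
    qed
    have "norm (dirichlet_sum ?\<mu> {N<..} (1 + w)) \<le> real N powr (1 - Re (1 + w)) / (Re (1 + w) - 1)"
      using w N norm_moebius_mu_le_1 by (intro norm_dirichlet_sum_tail_le) auto
    hence "norm (h w - f w / w) \<le> (real N powr (- Re w) / Re w) * (real N powr Re w * (2 * \<bar>Re w\<bar>) / R ^ 2)"
      unfolding eq norm_mult kernel[OF w(1)] by (intro mult_right_mono) auto
    also have "\<dots> = 2 / R ^ 2"
      using w N by (simp add: powr_minus field_simps)
    also have "\<dots> \<le> 4 / R ^ 2" using R by (intro divide_right_mono) auto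
    finally show ?thesis .
  qed
  \<comment> \<open>Here the partial sum is estimated term by term. From
    \<open>a \<le> R \<le> N\<close> the extra term \<open>2 * a / N\<close> is at most 2.\<close>
  have left: "norm (f w / w) \<le> 4 / R ^ 2" if w: "norm w = R" "Re w < 0" for w
  proof -
    define a where "a = - Re w"
    have a: "a > 0" using w by (simp add: a_def)
    have Re_a: "Re (-1 - w) = a - 1" by (simp add: a_def)
    have aR: "a \<le> R" using w abs_Re_le_cmod[of w] by (simp add: a_def)
    have "norm (S w) \<le> (\<Sum>n=1..N. norm (?\<mu> n * of_nat n powr (-1 - w)))"
      unfolding S_def by (rule norm_sum)
    also have "\<dots> \<le> (\<Sum>n=1..N. real n powr (a - 1))"
    proof (rule sum_mono)
      fix n assume "n \<in> {1..N}"
      have "norm (?\<mu> n) * real n powr (a - 1) \<le> 1 * real n powr (a - 1)"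
        using norm_moebius_mu_le_1 by (intro mult_right_mono) auto
      thus "norm (?\<mu> n * of_nat n powr (-1 - w)) \<le> real n powr (a - 1)"
        by (simp only: norm_mult norm_of_nat_powr Re_a)
    qed
    also have "\<dots> \<le> real N powr a / a + real N powr (a - 1)"
      using a N by (intro sum_powr_le) auto
    finally have Sb: "norm (S w) \<le> real N powr a / a + real N powr (a - 1)" .
    have eq: "f w / w = S w * (E w / w)" by (simp add: f_def)
    have "norm (f w / w) \<le> (real N powr a / a + real N powr (a - 1)) * (real N powr Re w * (2 * \<bar>Re w\<bar>) / R ^ 2)"
      unfolding eq norm_mult kernel[OF w(1)] using Sb by (intro mult_right_mono) auto
    also have "\<dots> = (2 + 2 * a / real N) / R ^ 2"
    proof -
      define P where "P = real N powr a"
      have P: "P > 0" using N by (simp add: P_def)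
      have "Re w = -a" by (simp add: a_def)
      hence eqs: "real N powr Re w = 1 / P" "real N powr (a - 1) = P / real N" "\<bar>Re w\<bar> = a"
        using N a by (simp_all add: P_def powr_minus powr_diff divide_inverse)
      show ?thesis unfolding eqs P_def[symmetric] using P a N R by (simp add: field_simps)
    qed
    also have "\<dots> \<le> 4 / R ^ 2"
      using aR a R N by (intro divide_right_mono) (auto simp: field_simps)
    finally show ?thesis .
  qed
  let ?p = "part_circlepath 0 R"
  have on_circle: "norm w = R" if "w \<in> path_image (?p a c)" "a \<le> c" for w a c
    using in_path_image_part_circlepath[OF that(1,2)] R by simp
  have cont: "(\<lambda>w. f w / w) contour_integrable_on (?p a c)" if "a \<le> c" for a c
  proof (rule contour_integrable_continuous_part_circlepath, intro continuous_intros)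
    show "continuous_on (path_image (?p a c)) f"
      by (rule holomorphic_on_imp_continuous_on[OF f_hol])
    show "\<forall>w\<in>path_image (?p a c). w \<noteq> 0"
      using on_circle[of _ a c] that R by force
  qed
  define J where "J = (\<lambda>a c. contour_integral (?p a c) (\<lambda>w. f w / w))"
  have J: "((\<lambda>w. f w / w) has_contour_integral J a c) (?p a c)" if "a \<le> c" for a c
    unfolding J_def using cont[OF that] by (rule has_contour_integral_integral)
  \<comment> \<open>\<open>circlepath\<close> starts at angle 0, so the right half circle appears as
    two quarter arcs with the left half between them.\<close>
  have circ: "J 0 (pi/2) + J (pi/2) (3*pi/2) + J (3*pi/2) (2*pi) = 2 * of_real pi * \<i> * f 0"
  proof -
    define \<phi> where "\<phi> = (\<lambda>t. f (0 + of_real R * cis t) / (0 + of_real R * cis t) * of_real R * \<i> * cis t)"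
    have iff: "((\<lambda>w. f w / w) has_contour_integral I) (?p a c) \<longleftrightarrow> (\<phi> has_integral I) {a..c}" if "a < c" for a c I
      unfolding \<phi>_def by (rule has_contour_integral_part_circlepath_iff[OF that])
    have hi: "(\<phi> has_integral J a c) {a..c}" if "a < c" for a c
      using J[of a c] iff[OF that] that by simp
    have h1: "(\<phi> has_integral (J 0 (pi/2) + J (pi/2) (3*pi/2))) {0..3*pi/2}"
      by (rule has_integral_combine[of 0 "pi/2"]) (auto intro!: hi)
    have "(\<phi> has_integral (J 0 (pi/2) + J (pi/2) (3*pi/2) + J (3*pi/2) (2*pi))) {0..2*pi}"
      by (rule has_integral_combine[OF _ _ h1 hi]) auto
    hence "((\<lambda>w. f w / w) has_contour_integral (J 0 (pi/2) + J (pi/2) (3*pi/2) + J (3*pi/2) (2*pi))) (circlepath 0 R)"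
      unfolding circlepath_def by (subst iff) auto
    moreover have "((\<lambda>w. f w / (w - 0)) has_contour_integral (2 * of_real pi * \<i> * f 0)) (circlepath 0 R)"
      using R by (intro Cauchy_integral_circlepath_simple f_hol) auto
    ultimately show ?thesis
      by (metis (no_types, lifting) diff_zero has_contour_integral_unique has_contour_integral_eq)
  qed
  have Re_circle: "\<exists>t. w = of_real R * cis t \<and> a \<le> t \<and> t \<le> c" if "w \<in> path_image (?p a c)" "a \<le> c" for w a c
    using that by (auto simp: path_image_part_circlepath' closed_segment_eq_real_ivl)
  have piece: "norm (G q - G p - J a c) \<le> 4 / R ^ 2 * R * (pi / 2)"
    if ac: "c = a + pi / 2" "\<And>t. a \<le> t \<Longrightarrow> t \<le> c \<Longrightarrow> cos t \<ge> 0" "p = of_real R * cis a" "q = of_real R * cis c" for a c p q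
  proof -
    have le: "a \<le> c" using ac by simp
    have Re: "Re w \<ge> 0" if "w \<in> path_image (?p a c)" for w
      using Re_circle[OF that le] ac(2) R by auto
    have "(h has_contour_integral (G (pathfinish (?p a c)) - G (pathstart (?p a c)))) (?p a c)"
    proof (rule contour_integral_primitive[where S = D])
      show "path_image (?p a c) \<subseteq> D"
      proof
        fix w assume w: "w \<in> path_image (?p a c)"
        have "\<bar>Im w\<bar> \<le> R" using abs_Im_le_cmod[of w] on_circle[OF w le] by simp
        thus "w \<in> D" using Re[OF w] R \<delta> by (auto simp: DI)
      qed
    qed (use G in auto)
    hence "((\<lambda>w. h w - f w / w) has_contour_integral (G q - G p - J a c)) (?p a c)"
      using J[OF le] ac(3,4) by (intro has_contour_integral_diff) (auto simp: cis_conv_exp mult.commute)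
    hence "norm (G q - G p - J a c) \<le> 4 / R ^ 2 * R * (c - a)"
    proof (rule has_contour_integral_bound_part_circlepath_strong)
      \<comment> \<open>At these two points the real part is 0 and the estimate does not apply; the
        strong form of the bound allows finitely many exceptions.\<close>
      show "finite {?iR, - ?iR}" by simp
      fix w assume w: "w \<in> path_image (?p a c) - {?iR, - ?iR}"
      have n: "norm w = R" using w le by (intro on_circle) auto
      have "Re w \<noteq> 0"
      proof
        assume "Re w = 0"
        hence "\<bar>Im w\<bar> = R" using n by (simp add: cmod_def)
        hence "w = ?iR \<or> w = - ?iR" using \<open>Re w = 0\<close> by (auto simp: complex_eq_iff)
        thus False using w by blast
      qed
      thus "norm (h w - f w / w) \<le> 4 / R ^ 2" using Re[of w] w n by (intro right) auto
    qed (use R le in auto)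
    thus ?thesis using ac by simp
  qed
  have p1: "norm (G ?iR - G (of_real R) - J 0 (pi/2)) \<le> 4 / R ^ 2 * R * (pi / 2)"
    by (rule piece) (auto intro!: cos_ge_zero)
  have p2: "norm (G (of_real R) - G (- ?iR) - J (3*pi/2) (2*pi)) \<le> 4 / R ^ 2 * R * (pi / 2)"
  proof (rule piece)
    fix t :: real assume "3*pi/2 \<le> t" "t \<le> 2*pi"
    hence "cos (t - 2*pi) \<ge> 0" by (intro cos_ge_zero) auto
    thus "cos t \<ge> 0" by (simp add: cos_diff)
  next
    have "cis (3*pi/2) = - \<i>"
      using cis_mult[of pi "pi/2", symmetric] by (simp add: algebra_simps)
    thus "- ?iR = of_real R * cis (3*pi/2)" by simp
  qed auto
  have p3: "norm (J (pi/2) (3*pi/2)) \<le> 4 / R ^ 2 * R * (3*pi/2 - pi/2)"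
  proof (rule has_contour_integral_bound_part_circlepath_strong[OF J])
    show "finite {?iR, - ?iR}" by simp
    fix w assume w: "w \<in> path_image (?p (pi/2) (3*pi/2)) - {?iR, - ?iR}"
    have n: "norm w = R" using w by (intro on_circle) auto
    obtain t where t: "w = of_real R * cis t" "pi/2 \<le> t" "t \<le> 3*pi/2"
      using Re_circle[of w "pi/2" "3*pi/2"] w by auto
    have "cos (t - pi) \<ge> 0" using t by (intro cos_ge_zero) auto
    hence "cos t \<le> 0" by (simp add: cos_diff)
    hence "Re w \<le> 0" using t R by (auto simp: mult_nonneg_nonpos)
    moreover have "Re w \<noteq> 0"
    proof
      assume "Re w = 0"
      hence "\<bar>Im w\<bar> = R" using n by (simp add: cmod_def)
      hence "w = ?iR \<or> w = - ?iR" using \<open>Re w = 0\<close> by (auto simp: complex_eq_iff)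
      thus False using w by blast
    qed
    ultimately show "norm (f w / w) \<le> 4 / R ^ 2" using n by (intro left) auto
  qed (use R in auto)
  have eq: "2 * of_real pi * \<i> * f 0 = (G ?iR - G (- ?iR)) - (G ?iR - G (of_real R) - J 0 (pi/2))
      - (G (of_real R) - G (- ?iR) - J (3*pi/2) (2*pi)) + J (pi/2) (3*pi/2)"
    unfolding circ[symmetric] by simp
  have tri4: "norm (x - y - z + u) \<le> norm x + norm y + norm z + norm u" for x y z u :: complex
    using norm_triangle_ineq[of "x - y - z" u] norm_triangle_ineq4[of "x - y" z] norm_triangle_ineq4[of x y] by linarith
  have "2 * pi * norm (f 0) = norm (2 * of_real pi * \<i> * f 0)"
    by (simp add: norm_mult)
  also have "\<dots> \<le> norm (G ?iR - G (- ?iR)) + 4 / R ^ 2 * R * (pi / 2) + 4 / R ^ 2 * R * (pi / 2) + 4 / R ^ 2 * R * (3*pi/2 - pi/2)"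
    unfolding eq by (rule order_trans[OF tri4]) (intro add_mono p1 p2 p3 order_refl)
  \<comment> \<open>The arcs have total length \<open>2 * pi * R\<close>; after division by
    \<open>2 * pi\<close> they leave \<open>4 / R\<close>.\<close>
  also have "\<dots> = norm (G ?iR - G (- ?iR)) + 8 * pi / R"
    using R by (simp add: field_simps power2_eq_square)
  finally have "2 * pi * norm (f 0) \<le> 6 / (R * b) + 18 * R * real N powr (-\<delta>) / b' + 8 * pi / R"
    using Gd by linarith
  hence "norm (f 0) \<le> (6 / (R * b) + 18 * R * real N powr (-\<delta>) / b') / (2 * pi) + 4 / R"
    using R by (simp add: field_simps)
  also have "(6 / (R * b) + 18 * R * real N powr (-\<delta>) / b') / (2 * pi) \<le> (6 / (R * b) + 18 * R * real N powr (-\<delta>) / b') / 1"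
    using R b(1) b'(1) pi_ge_two by (intro divide_left_mono) (auto intro!: add_nonneg_nonneg)
  also have "f 0 = of_real (\<Sum>n=1..N. real_of_int (moebius_mu n) / real n)"
  proof -
    have "of_nat n powr (-1 :: complex) = 1 / of_nat n" if "n \<ge> 1" for n
      using that powr_minus[of "of_nat n :: complex" 1] by (simp add: field_simps)
    thus ?thesis using R N by (simp add: f_def S_def E_def)
  qed
  finally show ?thesis by (simp only: norm_of_real) simp
qed

text \<open>Newman's bound with \<open>R = (ln N)^2\<close>, so that its leading terms have the
  required order \<open>1 / R\<close>. The strip has width of order \<open>R powr (-1/4)\<close>,
  hence \<open>N powr (-\<delta>) = exp (- c' * sqrt (ln N))\<close>, which beats the factor
  \<open>R ^ 2\<close> in front of it.\<close>

lemma moebius_sum_bound_eventually: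
  obtains C where "\<forall>\<^sub>F N in sequentially. \<bar>\<Sum>n=1..N. real_of_int (moebius_mu n) / real n\<bar> \<le> C / (ln (real N))\<^sup>2"
proof -
  obtain c d :: real where c: "0 < c" "c \<le> 1/100" and d: "d > 0" and low: "\<And>R s. R \<ge> 1 \<Longrightarrow> \<bar>Re s - 1\<bar> \<le> c * R powr (-1/4) \<Longrightarrow> \<bar>Im s\<bar> \<le> R \<Longrightarrow>
       norm (reg_zeta s) \<ge> d * (1 + \<bar>Im s\<bar>) * R powr (-1/5)"
    using reg_zeta_lower by blast
  define c' where "c' = c / 2 * 2 powr (-1/4)"
  have c': "c' > 0" using c by (simp add: c'_def)
  have ev1: "\<forall>\<^sub>F N in sequentially. (ln (real N)) ^ 6 * real N powr (- c' * ((ln (real N))\<^sup>2) powr (-1/4)) \<le> 1"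
    using c' by real_asymp
  have ev2: "\<forall>\<^sub>F N in sequentially. (ln (real N))\<^sup>2 \<le> real N" by real_asymp
  have ev3: "\<forall>\<^sub>F N in sequentially. 1 \<le> (ln (real N))\<^sup>2" by real_asymp
  from ev1 ev2 ev3 have "\<forall>\<^sub>F N in sequentially. \<bar>\<Sum>n=1..N. real_of_int (moebius_mu n) / real n\<bar> \<le> (4 + 48 / d) / (ln (real N))\<^sup>2"
  proof eventually_elim
    case (elim N)
    define R where "R = (ln (real N))\<^sup>2"
    have R: "R \<ge> 1" "R \<le> real N" using elim by (auto simp: R_def)
    \<comment> \<open>The lower bound is applied with \<open>2 * R\<close>, since
      \<open>newman_contour_bound\<close> asks for nonvanishing up to twice the radius.\<close>
    define \<delta>' where "\<delta>' = c * (2 * R) powr (-1/4)"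
    define \<delta> where "\<delta> = \<delta>' / 2"
    have "(2 * R) powr (-1/4) \<le> 1" using R powr_mono[of "-1/4" 0 "2 * R"] by simp
    hence \<delta>': "0 < \<delta>'" "\<delta>' \<le> 1/100" using R c mult_mono[of c "1/100" "(2 * R) powr (-1/4)" 1] by (auto simp: \<delta>'_def)
    have \<delta>: "0 < \<delta>" "\<delta> < \<delta>'" using \<delta>' by (auto simp: \<delta>_def)
    have R5: "(2 * R) powr (-1/5) \<ge> 1 / (2 * R)"
      using R powr_mono[of "-1" "-1/5" "2 * R"] by (simp add: powr_minus_divide)
    have low': "norm (reg_zeta s) \<ge> d * (1 + \<bar>Im s\<bar>) / (2 * R)"
      if "\<bar>Re s - 1\<bar> \<le> \<delta>'" "\<bar>Im s\<bar> \<le> 2 * R" for s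
    proof -
      have "d * (1 + \<bar>Im s\<bar>) * (1 / (2 * R)) \<le> d * (1 + \<bar>Im s\<bar>) * (2 * R) powr (-1/5)"
        using d by (intro mult_left_mono R5) auto
      also have "\<dots> \<le> norm (reg_zeta s)"
        using that R by (intro low) (auto simp: \<delta>'_def)
      finally show ?thesis by simp
    qed
    have "\<bar>\<Sum>n=1..N. real_of_int (moebius_mu n) / real n\<bar> \<le> 4 / R + 6 / (R * (d / 2)) + 18 * R * real N powr (-\<delta>) / (d / (2 * R))"
    proof (rule newman_contour_bound[where \<delta>' = \<delta>'])
      fix s assume s: "Re s > 1 - \<delta>'" "\<bar>Im s\<bar> < 2 * R"
      show "reg_zeta s \<noteq> 0"
      proof (cases "Re s > 1")
        case True
        hence "s \<noteq> 1" "zeta s \<noteq> 0" using zeta_mult_moebius_series[of s] by auto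
        thus ?thesis using True by (simp add: reg_zeta_eq)
      next
        case False
        have "0 < d * (1 + \<bar>Im s\<bar>) / (2 * R)" using d R by simp
        also have "\<dots> \<le> norm (reg_zeta s)" using s False by (intro low') auto
        finally show ?thesis by auto
      qed
    next
      \<comment> \<open>At height \<open>R\<close> the factor \<open>1 + R\<close> makes up for the
        denominator \<open>2 * R\<close>, so the bound on the horizontal sides is a
        constant.\<close>
      fix s assume s: "1 - \<delta> \<le> Re s" "Re s \<le> 1" "\<bar>Im s\<bar> = R"
      have "d / 2 \<le> d * (1 + R) / (2 * R)" using d R by (simp add: field_simps)
      also have "\<dots> \<le> norm (reg_zeta s)" using s \<delta> R low'[of s] by auto
      finally show "d / 2 \<le> norm (reg_zeta s)" .
    next
      fix s assume s: "Re s = 1 - \<delta>" "\<bar>Im s\<bar> \<le> R"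
      have "d * 1 / (2 * R) \<le> d * (1 + \<bar>Im s\<bar>) / (2 * R)"
        using d R by (intro divide_right_mono mult_left_mono) auto
      also have "\<dots> \<le> norm (reg_zeta s)" using s \<delta> R by (intro low') auto
      finally show "d / (2 * R) \<le> norm (reg_zeta s)" by simp
    qed (use R \<delta> \<delta>' d in auto)
    also have "\<dots> = (4 + 12 / d) / R + 36 / d * (R ^ 2 * real N powr (-\<delta>))"
      using R d by (simp add: field_simps power2_eq_square)
    also have "R ^ 2 * real N powr (-\<delta>) \<le> 1 / R"
    proof -
      have "-\<delta> = - c' * R powr (-1/4)"
        using R by (simp add: \<delta>_def \<delta>'_def c'_def powr_mult)
      hence "R * (R ^ 2 * real N powr (-\<delta>)) = (ln (real N)) ^ 6 * real N powr (- c' * ((ln (real N))\<^sup>2) powr (-1/4))"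
        by (simp add: R_def power_mult[symmetric] power_add[symmetric] flip: mult.assoc power_Suc)
      also have "\<dots> \<le> 1" by (rule elim)
      finally show ?thesis using R by (simp add: field_simps)
    qed
    hence "(4 + 12 / d) / R + 36 / d * (R ^ 2 * real N powr (-\<delta>)) \<le> (4 + 12 / d) / R + 36 / d * (1 / R)"
      using d by (intro add_left_mono mult_left_mono) auto
    also have "\<dots> = (4 + 48 / d) / R" using R d by (simp add: field_simps)
    finally show ?case by (simp add: R_def)
  qed
  thus ?thesis by (rule that)
qed

lemma moebius_sum_bound:
  obtains C where "C > 0"
    "\<And>N. N \<ge> 2 \<Longrightarrow> \<bar>\<Sum>n=1..N. real_of_int (moebius_mu n) / real n\<bar> \<le> C / (ln (real N))\<^sup>2"
proof -
  let ?m = "\<lambda>N. \<bar>\<Sum>n=1..N. real_of_int (moebius_mu n) / real n\<bar>"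
  obtain C N0 where C: "\<And>N. N \<ge> N0 \<Longrightarrow> ?m N \<le> C / (ln (real N))\<^sup>2"
    using moebius_sum_bound_eventually unfolding eventually_sequentially by metis
  define C' where "C' = \<bar>C\<bar> + (\<Sum>N\<le>N0. ?m N * (ln (real N))\<^sup>2) + 1"
  have s: "(\<Sum>N\<le>N0. ?m N * (ln (real N))\<^sup>2) \<ge> 0" by (intro sum_nonneg) auto
  have "?m N \<le> C' / (ln (real N))\<^sup>2" if N: "N \<ge> 2" for N
  proof -
    have L: "(ln (real N))\<^sup>2 > 0" using N by simp
    have "?m N * (ln (real N))\<^sup>2 \<le> C'"
    proof (cases "N \<ge> N0")
      case True
      hence "?m N * (ln (real N))\<^sup>2 \<le> C" using C[OF True] L by (simp add: field_simps)
      thus ?thesis using s by (simp add: C'_def)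
    next
      case False
      hence "?m N * (ln (real N))\<^sup>2 \<le> (\<Sum>N\<le>N0. ?m N * (ln (real N))\<^sup>2)"
        by (intro member_le_sum) auto
      thus ?thesis by (simp add: C'_def)
    qed
    thus ?thesis using L by (simp add: field_simps)
  qed
  moreover have "C' > 0" using s by (simp add: C'_def)
  ultimately show ?thesis using that by blast
qed

section \<open>Fractional part sums of the Moebius function\<close>

definition rough_upto :: "nat set \<Rightarrow> real \<Rightarrow> nat set" where
  "rough_upto P y = {m \<in> coprime_set P. real m \<le> y}"

text \<open>The sum \<open>U\<^sub>P(y)\<close> of the overview. It vanishes for
  \<open>y < 1\<close>, which ends the recursion.\<close>

definition moebius_frac_sum :: "nat set \<Rightarrow> real \<Rightarrow> real" where
  "moebius_frac_sum P y = (\<Sum>m\<in>rough_upto P y. real_of_int (moebius_mu m) * frac (y / real m))"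

lemma rough_upto_empty: "rough_upto {} y = {1..nat \<lfloor>y\<rfloor>}"
  by (auto simp: rough_upto_def coprime_set_def le_nat_floor) linarith+

lemma finite_rough_upto [simp]: "finite (rough_upto P y)"
  by (rule finite_subset[of _ "{..nat \<lfloor>y\<rfloor>}"]) (auto simp: rough_upto_def le_nat_floor)

lemma one_plus_ln_le_sqrt:
  fixes u :: real
  assumes "u \<ge> 1"
  shows "1 + ln u \<le> 2 * sqrt u"
proof -
  have "ln u = 2 * ln (sqrt u)" using assms by (simp add: ln_sqrt)
  also have "ln (sqrt u) \<le> sqrt u - 1" using assms by (intro ln_le_minus_one) auto
  finally show ?thesis by simp
qed

lemma one_plus_ln_sq_le:
  fixes u :: real
  assumes "u \<ge> 1"
  shows "(1 + ln u)\<^sup>2 \<le> 4 * u"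
proof -
  have "(1 + ln u)\<^sup>2 \<le> (2 * sqrt u)\<^sup>2"
    using assms one_plus_ln_le_sqrt[OF assms] by (intro power_mono) auto
  also have "\<dots> = 4 * u" using assms by (simp add: power_mult_distrib)
  finally show ?thesis .
qed

text \<open>\<open>frac (u / n)\<close> is \<open>u / n\<close> minus \<open>N div n\<close>, and
  the second part sums to exactly 1 by \<open>sum_moebius_mu_floor\<close>.\<close>

lemma moebius_frac_sum_empty:
  assumes "u \<ge> 1"
  shows "moebius_frac_sum {} u = u * (\<Sum>n=1..nat \<lfloor>u\<rfloor>. real_of_int (moebius_mu n) / real n) - 1"
proof -
  define N where "N = nat \<lfloor>u\<rfloor>"
  have N: "N > 0" "\<lfloor>u\<rfloor> = int N" using assms by (auto simp: N_def)
  have fr: "frac (u / real n) = u / real n - real (N div n)" for n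
    using floor_divide_real_eq_div[of "int n" u] N by (simp add: frac_def flip: zdiv_int)
  have "moebius_frac_sum {} u = (\<Sum>n=1..N. u * (real_of_int (moebius_mu n) / real n) - real_of_int (moebius_mu n * int (N div n)))"
    unfolding moebius_frac_sum_def rough_upto_empty N_def[symmetric]
    by (intro sum.cong) (simp_all add: fr right_diff_distrib)
  also have "\<dots> = u * (\<Sum>n=1..N. real_of_int (moebius_mu n) / real n) - real_of_int (\<Sum>n=1..N. moebius_mu n * int (N div n))"
    by (simp add: sum_subtractf sum_distrib_left)
  finally show ?thesis unfolding sum_moebius_mu_floor[OF N(1)] N_def[symmetric] by simp
qed

text \<open>\<open>1 + ln u\<close> instead of \<open>ln u\<close> lets the bound hold from
  \<open>u = 1\<close> on. The 4 absorbs the constant \<open>-1\<close> by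
  \<open>one_plus_ln_sq_le\<close>; the 25 comes from \<open>1 + ln u \<le> 5 * ln (real N)\<close>
  for \<open>u \<ge> 2\<close>.\<close>

lemma moebius_frac_sum_empty_bound:
  obtains C where "C > 0" "\<And>u. u \<ge> 1 \<Longrightarrow> \<bar>moebius_frac_sum {} u\<bar> \<le> C * u / (1 + ln u)\<^sup>2"
proof -
  obtain C where C: "C > 0" "\<And>N. N \<ge> 2 \<Longrightarrow> \<bar>\<Sum>n=1..N. real_of_int (moebius_mu n) / real n\<bar> \<le> C / (ln (real N))\<^sup>2"
    using moebius_sum_bound by blast
  have "\<bar>moebius_frac_sum {} u\<bar> \<le> (25 * C + 4) * u / (1 + ln u)\<^sup>2" if u: "u \<ge> 1" for u
  proof -
    have lnu: "1 + ln u > 0" using u by (simp add: add_pos_nonneg)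
    have 1: "1 \<le> 4 * u / (1 + ln u)\<^sup>2"
      using one_plus_ln_sq_le[OF u] lnu by (simp add: le_divide_eq)
    define N where "N = nat \<lfloor>u\<rfloor>"
    have le: "(25 * C + 4) * u / (1 + ln u)\<^sup>2 = u * (25 * C / (1 + ln u)\<^sup>2) + 4 * u / (1 + ln u)\<^sup>2"
      by (simp add: field_simps add_divide_distrib)
    show ?thesis
    proof (cases "u < 2")
      case True
      hence "nat \<lfloor>u\<rfloor> = 1" using u by linarith
      hence "moebius_frac_sum {} u = u - 1" using moebius_frac_sum_empty[OF u] by simp
      moreover have "u * (25 * C / (1 + ln u)\<^sup>2) \<ge> 0" using u C by simp
      ultimately show ?thesis unfolding le using 1 True u by simp
    next
      case False
      have N: "N \<ge> 2" "u \<le> 2 * real N" using False by (auto simp: N_def) linarith+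
      have "1/2 \<le> ln (2::real)" using ln_2_less_1 ln2_ge_two_thirds by simp
      moreover have "ln 2 \<le> ln (real N)" using N by simp
      moreover have "ln u \<le> ln 2 + ln (real N)"
        using N u by (simp flip: ln_mult_pos)
      ultimately have "1 + ln u \<le> 5 * ln (real N)" "ln (real N) > 0"
        using ln_2_less_1 by linarith+
      hence "(1 + ln u)\<^sup>2 \<le> (5 * ln (real N))\<^sup>2" using u by (intro power_mono) auto
      hence "C / (ln (real N))\<^sup>2 \<le> 25 * C / (1 + ln u)\<^sup>2"
        using C lnu \<open>ln (real N) > 0\<close> by (simp add: field_simps)
      with C(2)[OF N(1)] have "\<bar>\<Sum>n=1..N. real_of_int (moebius_mu n) / real n\<bar> \<le> 25 * C / (1 + ln u)\<^sup>2"
        by simp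
      hence "u * \<bar>\<Sum>n=1..N. real_of_int (moebius_mu n) / real n\<bar> \<le> u * (25 * C / (1 + ln u)\<^sup>2)"
        using u by (intro mult_left_mono) auto
      moreover have "\<bar>moebius_frac_sum {} u\<bar> \<le> u * \<bar>\<Sum>n=1..N. real_of_int (moebius_mu n) / real n\<bar> + 1"
        unfolding moebius_frac_sum_empty[OF u] N_def[symmetric] 
        using abs_triangle_ineq4[of "u * (\<Sum>n=1..N. real_of_int (moebius_mu n) / real n)" 1] u by (simp add: abs_mult)
      ultimately show ?thesis unfolding le using 1 by linarith
    qed
  qed
  thus ?thesis using C(1) by (intro that[of "25 * C + 4"]) auto
qed

section \<open>Chebyshev and Mertens estimates\<close>

lemma primes_leD: "q \<in> primes_le z \<Longrightarrow> prime q" "q \<in> primes_le z \<Longrightarrow> real q \<le> z"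
  by (auto simp: primes_le_def)

lemma primes_le_ge_2: "q \<in> primes_le z \<Longrightarrow> q \<ge> 2"
  by (auto simp: primes_le_def prime_ge_2_nat)

lemma primes_le_mono: "x \<le> y \<Longrightarrow> primes_le x \<subseteq> primes_le y"
  by (auto simp: primes_le_def)

lemma ln_primes_le_nonneg: "q \<in> primes_le z \<Longrightarrow> 0 \<le> ln (real q)"
  using primes_le_ge_2[of q z] by simp

lemma prod_distinct_primes_dvd:
  fixes m :: nat
  assumes "finite A" "\<And>q. q \<in> A \<Longrightarrow> prime q" "\<And>q. q \<in> A \<Longrightarrow> q dvd m"
  shows "(\<Prod>q\<in>A. q) dvd m"
  using assms
proof (induction A rule: finite_induct)
  case (insert p A)
  have "coprime p (\<Prod>q\<in>A. q)"
    using insert by (intro prod_coprime_right primes_coprime) auto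
  thus ?case using insert by (simp add: divides_mult)
qed auto

text \<open>Chebyshev's argument: each prime in \<open>(n, 2n]\<close> divides the central binomial
  coefficient, which is at most \<open>4 ^ n\<close>.\<close>

lemma sum_ln_primes_le_double:
  "(\<Sum>q\<in>primes_le (real (2 * n)) - primes_le (real n). ln (real q)) \<le> real n * ln 4"
proof -
  let ?P = "primes_le (real (2 * n)) - primes_le (real n)"
  have "(\<Prod>q\<in>?P. q) dvd (2 * n) choose n"
  proof (rule prod_distinct_primes_dvd)
    fix q assume q: "q \<in> ?P"
    hence pr: "prime q" "n < q" "q \<le> 2 * n" by (auto simp: primes_le_def)
    have "q dvd fact (2 * n)" using pr by (simp add: prime_dvd_fact_iff)
    moreover have "fact (2 * n) = fact n * fact n * ((2 * n) choose n)"
      using binomial_fact_lemma[of n "2 * n"] by (simp add: mult_2)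
    moreover have "\<not> q dvd fact n" using pr by (simp add: prime_dvd_fact_iff)
    ultimately show "q dvd (2 * n) choose n" using pr by (simp add: prime_dvd_mult_iff)
  qed (auto intro: primes_leD)
  hence "(\<Prod>q\<in>?P. q) \<le> (2 * n) choose n"
    by (intro dvd_imp_le) auto
  also have "\<dots> \<le> 2 ^ (2 * n)" by (rule binomial_le_pow2)
  finally have "real (\<Prod>q\<in>?P. q) \<le> 4 ^ n"
  proof -
    assume "(\<Prod>q\<in>?P. q) \<le> 2 ^ (2 * n)"
    hence "(\<Prod>q\<in>?P. q) \<le> 4 ^ n" by (simp add: power_mult)
    hence "real (\<Prod>q\<in>?P. q) \<le> real (4 ^ n)" by (simp only: of_nat_le_iff)
    thus ?thesis by simp
  qed
  hence "ln (\<Prod>q\<in>?P. real q) \<le> ln (4 ^ n)"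
    by (subst ln_le_cancel_iff) (auto intro!: prod_pos dest: primes_le_ge_2)
  moreover have "ln (\<Prod>q\<in>?P. real q) = (\<Sum>q\<in>?P. ln (real q))"
    by (rule ln_prod) (auto dest: primes_le_ge_2)
  ultimately show ?thesis by (simp add: ln_realpow)
qed

lemma sum_ln_primes_le_pow2:
  "(\<Sum>q\<in>primes_le (2 ^ k). ln (real q)) \<le> 2 ^ Suc k"
proof (induction k)
  case 0
  have "primes_le 1 = {}" by (auto simp: primes_le_def dest: prime_ge_2_nat)
  thus ?case by simp
next
  case (Suc k)
  have sub: "primes_le (2 ^ k) \<subseteq> primes_le (2 ^ Suc k)"
    by (rule primes_le_mono) simp
  have "ln 4 = 2 * ln (2::real)" using ln_realpow[of 2 2] by simp
  hence ln4: "ln 4 \<le> (2::real)" using ln_2_less_1 by simp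
  have "(\<Sum>q\<in>primes_le (2 ^ Suc k). ln (real q)) = (\<Sum>q\<in>primes_le (2 ^ Suc k) - primes_le (2 ^ k). ln (real q)) + (\<Sum>q\<in>primes_le (2 ^ k). ln (real q))"
    by (rule sum.subset_diff[OF sub]) simp
  also have "(\<Sum>q\<in>primes_le (2 ^ Suc k) - primes_le (2 ^ k). ln (real q)) \<le> 2 ^ k * ln 4"
    using sum_ln_primes_le_double[of "2 ^ k"] by simp
  also have "2 ^ k * ln 4 \<le> 2 ^ k * (2::real)" using ln4 by (intro mult_left_mono) auto
  finally show ?case using Suc by simp
qed

lemma sum_ln_primes_le:
  assumes "x \<ge> 0"
  shows "(\<Sum>q\<in>primes_le x. ln (real q)) \<le> 4 * x"
proof (cases "x \<ge> 1")
  case True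
  define k where "k = nat \<lfloor>log 2 x\<rfloor>"
  have l: "0 \<le> log 2 x" using True by simp
  hence k: "real k \<le> log 2 x" "log 2 x < real k + 1" unfolding k_def by linarith+
  have "2 powr real k \<le> x" using k True by (simp add: le_log_iff)
  hence k1: "2 ^ k \<le> x" by (simp add: powr_realpow)
  have "x < 2 powr (real k + 1)" using k True by (simp add: log_less_iff)
  hence k2: "x < 2 ^ Suc k" by (simp add: powr_add powr_realpow)
  have "(\<Sum>q\<in>primes_le x. ln (real q)) \<le> (\<Sum>q\<in>primes_le (2 ^ Suc k). ln (real q))"
    using k2 by (intro sum_mono2 primes_le_mono) (auto intro: ln_primes_le_nonneg)
  also have "\<dots> \<le> 2 ^ Suc (Suc k)" by (rule sum_ln_primes_le_pow2)
  also have "\<dots> \<le> 4 * x" using k1 by simp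
  finally show ?thesis .
next
  case False
  hence "primes_le x = {}" by (auto simp: primes_le_def dest: prime_ge_2_nat)
  thus ?thesis using assms by simp
qed

text \<open>The primes in \<open>(y/2^(j+1), y/2^j]\<close> contribute \<open>O(h (2^j))\<close> by Chebyshev's bound.\<close>
lemma sum_ln_over_primes_dyadic:
  fixes h :: "real \<Rightarrow> real"
  assumes "y \<ge> 1" and h: "\<And>u. u \<ge> 1 \<Longrightarrow> h u \<ge> 0" "\<And>u v. 1 \<le> u \<Longrightarrow> u \<le> v \<Longrightarrow> h v \<le> h u"
  shows "(\<Sum>q\<in>primes_le y. ln (real q) / real q * h (y / real q)) \<le> 8 * (\<Sum>j\<le>nat \<lfloor>log 2 y\<rfloor>. h (2 ^ j))"
proof -
  define J where "J = nat \<lfloor>log 2 y\<rfloor>"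
  define j where "j = (\<lambda>q. nat \<lfloor>log 2 (y / real q)\<rfloor>)"
  have jq: "2 ^ j q \<le> y / real q" "y / real q < 2 ^ Suc (j q)" "j q \<le> J" if "q \<in> primes_le y" for q
  proof -
    have q: "real q \<ge> 1" "y / real q \<ge> 1"
      using that primes_le_ge_2[OF that] by (auto simp: primes_le_def)
    hence "0 \<le> log 2 (y / real q)" by simp
    hence k: "real (j q) \<le> log 2 (y / real q)" "log 2 (y / real q) < real (j q) + 1"
      unfolding j_def by linarith+
    have "2 powr real (j q) \<le> y / real q" using k q by (simp add: le_log_iff)
    thus "2 ^ j q \<le> y / real q" by (simp add: powr_realpow)
    have "y / real q < 2 powr (real (j q) + 1)" using k q by (simp add: log_less_iff)
    thus "y / real q < 2 ^ Suc (j q)" by (simp add: powr_add powr_realpow)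
    have "y / real q \<le> y" using q assms by (simp add: divide_le_eq mult_le_cancel_left1)
    hence "log 2 (y / real q) \<le> log 2 y" using q assms by simp
    thus "j q \<le> J" unfolding j_def J_def by (intro nat_mono floor_mono)
  qed
  have "(\<Sum>q\<in>primes_le y. ln (real q) / real q * h (y / real q))
      = (\<Sum>i\<le>J. \<Sum>q\<in>{q\<in>primes_le y. j q = i}. ln (real q) / real q * h (y / real q))"
    by (rule sum.group[symmetric]) (use jq in auto)
  also have "\<dots> \<le> (\<Sum>i\<le>J. 8 * h (2 ^ i))"
  proof (rule sum_mono)
    fix i
    have "(\<Sum>q\<in>{q\<in>primes_le y. j q = i}. ln (real q) / real q * h (y / real q))
       \<le> (\<Sum>q\<in>{q\<in>primes_le y. j q = i}. ln (real q) * (2 ^ Suc i / y * h (2 ^ i)))"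
    proof (rule sum_mono)
      fix q assume "q \<in> {q\<in>primes_le y. j q = i}"
      hence q: "q \<in> primes_le y" "j q = i" by auto
      have q2: "q \<ge> 2" using primes_le_ge_2[OF q(1)] .
      have "1 / real q \<le> 2 ^ Suc i / y"
        using jq(2)[OF q(1)] q2 assms(1) by (simp add: q field_simps)
      moreover have "h (y / real q) \<le> h (2 ^ i)"
        using jq(1)[OF q(1)] by (intro h) (auto simp: q)
      moreover have "h (y / real q) \<ge> 0"
        using jq(1)[OF q(1)] by (intro h) (rule order_trans[of _ "2 ^ j q"], auto)
      ultimately have "1 / real q * h (y / real q) \<le> 2 ^ Suc i / y * h (2 ^ i)"
        using assms(1) by (intro mult_mono) auto
      hence "ln (real q) * (1 / real q * h (y / real q)) \<le> ln (real q) * (2 ^ Suc i / y * h (2 ^ i))"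
        using q2 by (intro mult_left_mono) auto
      thus "ln (real q) / real q * h (y / real q) \<le> ln (real q) * (2 ^ Suc i / y * h (2 ^ i))" by simp
    qed
    also have "\<dots> = (\<Sum>q\<in>{q\<in>primes_le y. j q = i}. ln (real q)) * (2 ^ Suc i / y * h (2 ^ i))"
      by (rule sum_distrib_right[symmetric])
    also have "\<dots> \<le> 4 * (y / 2 ^ i) * (2 ^ Suc i / y * h (2 ^ i))"
    proof (rule mult_right_mono)
      have "(\<Sum>q\<in>{q\<in>primes_le y. j q = i}. ln (real q)) \<le> (\<Sum>q\<in>primes_le (y / 2 ^ i). ln (real q))"
      proof (rule sum_mono2)
        show "{q\<in>primes_le y. j q = i} \<subseteq> primes_le (y / 2 ^ i)"
        proof safe
          fix q assume q: "q \<in> primes_le y" "i = j q"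
          have "2 ^ j q \<le> y / real q" "real q > 0" using jq(1)[OF q(1)] primes_le_ge_2[OF q(1)] by auto
          hence "real q \<le> y / 2 ^ j q" by (simp add: field_simps)
          thus "q \<in> primes_le (y / 2 ^ j q)" using q(1) by (simp add: primes_le_def)
        qed
        show "0 \<le> ln (real q)" if "q \<in> primes_le (y / 2 ^ i) - {q\<in>primes_le y. j q = i}" for q
          using that by (auto intro: ln_primes_le_nonneg)
      qed simp
      also have "\<dots> \<le> 4 * (y / 2 ^ i)" using assms by (intro sum_ln_primes_le) auto
      finally show "(\<Sum>q\<in>{q\<in>primes_le y. j q = i}. ln (real q)) \<le> 4 * (y / 2 ^ i)" .
    qed (use assms in \<open>auto intro!: h\<close>)
    also have "\<dots> = 8 * h (2 ^ i)" using assms by simp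
    finally show "(\<Sum>q\<in>{q\<in>primes_le y. j q = i}. ln (real q) / real q * h (y / real q)) \<le> 8 * h (2 ^ i)" .
  qed
  also have "\<dots> = 8 * (\<Sum>j\<le>J. h (2 ^ j))" by (simp add: sum_distrib_left)
  finally show ?thesis by (simp add: J_def)
qed

lemma ln_2_ge_half: "ln (2::real) \<ge> 1/2"
  using ln2_ge_two_thirds by simp

lemma log_2_le: "y \<ge> 1 \<Longrightarrow> log 2 y \<le> 2 * ln y"
proof -
  assume "y \<ge> 1"
  hence "ln y * 1 \<le> ln y * (2 * ln 2)" using ln_2_ge_half by (intro mult_left_mono) auto
  thus ?thesis using ln_2_ge_half by (simp add: log_def divide_le_eq mult_ac)
qed

text \<open>With \<open>h = 1\<close> every dyadic block contributes a constant: the upper half of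
  Mertens' first theorem.\<close>

lemma sum_ln_over_primes:
  assumes "z \<ge> 2"
  shows "(\<Sum>q\<in>primes_le z. ln (real q) / real q) \<le> 32 * ln z"
proof -
  have L: "ln z \<ge> 1/2" using assms ln_2_ge_half ln_le_cancel_iff[of 2 z] by linarith
  have "(\<Sum>q\<in>primes_le z. ln (real q) / real q * 1) \<le> 8 * (\<Sum>j\<le>nat \<lfloor>log 2 z\<rfloor>. 1)"
    using assms by (intro sum_ln_over_primes_dyadic) auto
  also have "\<dots> = 8 * (real (nat \<lfloor>log 2 z\<rfloor>) + 1)" by simp
  also have "real (nat \<lfloor>log 2 z\<rfloor>) \<le> log 2 z" using assms by simp
  also have "log 2 z \<le> 2 * ln z" using assms by (intro log_2_le) auto
  finally show ?thesis using L by simp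
qed

lemma sum_inverse_le_ln: "(\<Sum>j\<le>n. 1 / real (Suc j)) \<le> 1 + ln (real (Suc n))"
proof (induction n)
  case (Suc n)
  have "ln (real (Suc n) / real (Suc (Suc n))) \<le> real (Suc n) / real (Suc (Suc n)) - 1"
    by (intro ln_le_minus_one) simp
  also have "\<dots> = - (1 / real (Suc (Suc n)))" by (simp add: field_simps)
  finally have "1 / real (Suc (Suc n)) \<le> ln (real (Suc (Suc n))) - ln (real (Suc n))"
    by (subst (asm) ln_div) auto
  thus ?case using Suc by simp
qed auto

text \<open>Here \<open>h (2 ^ j)\<close> has order \<open>1 / (j + 1)\<close>, so the dyadic sum is
  harmonic with about \<open>log 2 y\<close> terms and grows only like
  \<open>ln ln y\<close>.\<close>

lemma sum_ln_over_primes_weighted: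
  assumes "y \<ge> 1"
  shows "(\<Sum>q\<in>primes_le y. ln (real q) / real q * (1 / (1 + ln (y / real q)))) \<le> 16 * (1 + ln (1 + 2 * ln y))"
proof -
  let ?J = "nat \<lfloor>log 2 y\<rfloor>"
  have "(\<Sum>q\<in>primes_le y. ln (real q) / real q * (1 / (1 + ln (y / real q)))) \<le> 8 * (\<Sum>j\<le>?J. 1 / (1 + ln (2 ^ j)))"
    by (rule sum_ln_over_primes_dyadic[OF assms]) (auto intro!: frac_le add_pos_nonneg)
  also have "(\<Sum>j\<le>?J. 1 / (1 + ln (2 ^ j))) \<le> (\<Sum>j\<le>?J. 2 * (1 / real (Suc j)))"
  proof (rule sum_mono)
    fix j
    have "real j * (1/2) \<le> real j * ln 2" using ln_2_ge_half by (intro mult_left_mono) auto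
    hence "real (Suc j) / 2 \<le> 1 + ln (2 ^ j)" by (simp add: ln_realpow)
    hence "1 / (1 + ln (2 ^ j)) \<le> 1 / (real (Suc j) / 2)" by (intro divide_left_mono) (auto intro!: mult_pos_pos add_pos_nonneg)
    thus "1 / (1 + ln (2 ^ j)) \<le> 2 * (1 / real (Suc j))" by simp
  qed
  also have "\<dots> = 2 * (\<Sum>j\<le>?J. 1 / real (Suc j))" by (rule sum_distrib_left[symmetric])
  also have "\<dots> \<le> 2 * (1 + ln (real (Suc ?J)))" by (intro mult_left_mono sum_inverse_le_ln) auto
  also have "ln (real (Suc ?J)) \<le> ln (1 + 2 * ln y)"
  proof -
    have "real ?J \<le> log 2 y" using assms by simp
    also have "\<dots> \<le> 2 * ln y" by (rule log_2_le[OF assms])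
    finally show ?thesis by simp
  qed
  finally show ?thesis by simp
qed

section \<open>Mertens products and the sum of reciprocals of primes\<close>

lemma norm_zeta_le:
  assumes "\<eta> > 0"
  shows "norm (zeta (of_real (1 + \<eta>))) \<le> 1 + 1 / \<eta>"
proof -
  let ?s = "complex_of_real (1 + \<eta>)"
  have Un: "{0<..} = {1} \<union> {1::nat<..}" by auto
  have "zeta ?s = dirichlet_sum (\<lambda>_. 1) {1} ?s + dirichlet_sum (\<lambda>_. 1) {1<..} ?s"
    unfolding zeta_def Un by (rule dirichlet_sum_union) (use assms in auto)
  moreover have "norm (dirichlet_sum (\<lambda>_. 1) {1<..} ?s) \<le> real 1 powr (1 - Re ?s) / (Re ?s - 1)"
    by (rule norm_dirichlet_sum_tail_le) (use assms in auto)
  moreover have "dirichlet_sum (\<lambda>_. 1) {1} ?s = 1" by (simp add: dirichlet_sum_def)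
  ultimately show ?thesis
    using norm_triangle_ineq[of 1 "dirichlet_sum (\<lambda>_. 1) {1<..} ?s"] by simp
qed

text \<open>The Euler factors times \<open>zeta (1 + \<eta>)\<close> give the series over integers
  free of primes up to \<open>z\<close>; its terms are nonnegative and the term of 1 is 1.\<close>

lemma prod_primes_le_zeta:
  assumes "\<eta> > 0"
  shows "1 \<le> (\<Prod>q\<in>primes_le z. 1 - real q powr (-1-\<eta>)) * (1 + 1 / \<eta>)"
proof -
  let ?s = "complex_of_real (1 + \<eta>)" and ?A = "coprime_set (primes_le z)"
  have summ: "(\<lambda>n. 1 * of_nat n powr (-?s)) summable_on ?A"
    using assms by (intro summable_dirichlet) auto
  have ReT: "Re (1 * of_nat n powr (-?s)) = real n powr (-1-\<eta>)" for n
    using powr_of_real[of "real n" "-1-\<eta>"] by (simp add: algebra_simps)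
  have q0: "1 - real q powr (-1-\<eta>) \<ge> 0" if "q \<in> primes_le z" for q
    using primes_le_ge_2[OF that] assms powr_mono[of "-1-\<eta>" 0 "real q"] by simp
  have "1 = (\<Sum>n\<in>{1::nat}. real n powr (-1-\<eta>))" by simp
  also have "\<dots> \<le> infsum (\<lambda>n. real n powr (-1-\<eta>)) ?A"
    using summable_on_Re[OF summ] unfolding ReT
    by (intro finite_sum_le_infsum) (auto simp: coprime_set_def primes_le_def)
  also have "\<dots> = Re (dirichlet_sum (\<lambda>_. 1) ?A ?s)"
    unfolding dirichlet_sum_def using infsum_Re[OF summ] unfolding ReT by simp
  also have "\<dots> \<le> norm (dirichlet_sum (\<lambda>_. 1) ?A ?s)" by (rule complex_Re_le_cmod)
  also have "\<dots> = (\<Prod>q\<in>primes_le z. norm (1 - of_nat q powr (-?s))) * norm (zeta ?s)"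
    using assms by (subst zeta_euler_factor) (auto simp: primes_leD norm_mult prod_norm)
  also have "(\<Prod>q\<in>primes_le z. norm (1 - of_nat q powr (-?s))) = (\<Prod>q\<in>primes_le z. 1 - real q powr (-1-\<eta>))"
  proof (rule prod.cong)
    fix q assume q: "q \<in> primes_le z"
    have "of_nat q powr (-?s) = complex_of_real (real q powr (-1-\<eta>))"
      using powr_of_real[of "real q" "-1-\<eta>"] by (simp add: algebra_simps)
    hence "1 - of_nat q powr (-?s) = complex_of_real (1 - real q powr (-1-\<eta>))" by simp
    thus "norm (1 - of_nat q powr (-?s)) = 1 - real q powr (-1-\<eta>)"
      using q0[OF q] by (simp only: norm_of_real)
  qed auto
  also have "\<dots> * norm (zeta ?s) \<le> (\<Prod>q\<in>primes_le z. 1 - real q powr (-1-\<eta>)) * (1 + 1 / \<eta>)"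
    using q0 norm_zeta_le[OF assms] by (intro mult_left_mono prod_nonneg) auto
  finally show ?thesis .
qed

text \<open>Compares the Euler factors at \<open>1 - \<eta>\<close> and \<open>1 + \<eta>\<close>; the product of the latter is bounded by \<open>\<zeta>(1 + \<eta>)\<close>.\<close>

lemma prime_factor_shift_bound:
  fixes L :: real
  assumes "q \<ge> 2" "ln (real q) \<le> L"
  defines "\<eta> \<equiv> 1 / (2 * L)"
  shows "real q powr (-1+\<eta>) \<le> 7/8"
    and "1 - real q powr (-1-\<eta>) \<le> (1 - real q powr (-1+\<eta>)) * exp (12 / L * (ln (real q) / real q))"
proof -
  define t where "t = \<eta> * ln (real q)"
  have lq: "ln (real q) > 0" using assms by simp
  have L: "L > 0" using assms lq by linarith
  have t_eq: "t = ln (real q) / (2 * L)" by (simp add: t_def \<eta>_def)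
  have t: "0 \<le> t" "t \<le> 1/2" using L lq assms(2) by (simp_all add: t_eq divide_le_eq)
  define a where "a = real q powr (-1+\<eta>)"
  define b where "b = real q powr (-1-\<eta>)"
  have a: "a = exp t / real q" and b: "b = exp (-t) / real q"
    using assms by (auto simp: a_def b_def t_def powr_def exp_add exp_diff exp_minus field_simps)
  have "exp t \<le> 1 + t + t\<^sup>2" using t by (intro exp_bound) auto
  also have "t\<^sup>2 \<le> 1/2 * t" using t unfolding power2_eq_square by (intro mult_right_mono) auto
  finally have et: "exp t \<le> 1 + 3/2 * t" by simp
  have a78: "a \<le> (7/4) / 2" unfolding a using et t assms by (intro frac_le) auto
  thus "real q powr (-1+\<eta>) \<le> 7/8" by (simp add: a_def)
  have "exp (-t) \<ge> 1 - t" using exp_ge_add_one_self[of "-t"] by simp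
  hence "exp t - exp (-t) \<le> 3 * t" using et t by linarith
  hence ab: "a - b \<le> 3 * t / real q" unfolding a b using assms by (simp add: divide_right_mono flip: diff_divide_distrib)
  have "1 - b = (1 - a) + (a - b)" by simp
  \<comment> \<open>\<open>a \<le> 7/8\<close> gives \<open>1 \<le> 8 * (1 - a)\<close> and turns
    the difference of the factors into a relative error. As \<open>t = ln q / (2 L)\<close>, the
    constant is \<open>8 * 3 / 2 = 12\<close>.\<close>
  also have "\<dots> \<le> (1 - a) + (1 - a) * (8 * (3 * t / real q))"
  proof -
    have "1 * (3 * t / real q) \<le> (8 * (1 - a)) * (3 * t / real q)"
      using a78 t by (intro mult_right_mono) auto
    thus ?thesis using ab by (simp add: mult_ac)
  qed
  also have "\<dots> = (1 - a) * (1 + 12 / L * (ln (real q) / real q))"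
    using L by (simp add: t_def \<eta>_def algebra_simps)
  also have "\<dots> \<le> (1 - a) * exp (12 / L * (ln (real q) / real q))"
    using a78 by (intro mult_left_mono exp_ge_add_one_self) auto
  finally show "1 - real q powr (-1-\<eta>) \<le> (1 - real q powr (-1+\<eta>)) * exp (12 / L * (ln (real q) / real q))"
    by (simp add: a_def b_def)
qed

text \<open>The exponents may lie left of \<open>-1 + 0\<close> by a margin
  \<open>1 / (2 ln z)\<close> in the harmful direction: moving them across to
  \<open>-1 - \<eta>\<close> costs at most \<open>exp (12 * 32)\<close> in total by
  \<open>sum_ln_over_primes\<close>, and \<open>1 + 1 / \<eta> = 1 + 2 ln z\<close> supplies the
  order of growth.\<close>

lemma mertens_product:
  obtains C where "C > 0"
    "\<And>z. z \<ge> 2 \<Longrightarrow> (\<Prod>q\<in>primes_le z. 1 / (1 - real q powr (-1 + 1 / (2 * ln z)))) \<le> C * ln z"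
proof -
  have "(\<Prod>q\<in>primes_le z. 1 / (1 - real q powr (-1 + 1 / (2 * ln z)))) \<le> (4 * exp 384) * ln z" if z: "z \<ge> 2" for z
  proof -
    define L where "L = ln z"
    define \<eta> where "\<eta> = 1 / (2 * L)"
    have L: "L \<ge> 1/2" using z ln_2_ge_half ln_le_cancel_iff[of 2 z] unfolding L_def by linarith
    have \<eta>: "\<eta> > 0" using L by (simp add: \<eta>_def)
    have q: "q \<ge> 2" "ln (real q) \<le> L" if "q \<in> primes_le z" for q
      using primes_le_ge_2[OF that] primes_leD(2)[OF that] by (auto simp: L_def)
    have a: "real q powr (-1+\<eta>) \<le> 7/8" if "q \<in> primes_le z" for q
      using prime_factor_shift_bound(1)[OF q[OF that]] by (simp add: \<eta>_def)
    let ?A = "\<Prod>q\<in>primes_le z. 1 - real q powr (-1+\<eta>)"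
    have A: "?A > 0" using a by (intro prod_pos) force
    have "(\<Prod>q\<in>primes_le z. 1 - real q powr (-1-\<eta>)) \<le> (\<Prod>q\<in>primes_le z. (1 - real q powr (-1+\<eta>)) * exp (12 / L * (ln (real q) / real q)))"
    proof (rule prod_mono, intro conjI)
      fix q assume "q \<in> primes_le z"
      note q = q[OF this]
      show "0 \<le> 1 - real q powr (-1-\<eta>)"
        using q \<eta> powr_mono[of "-1-\<eta>" 0 "real q"] by simp
      show "1 - real q powr (-1-\<eta>) \<le> (1 - real q powr (-1+\<eta>)) * exp (12 / L * (ln (real q) / real q))"
        using prime_factor_shift_bound(2)[OF q] by (simp add: \<eta>_def)
    qed
    also have "\<dots> = ?A * exp (12 / L * (\<Sum>q\<in>primes_le z. ln (real q) / real q))"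
      by (simp add: prod.distrib exp_sum sum_distrib_left)
    also have "\<dots> \<le> ?A * exp 384"
    proof (rule mult_left_mono)
      have "12 / L * (\<Sum>q\<in>primes_le z. ln (real q) / real q) \<le> 12 / L * (32 * L)"
        using L sum_ln_over_primes[OF z] by (intro mult_left_mono) (auto simp: L_def)
      also have "\<dots> = 384" using L by simp
      finally show "exp (12 / L * (\<Sum>q\<in>primes_le z. ln (real q) / real q)) \<le> exp 384" by simp
    qed (use A in auto)
    finally have "(\<Prod>q\<in>primes_le z. 1 - real q powr (-1-\<eta>)) \<le> ?A * exp 384" .
    hence "(\<Prod>q\<in>primes_le z. 1 - real q powr (-1-\<eta>)) * (1 + 1 / \<eta>) \<le> ?A * exp 384 * (1 + 1 / \<eta>)"
      using \<eta> by (intro mult_right_mono) auto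
    also have "1 + 1 / \<eta> \<le> 4 * L" using L by (simp add: \<eta>_def)
    finally have "(\<Prod>q\<in>primes_le z. 1 - real q powr (-1-\<eta>)) * (1 + 1 / \<eta>) \<le> ?A * exp 384 * (4 * L)"
      using A by (simp add: mult_left_mono)
    with prod_primes_le_zeta[OF \<eta>, of z] have "1 \<le> ?A * exp 384 * (4 * L)" by linarith
    hence "1 / ?A \<le> 4 * exp 384 * L" using A by (simp add: divide_le_eq mult_ac)
    thus ?thesis by (simp add: prod_dividef \<eta>_def L_def)
  qed
  thus ?thesis by (intro that[of "4 * exp 384"]) auto
qed

text \<open>The logarithm of the Mertens product: \<open>exp (1/q)\<close> is at most
  \<open>1 / (1 - 1/q)\<close>, and the shifted exponent only enlarges this factor.\<close>

lemma sum_inverse_primes: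
  obtains C where "C > 0" "\<And>z. z \<ge> 2 \<Longrightarrow> (\<Sum>q\<in>primes_le z. 1 / real q) \<le> ln (C * ln z)"
proof -
  obtain C where C: "C > 0" "\<And>z. z \<ge> 2 \<Longrightarrow> (\<Prod>q\<in>primes_le z. 1 / (1 - real q powr (-1 + 1 / (2 * ln z)))) \<le> C * ln z"
    using mertens_product by blast
  have "(\<Sum>q\<in>primes_le z. 1 / real q) \<le> ln (C * ln z)" if z: "z \<ge> 2" for z
  proof -
    have L: "ln z > 0" using z by simp
    have "exp (\<Sum>q\<in>primes_le z. 1 / real q) = (\<Prod>q\<in>primes_le z. exp (1 / real q))"
      by (simp add: exp_sum)
    also have "\<dots> \<le> (\<Prod>q\<in>primes_le z. 1 / (1 - real q powr (-1 + 1 / (2 * ln z))))"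
    proof (rule prod_mono, intro conjI)
      fix q assume q: "q \<in> primes_le z"
      have q2: "q \<ge> 2" by (rule primes_le_ge_2[OF q])
      have "real q powr (-1 + 1 / (2 * ln z)) \<le> 7/8"
        using q2 primes_leD(2)[OF q] by (intro prime_factor_shift_bound) auto
      moreover have "1 - real q powr (-1 + 1 / (2 * ln z)) \<le> exp (- (1 / real q))"
      proof -
        have "real q powr (-1) \<le> real q powr (-1 + 1 / (2 * ln z))"
          using q2 L by (intro powr_mono) auto
        hence "1 - real q powr (-1 + 1 / (2 * ln z)) \<le> 1 + - (1 / real q)"
          using q2 by (simp add: powr_minus_divide)
        also have "\<dots> \<le> exp (- (1 / real q))" by (rule exp_ge_add_one_self)
        finally show ?thesis .
      qed
      ultimately have "1 / exp (- (1 / real q)) \<le> 1 / (1 - real q powr (-1 + 1 / (2 * ln z)))"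
        by (intro divide_left_mono) auto
      thus "exp (1 / real q) \<le> 1 / (1 - real q powr (-1 + 1 / (2 * ln z)))"
        by (simp add: exp_minus field_simps)
    qed auto
    also have "\<dots> \<le> C * ln z" by (rule C(2)[OF z])
    finally show ?thesis using C(1) L by (subst ln_ge_iff) auto
  qed
  thus ?thesis using C(1) that by blast
qed

section \<open>Sums over integers without small prime factors\<close>

lemma rough_upto_lt_1: "y < 1 \<Longrightarrow> rough_upto P y = {}"
  by (auto simp: rough_upto_def coprime_set_def)

lemma moebius_frac_sum_lt_1: "y < 1 \<Longrightarrow> moebius_frac_sum P y = 0"
  by (simp add: moebius_frac_sum_def rough_upto_lt_1)

lemma rough_upto_multiples:
  assumes "prime q" "q \<notin> P" "\<forall>p\<in>P. prime p"
  shows "{m \<in> rough_upto P y. q dvd m} = (\<lambda>n. q * n) ` rough_upto P (y / real q)"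
proof -
  have q: "q > 0" using assms prime_gt_0_nat by blast
  have iff: "q * n \<in> rough_upto P y \<longleftrightarrow> n \<in> rough_upto P (y / real q)" for n
    using assms q by (auto simp: rough_upto_def coprime_set_def prime_dvd_mult_iff field_simps dest: primes_dvd_imp_eq)
  show ?thesis
  proof (intro equalityI subsetI)
    fix m assume "m \<in> {m \<in> rough_upto P y. q dvd m}"
    thus "m \<in> (\<lambda>n. q * n) ` rough_upto P (y / real q)"
      using iff by (auto elim!: dvdE)
  next
    fix m assume "m \<in> (\<lambda>n. q * n) ` rough_upto P (y / real q)"
    thus "m \<in> {m \<in> rough_upto P y. q dvd m}" using iff by auto
  qed
qed

text \<open>\<open>q * n\<close> has Moebius value 0 if \<open>q\<close> divides \<open>n\<close>
  and minus that of \<open>n\<close> otherwise; hence \<open>q\<close> joins \<open>P\<close> on the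
  right.\<close>

lemma sum_moebius_rough_multiples:
  fixes g :: "nat \<Rightarrow> real"
  assumes "prime q" "q \<notin> P" "\<forall>p\<in>P. prime p"
  shows "(\<Sum>m | m \<in> rough_upto P y \<and> q dvd m. real_of_int (moebius_mu m) * g m)
       = - (\<Sum>n\<in>rough_upto (insert q P) (y / real q). real_of_int (moebius_mu n) * g (q * n))"
proof -
  have q: "q > 0" using assms prime_gt_0_nat by blast
  have "(\<Sum>m | m \<in> rough_upto P y \<and> q dvd m. real_of_int (moebius_mu m) * g m)
      = (\<Sum>n\<in>rough_upto P (y / real q). real_of_int (moebius_mu (q * n)) * g (q * n))"
    unfolding rough_upto_multiples[OF assms] using q by (subst sum.reindex) (auto simp: inj_on_def)
  also have "\<dots> = (\<Sum>n\<in>rough_upto (insert q P) (y / real q). real_of_int (moebius_mu (q * n)) * g (q * n))"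
    using assms(1) by (intro sum.mono_neutral_right finite_rough_upto) (auto simp: rough_upto_def coprime_set_def moebius_mu_prime_mult_eq_0)
  also have "\<dots> = (\<Sum>n\<in>rough_upto (insert q P) (y / real q). - (real_of_int (moebius_mu n) * g (q * n)))"
    using assms(1) by (intro sum.cong) (auto simp: rough_upto_def coprime_set_def moebius_mu_prime_mult)
  finally show ?thesis by (simp add: sum_negf)
qed

lemma moebius_frac_sum_insert:
  assumes "prime q" "q \<notin> P" "\<forall>p\<in>P. prime p"
  shows "moebius_frac_sum (insert q P) y = moebius_frac_sum P y + moebius_frac_sum (insert q P) (y / real q)"
proof -
  let ?f = "\<lambda>m. real_of_int (moebius_mu m) * frac (y / real m)"
  have "moebius_frac_sum P y = (\<Sum>m | m \<in> rough_upto P y \<and> q dvd m. ?f m) + (\<Sum>m | m \<in> rough_upto P y \<and> \<not> q dvd m. ?f m)"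
    unfolding moebius_frac_sum_def by (subst sum.union_disjoint[symmetric]) (auto intro!: sum.cong)
  also have "{m. m \<in> rough_upto P y \<and> \<not> q dvd m} = rough_upto (insert q P) y"
    by (auto simp: rough_upto_def coprime_set_def)
  also have "(\<Sum>m | m \<in> rough_upto P y \<and> q dvd m. ?f m) = - moebius_frac_sum (insert q P) (y / real q)"
    unfolding sum_moebius_rough_multiples[OF assms] moebius_frac_sum_def by simp
  finally show ?thesis by (simp add: moebius_frac_sum_def)
qed

text \<open>Unrolled, the recursion expresses the new sum by the old ones at \<open>y\<close>,
  \<open>y/q\<close>, \<open>y/q^2\<close> and so on down to 1. Since \<open>H\<close> contracts by
  \<open>r\<close>, the bounds form a geometric series.\<close>

lemma moebius_frac_sum_insert_bound:
  fixes H :: "real \<Rightarrow> real"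
  assumes "prime q" "q \<notin> P" "\<forall>p\<in>P. prime p"
    and r: "0 \<le> r" "r < 1" and B: "B \<ge> 0"
    and H: "\<And>y. y \<ge> 1 \<Longrightarrow> H y \<ge> 0" "\<And>y. y \<ge> real q \<Longrightarrow> H (y / real q) \<le> r * H y"
    and bound: "\<And>y. y \<ge> 1 \<Longrightarrow> \<bar>moebius_frac_sum P y\<bar> \<le> B * H y"
    and "y \<ge> 1"
  shows "\<bar>moebius_frac_sum (insert q P) y\<bar> \<le> B / (1 - r) * H y"
proof -
  have q: "q \<ge> 2" using assms(1) by (rule prime_ge_2_nat)
  \<comment> \<open>The exponent \<open>n\<close> bounds the depth: as \<open>q \<ge> 2\<close>,
    division by \<open>q\<close> lowers it by one, and \<open>n = 0\<close> is vacuous.\<close>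
  have "\<bar>moebius_frac_sum (insert q P) y\<bar> \<le> B / (1 - r) * H y" if "y \<ge> 1" "y < 2 ^ n" for n y
    using that
  proof (induction n arbitrary: y)
    case (Suc n)
    have rec: "\<bar>moebius_frac_sum (insert q P) y\<bar> \<le> B * H y + \<bar>moebius_frac_sum (insert q P) (y / real q)\<bar>"
      using moebius_frac_sum_insert[OF assms(1-3), of y] bound[OF Suc.prems(1)] by linarith
    show ?case
    proof (cases "y < real q")
      case True
      hence "y / real q < 1" using q by simp
      hence "\<bar>moebius_frac_sum (insert q P) y\<bar> \<le> B * H y"
        using rec by (simp add: moebius_frac_sum_lt_1)
      also have "\<dots> \<le> B / (1 - r) * H y"
        using r B H(1)[OF Suc.prems(1)] by (intro mult_right_mono) (auto simp: le_divide_eq algebra_simps)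
      finally show ?thesis .
    next
      case False
      have "y / real q \<le> y / 2" using q Suc.prems by (intro divide_left_mono) auto
      moreover have "y / 2 < 2 ^ n" using Suc.prems by simp
      ultimately have "y / real q < 2 ^ n" by linarith
      moreover have "y / real q \<ge> 1" using False q by simp
      ultimately have "\<bar>moebius_frac_sum (insert q P) (y / real q)\<bar> \<le> B / (1 - r) * H (y / real q)"
        by (intro Suc.IH)
      also have "\<dots> \<le> B / (1 - r) * (r * H y)"
        using r B False H by (intro mult_left_mono) auto
      finally have "\<bar>moebius_frac_sum (insert q P) y\<bar> \<le> B * H y + B / (1 - r) * (r * H y)"
        using rec by simp
      also have "\<dots> = B / (1 - r) * H y" using r by (simp add: field_simps)
      finally show ?thesis .
    qed
  qed auto
  moreover obtain n where "y < 2 ^ n" using real_arch_pow[of 2 y] by auto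
  ultimately show ?thesis using \<open>y \<ge> 1\<close> by blast
qed

text \<open>With \<open>b = 4 ln z\<close> the majorant loses, per prime \<open>q \<le> z\<close>, exactly an Euler factor of the product
  in \<open>mertens_product\<close>.\<close>

lemma quadratic_log_shift:
  fixes b u :: real
  assumes "b > 0" "q > 0" "u \<ge> real q"
  shows "(u / real q) / (b + ln (u / real q))\<^sup>2 \<le> real q powr (-1 + 2 / b) * (u / (b + ln u)\<^sup>2)"
proof -
  have u: "u > 0" "u / real q \<ge> 1" using assms by auto
  define w where "w = b + ln (u / real q)"
  have w: "w \<ge> b" "w > 0" using u assms by (auto simp: w_def add_pos_nonneg)
  have lq: "ln (real q) \<ge> 0" using assms by simp
  have eq: "b + ln u = w + ln (real q)" using assms u by (simp add: w_def ln_div)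
  have "w + ln (real q) \<le> w * (1 + ln (real q) / b)"
  proof -
    have "ln (real q) * b \<le> ln (real q) * w" using w lq by (intro mult_left_mono) auto
    thus ?thesis using assms by (simp add: field_simps)
  qed
  also have "\<dots> \<le> w * exp (ln (real q) / b)"
    using w by (intro mult_left_mono exp_ge_add_one_self) auto
  finally have "(w + ln (real q))\<^sup>2 \<le> (w * exp (ln (real q) / b))\<^sup>2"
    using w lq by (intro power_mono) auto
  also have "\<dots> = w\<^sup>2 * real q powr (2 / b)"
    using assms by (simp add: power_mult_distrib powr_def exp_double[symmetric] field_simps)
  finally have le: "(b + ln u)\<^sup>2 \<le> w\<^sup>2 * real q powr (2 / b)" by (simp add: eq)
  have pos: "b + ln u > 0" using eq w lq by simp
  have "1 / w\<^sup>2 \<le> real q powr (2 / b) / (b + ln u)\<^sup>2"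
    using le w pos by (simp add: field_simps)
  hence "(u / real q) * (1 / w\<^sup>2) \<le> (u / real q) * (real q powr (2 / b) / (b + ln u)\<^sup>2)"
    using u by (intro mult_left_mono) auto
  also have "\<dots> = real q powr (-1 + 2 / b) * (u / (b + ln u)\<^sup>2)"
    using assms powr_diff[of "real q" "2 / b" 1] by simp
  finally show ?thesis by (simp add: w_def)
qed

text \<open>One majorant, with \<open>b\<close> fixed, serves all the primes, so their factors
  \<open>1 / (1 - r)\<close> simply multiply up.\<close>

lemma moebius_frac_sum_prod_bound:
  fixes b :: real
  assumes "finite P" "\<forall>p\<in>P. prime p" "b > 0" "B \<ge> 0"
    and r: "\<And>q. q \<in> P \<Longrightarrow> real q powr (-1 + 2 / b) < 1"
    and bound: "\<And>y. y \<ge> 1 \<Longrightarrow> \<bar>moebius_frac_sum {} y\<bar> \<le> B * (y / (b + ln y)\<^sup>2)"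
    and "y \<ge> 1"
  shows "\<bar>moebius_frac_sum P y\<bar> \<le> B * (\<Prod>q\<in>P. 1 / (1 - real q powr (-1 + 2 / b))) * (y / (b + ln y)\<^sup>2)"
  using assms(1,2) r \<open>y \<ge> 1\<close>
proof (induction P arbitrary: y rule: finite_induct)
  case empty
  thus ?case using bound by simp
next
  case (insert q P)
  let ?r = "real q powr (-1 + 2 / b)" and ?\<Pi> = "\<Prod>q\<in>P. 1 / (1 - real q powr (-1 + 2 / b))"
  have q: "prime q" "q > 0" using insert.prems prime_gt_0_nat by auto
  have "\<bar>moebius_frac_sum (insert q P) y\<bar> \<le> (B * ?\<Pi>) / (1 - ?r) * (y / (b + ln y)\<^sup>2)"
  proof (rule moebius_frac_sum_insert_bound[where H = "\<lambda>y. y / (b + ln y)\<^sup>2"])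
    show "B * ?\<Pi> \<ge> 0"
      using insert.prems(2) \<open>B \<ge> 0\<close> by (intro mult_nonneg_nonneg prod_nonneg) (auto simp: less_imp_le)
    show "\<bar>moebius_frac_sum P u\<bar> \<le> B * ?\<Pi> * (u / (b + ln u)\<^sup>2)" if "u \<ge> 1" for u
      using insert that by auto
    show "u / real q / (b + ln (u / real q))\<^sup>2 \<le> ?r * (u / (b + ln u)\<^sup>2)" if "u \<ge> real q" for u
      using that q \<open>b > 0\<close> by (intro quadratic_log_shift) auto
  qed (use insert q in auto)
  thus ?case using insert by simp
qed

lemma ln_ge_half: "z \<ge> 2 \<Longrightarrow> ln z \<ge> (1/2 :: real)"
  using ln_2_ge_half ln_le_cancel_iff[of 2 z] by linarith

text \<open>Two powers of \<open>ln z\<close> pay for replacing \<open>1 + ln u\<close> by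
  \<open>b + ln u\<close>, through \<open>b + ln u \<le> 6 * L * (1 + ln u)\<close>; the third is
  \<open>mertens_product\<close>.\<close>

lemma moebius_frac_sum_primes_le_bound:
  obtains C where "C > 0" "\<And>z y. z \<ge> 2 \<Longrightarrow> y \<ge> 1 \<Longrightarrow> \<bar>moebius_frac_sum (primes_le z) y\<bar> \<le> C * (ln z) ^ 3 * y / (1 + ln y)\<^sup>2"
proof -
  obtain C1 where C1: "C1 > 0" "\<And>u. u \<ge> 1 \<Longrightarrow> \<bar>moebius_frac_sum {} u\<bar> \<le> C1 * u / (1 + ln u)\<^sup>2"
    using moebius_frac_sum_empty_bound by blast
  obtain C2 where C2: "C2 > 0" "\<And>z. z \<ge> 2 \<Longrightarrow> (\<Prod>q\<in>primes_le z. 1 / (1 - real q powr (-1 + 1 / (2 * ln z)))) \<le> C2 * ln z"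
    using mertens_product by blast
  have "\<bar>moebius_frac_sum (primes_le z) y\<bar> \<le> (36 * C1 * C2) * (ln z) ^ 3 * y / (1 + ln y)\<^sup>2"
    if z: "z \<ge> 2" and y: "y \<ge> 1" for z y
  proof -
    define L where "L = ln z"
    have L: "L \<ge> 1/2" using ln_ge_half[OF z] by (simp add: L_def)
    define b where "b = 4 * L"
    have b: "b > 0" "2 / b = 1 / (2 * L)" using L by (auto simp: b_def)
    have base: "\<bar>moebius_frac_sum {} u\<bar> \<le> (36 * C1 * L\<^sup>2) * (u / (b + ln u)\<^sup>2)" if u: "u \<ge> 1" for u
    proof -
      have l: "ln u \<ge> 0" using u by simp
      have "b * 1 + 1 * ln u \<le> b * (1 + ln u) + 2 * L * (1 + ln u)"
        using b L l by (intro add_mono mult_mono) auto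
      hence "b + ln u \<le> 6 * L * (1 + ln u)" by (simp add: b_def algebra_simps)
      hence "(b + ln u)\<^sup>2 \<le> (6 * L * (1 + ln u))\<^sup>2" using b l by (intro power_mono) auto
      hence "(b + ln u)\<^sup>2 \<le> 36 * L\<^sup>2 * (1 + ln u)\<^sup>2" by (simp add: power_mult_distrib)
      hence "1 / (1 + ln u)\<^sup>2 \<le> 36 * L\<^sup>2 / (b + ln u)\<^sup>2"
        using b l by (simp add: field_simps add_pos_nonneg)
      hence "C1 * u * (1 / (1 + ln u)\<^sup>2) \<le> C1 * u * (36 * L\<^sup>2 / (b + ln u)\<^sup>2)"
        using C1 u by (intro mult_left_mono) auto
      thus ?thesis using C1(2)[OF u] by (simp add: mult_ac)
    qed
    have r: "real q powr (-1 + 2 / b) < 1" if q: "q \<in> primes_le z" for q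
    proof -
      have "real q powr (-1 + 1 / (2 * L)) \<le> 7/8"
        using primes_leD(2)[OF q] primes_le_ge_2[OF q] by (intro prime_factor_shift_bound(1)) (auto simp: L_def)
      thus ?thesis by (simp add: b)
    qed
    have pos: "b + ln y > 0" "1 + ln y > 0" using b y by (simp_all add: add_pos_nonneg)
    have "\<bar>moebius_frac_sum (primes_le z) y\<bar> \<le> (36 * C1 * L\<^sup>2) * (\<Prod>q\<in>primes_le z. 1 / (1 - real q powr (-1 + 2 / b))) * (y / (b + ln y)\<^sup>2)"
      by (rule moebius_frac_sum_prod_bound) (use b C1 y base r in \<open>auto simp: primes_leD\<close>)
    also have "\<dots> \<le> (36 * C1 * L\<^sup>2) * (C2 * L) * (y / (1 + ln y)\<^sup>2)"
    proof (intro mult_mono divide_left_mono power_mono)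
      show "(\<Prod>q\<in>primes_le z. 1 / (1 - real q powr (-1 + 2 / b))) \<le> C2 * L"
        using C2(2)[OF z] by (simp add: b L_def)
    qed (use C1 C2 L y pos r in \<open>auto simp: b_def less_imp_le intro!: mult_pos_pos prod_nonneg\<close>)
    also have "\<dots> = (36 * C1 * C2) * L ^ 3 * y / (1 + ln y)\<^sup>2"
      by (simp add: power2_eq_square power3_eq_cube)
    finally show ?thesis by (simp add: L_def)
  qed
  thus ?thesis using C1(1) C2(1) by (intro that[of "36 * C1 * C2"]) auto
qed

section \<open>An upper bound sieve for squarefree integers without small prime factors\<close>

definition rough_sqfree_upto :: "real \<Rightarrow> real \<Rightarrow> nat set" where
  "rough_sqfree_upto z y = {m \<in> rough_upto (primes_le z) y. squarefree m}"

lemma finite_rough_sqfree_upto [simp]: "finite (rough_sqfree_upto z y)"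
  by (simp add: rough_sqfree_upto_def)

lemma rough_sqfree_uptoD:
  assumes "m \<in> rough_sqfree_upto z y"
  shows "m > 0" "real m \<le> y" "squarefree m" "\<And>q. prime q \<Longrightarrow> q dvd m \<Longrightarrow> z < real q"
  using assms by (auto simp: rough_sqfree_upto_def rough_upto_def coprime_set_def primes_le_def not_le)

lemma rough_sqfree_uptoI:
  assumes "m > 0" "real m \<le> y" "squarefree m" "\<And>q. prime q \<Longrightarrow> q dvd m \<Longrightarrow> z < real q"
  shows "m \<in> rough_sqfree_upto z y"
proof -
  have "\<not> q dvd m" if "q \<in> primes_le z" for q
    using assms(4)[of q] that by (auto simp: primes_le_def)
  thus ?thesis using assms(1-3) by (simp add: rough_sqfree_upto_def rough_upto_def coprime_set_def)
qed

lemma ln_squarefree: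
  assumes "squarefree (m :: nat)"
  shows "ln (real m) = (\<Sum>q\<in>prime_factors m. ln (real q))"
proof -
  have m: "m \<noteq> 0" using assms by (auto intro: Nat.gr0I)
  have "(\<Prod>q\<in>prime_factors m. q ^ multiplicity q m) = m"
    using prod_prime_factors[OF m] by simp
  moreover have "\<forall>q\<in>prime_factors m. multiplicity q m = 1"
    using assms squarefree_factorial_semiring'[OF m] by simp
  ultimately have "(\<Prod>q\<in>prime_factors m. q) = m" by simp
  hence "real (\<Prod>q\<in>prime_factors m. q) = real m" by (rule arg_cong)
  hence "real m = (\<Prod>q\<in>prime_factors m. real q)" by simp
  also have "ln \<dots> = (\<Sum>q\<in>prime_factors m. ln (real q))"
    by (rule ln_prod) (auto simp: prime_factors_gt_0_nat)
  finally show ?thesis .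
qed

lemma squarefree_div_prime:
  assumes "squarefree m" "m > 0" "prime q" "q dvd (m::nat)"
  shows "squarefree (m div q)" "\<not> q dvd m div q" "q * (m div q) = m"
proof -
  show eq: "q * (m div q) = m" using assms by simp
  show "squarefree (m div q)" using assms(1) eq by (metis squarefree_multD(2))
  show "\<not> q dvd m div q"
  proof
    assume "q dvd m div q"
    hence "q * q dvd q * (m div q)" by simp
    hence "q\<^sup>2 dvd m" using eq by (simp add: power2_eq_square)
    thus False using assms by (auto simp: squarefree_def)
  qed
qed

text \<open>For squarefree \<open>m\<close>, \<open>ln m\<close> is the plain sum of
  \<open>ln q\<close> over its primes. Regrouped by the cofactor \<open>m div q\<close>, which is
  again in the set, the primes \<open>q \<le> y / (m div q)\<close> are summed by Chebyshev's
  bound.\<close>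

lemma sum_ln_rough_sqfree_le:
  "(\<Sum>m\<in>rough_sqfree_upto z y. ln (real m)) \<le> (\<Sum>m\<in>rough_sqfree_upto z y. 4 * y / real m)"
proof -
  let ?Q = "rough_sqfree_upto z y"
  let ?A = "Sigma ?Q prime_factors" and ?B = "Sigma ?Q (\<lambda>m. primes_le (y / real m))"
  let ?f = "\<lambda>(m, q). (m div q, q)"
  have div: "(m div q, q) \<in> ?B \<and> q * (m div q) = m" if "m \<in> ?Q" "q \<in> prime_factors m" for m q
  proof -
    have m: "m > 0" "real m \<le> y" "squarefree m" using rough_sqfree_uptoD[OF that(1)] by auto
    have q: "prime q" "q dvd m" using that(2) by auto
    note sq = squarefree_div_prime[OF m(3,1) q]
    have pos: "m div q > 0" using sq(3) m(1) by (metis mult_0_right neq0_conv)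
    have "real m = real q * real (m div q)" using sq(3) by (metis of_nat_mult)
    hence "real q \<le> y / real (m div q)" using m pos by (simp add: le_divide_eq)
    moreover have "m div q \<in> ?Q"
    proof (rule rough_sqfree_uptoI)
      have "m div q \<le> m" by simp
      thus "real (m div q) \<le> y" using m(2) by (meson of_nat_le_iff order_trans)
      show "z < real p" if "prime p" "p dvd m div q" for p
        using rough_sqfree_uptoD(4)[OF \<open>m \<in> ?Q\<close> that(1)] that(2) sq(3) by (metis dvd_mult)
    qed (use pos sq in auto)
    ultimately show ?thesis using q sq(3) by (auto simp: primes_le_def)
  qed
  have inj: "inj_on ?f ?A"
    using div by (auto simp: inj_on_def) metis
  have "(\<Sum>m\<in>?Q. ln (real m)) = (\<Sum>m\<in>?Q. \<Sum>q\<in>prime_factors m. ln (real q))"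
    by (intro sum.cong ln_squarefree) (auto dest: rough_sqfree_uptoD)
  also have "\<dots> = (\<Sum>(m, q)\<in>?A. ln (real q))"
    by (intro sum.Sigma) auto
  also have "\<dots> = (\<Sum>(m, q)\<in>?f ` ?A. ln (real q))"
    by (subst sum.reindex[OF inj]) (auto intro!: sum.cong)
  also have "\<dots> \<le> (\<Sum>(m, q)\<in>?B. ln (real q))"
    using div by (intro sum_mono2) (auto intro: ln_primes_le_nonneg)
  also have "\<dots> = (\<Sum>m\<in>?Q. \<Sum>q\<in>primes_le (y / real m). ln (real q))"
    by (intro sum.Sigma[symmetric]) auto
  also have "\<dots> \<le> (\<Sum>m\<in>?Q. 4 * (y / real m))"
  proof (rule sum_mono, rule sum_ln_primes_le)
    fix m assume "m \<in> ?Q"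
    thus "y / real m \<ge> 0" using rough_sqfree_uptoD(1,2)[of m z y] by (intro divide_nonneg_nonneg) auto
  qed
  finally show ?thesis by simp
qed

lemma ln_le_sum_inverse: "ln (real (Suc n)) \<le> (\<Sum>k=1..n. 1 / real k)"
proof (induction n)
  case (Suc n)
  have "ln (real (Suc (Suc n)) / real (Suc n)) \<le> real (Suc (Suc n)) / real (Suc n) - 1"
    by (intro ln_le_minus_one) simp
  also have "\<dots> = 1 / real (Suc n)" by (simp add: field_simps)
  finally have "ln (real (Suc (Suc n))) - ln (real (Suc n)) \<le> 1 / real (Suc n)"
    by (subst (asm) ln_div) auto
  thus ?case using Suc by simp
qed auto

lemma sum_inverse_le_ln':
  assumes "n \<ge> 1"
  shows "(\<Sum>k=1..n. 1 / real k) \<le> 1 + ln (real n)"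
proof -
  obtain m where m: "n = Suc m" using assms by (cases n) auto
  have "(\<Sum>k=1..n. 1 / real k) = (\<Sum>j\<le>m. 1 / real (Suc j))"
    unfolding m by (rule sum.reindex_bij_witness[of _ Suc "\<lambda>k. k - 1"]) auto
  thus ?thesis using sum_inverse_le_ln[of m] m by simp
qed

text \<open>Every integer up to \<open>z y\<close> arises at most once as a product of a \<open>z\<close>-rough and a number up to \<open>z\<close>.\<close>
lemma sum_inverse_rough_sqfree_le:
  assumes "2 \<le> z" "z \<le> y"
  shows "(\<Sum>m\<in>rough_sqfree_upto z y. 1 / real m) \<le> 4 * ln y / ln z"
proof -
  let ?Q = "rough_sqfree_upto z y"
  define N where "N = nat \<lfloor>z\<rfloor>"
  define K where "K = nat \<lfloor>y * z\<rfloor>"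
  have N: "real N \<le> z" "z < real (Suc N)" using assms unfolding N_def by linarith+
  have yz: "y * z \<ge> 1" using assms mult_mono[of 1 y 1 z] by simp
  have K: "real K \<le> y * z" "K \<ge> 1" using yz unfolding K_def by linarith+
  let ?f = "\<lambda>(m, n). m * n :: nat"
  have cop: "coprime m n" if "m \<in> ?Q" "n \<in> {1..N}" for m n
  proof (rule ccontr)
    assume "\<not> coprime m n"
    hence "gcd m n \<noteq> 1" using coprime_iff_gcd_eq_1 by blast
    then obtain p where p: "prime p" "p dvd m" "p dvd n"
      using prime_factor_nat[of "gcd m n"] by auto
    have "real p \<le> real n" using p that by (auto intro: dvd_imp_le)
    moreover have "z < real p" using rough_sqfree_uptoD(4)[OF that(1) p(1,2)] .
    moreover have "real n \<le> z" using that N by auto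
    ultimately show False by linarith
  qed
  have inj: "inj_on ?f (?Q \<times> {1..N})"
  proof (rule inj_onI, clarify)
    fix m n m' n' assume A: "m \<in> ?Q" "n \<in> {1..N}" "m' \<in> ?Q" "n' \<in> {1..N}" "m * n = m' * n'"
    have "m dvd m'" using cop[OF A(1,4)] A(5) coprime_dvd_mult_left_iff[of m n' m'] by (metis dvd_triv_left)
    moreover have "m' dvd m" using cop[OF A(3,2)] A(5) coprime_dvd_mult_left_iff[of m' n m] by (metis dvd_triv_left)
    ultimately have "m = m'" by (rule dvd_antisym)
    thus "m = m' \<and> n = n'" using A rough_sqfree_uptoD(1)[OF A(1)] by simp
  qed
  have sub: "?f ` (?Q \<times> {1..N}) \<subseteq> {1..K}"
  proof clarify
    fix m n assume A: "m \<in> ?Q" "n \<in> {1..N}"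
    have "real m * real n \<le> y * z"
      using rough_sqfree_uptoD(1,2)[OF A(1)] A(2) N assms by (intro mult_mono) auto
    hence "m * n \<le> K" unfolding K_def by (simp add: le_nat_floor)
    thus "m * n \<in> {1..K}" using rough_sqfree_uptoD(1)[OF A(1)] A(2) by simp
  qed
  have lz: "ln z > 0" using assms by simp
  have "(\<Sum>m\<in>?Q. 1 / real m) * ln z \<le> (\<Sum>m\<in>?Q. 1 / real m) * (\<Sum>n=1..N. 1 / real n)"
  proof (rule mult_left_mono)
    have "ln z \<le> ln (real (Suc N))" using N assms by simp
    also have "\<dots> \<le> (\<Sum>n=1..N. 1 / real n)" by (rule ln_le_sum_inverse)
    finally show "ln z \<le> (\<Sum>n=1..N. 1 / real n)" .
  qed (auto intro: sum_nonneg)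
  also have "\<dots> = (\<Sum>(m, n)\<in>?Q \<times> {1..N}. 1 / real (m * n))"
    by (simp add: sum_product sum.cartesian_product)
  also have "\<dots> = (\<Sum>k\<in>?f ` (?Q \<times> {1..N}). 1 / real k)"
    by (subst sum.reindex[OF inj]) (auto intro!: sum.cong)
  also have "\<dots> \<le> (\<Sum>k=1..K. 1 / real k)"
    using sub by (intro sum_mono2) auto
  also have "\<dots> \<le> 1 + ln (real K)" using K by (intro sum_inverse_le_ln') auto
  also have "ln (real K) \<le> ln (y * z)" using K by simp
  also have "ln (y * z) \<le> 2 * ln y" using assms by (simp add: ln_mult)
  finally have "(\<Sum>m\<in>?Q. 1 / real m) * ln z \<le> 4 * ln y"
    using ln_ge_half[of y] assms by simp
  thus ?thesis using lz by (simp add: field_simps)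
qed

text \<open>Each \<open>m\<close> is weighted with \<open>ln y = ln m + ln (y / m)\<close>. Both
  parts are bounded by multiples of the sum of \<open>y / m\<close>, whose factor
  \<open>ln y\<close> then cancels; \<open>20 = (4 + 1) * 4\<close>.\<close>

lemma card_rough_sqfree_le:
  assumes "2 \<le> z" "z \<le> y"
  shows "real (card (rough_sqfree_upto z y)) \<le> 20 * y / ln z"
proof -
  let ?Q = "rough_sqfree_upto z y"
  have ly: "ln y > 0" using assms by simp
  have "real (card ?Q) * ln y = (\<Sum>m\<in>?Q. ln (real m) + ln (y / real m))"
  proof -
    have "ln (real m) + ln (y / real m) = ln y" if "m \<in> ?Q" for m
      using rough_sqfree_uptoD(1)[OF that] assms by (simp add: ln_div)
    thus ?thesis by simp
  qed
  also have "\<dots> = (\<Sum>m\<in>?Q. ln (real m)) + (\<Sum>m\<in>?Q. ln (y / real m))"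
    by (rule sum.distrib)
  also have "\<dots> \<le> (\<Sum>m\<in>?Q. 4 * y / real m) + (\<Sum>m\<in>?Q. y / real m)"
  proof (intro add_mono sum_ln_rough_sqfree_le sum_mono)
    fix m assume m: "m \<in> ?Q"
    have "ln (y / real m) \<le> y / real m - 1"
      using rough_sqfree_uptoD(1)[OF m] assms by (intro ln_le_minus_one) auto
    thus "ln (y / real m) \<le> y / real m" by simp
  qed
  also have "\<dots> = 5 * y * (\<Sum>m\<in>?Q. 1 / real m)"
    by (simp add: sum_distrib_left flip: sum.distrib)
  also have "\<dots> \<le> 5 * y * (4 * ln y / ln z)"
    using assms by (intro mult_left_mono sum_inverse_rough_sqfree_le) auto
  also have "\<dots> = (20 * y / ln z) * ln y" by simp
  finally show ?thesis using ly by (simp only: mult_le_cancel_right_pos)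
qed

lemma rough_sqfree_upto_small:
  assumes "y < z"
  shows "rough_sqfree_upto z y \<subseteq> {1}"
proof
  fix m assume m: "m \<in> rough_sqfree_upto z y"
  show "m \<in> {1}"
  proof (rule ccontr)
    assume "m \<notin> {1}"
    then obtain p where p: "prime p" "p dvd m" using prime_factor_nat[of m] by auto
    have "real p \<le> real m" using p rough_sqfree_uptoD(1)[OF m] by (auto intro: dvd_imp_le)
    thus False using rough_sqfree_uptoD(2)[OF m] rough_sqfree_uptoD(4)[OF m p] assms by linarith
  qed
qed

lemma card_rough_sqfree_small: "y < z \<Longrightarrow> card (rough_sqfree_upto z y) \<le> 1"
  using card_mono[OF _ rough_sqfree_upto_small[of y z]] by simp

lemma moebius_frac_sum_le_card:
  "\<bar>moebius_frac_sum (primes_le z) y\<bar> \<le> real (card (rough_sqfree_upto z y))"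
proof -
  have "moebius_frac_sum (primes_le z) y = (\<Sum>m\<in>rough_sqfree_upto z y. real_of_int (moebius_mu m) * frac (y / real m))"
    unfolding moebius_frac_sum_def
    by (rule sum.mono_neutral_right) (auto simp: rough_sqfree_upto_def moebius_mu_def)
  also have "\<bar>\<dots>\<bar> \<le> (\<Sum>m\<in>rough_sqfree_upto z y. \<bar>real_of_int (moebius_mu m) * frac (y / real m)\<bar>)"
    by (rule sum_abs)
  also have "\<dots> \<le> (\<Sum>m\<in>rough_sqfree_upto z y. 1)"
  proof (rule sum_mono)
    fix m
    have "\<bar>real_of_int (moebius_mu m)\<bar> * frac (y / real m) \<le> 1 * 1"
      using abs_moebius_mu_le_1[of m] frac_lt_1[of "y / real m"] by (intro mult_mono) auto
    thus "\<bar>real_of_int (moebius_mu m) * frac (y / real m)\<bar> \<le> 1"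
      by (simp add: abs_mult)
  qed
  finally show ?thesis by simp
qed

text \<open>Relative to \<open>y\<close>, the analytic bound \<open>(ln z)^3 / (ln y)\<^sup>2\<close> and the sieve bound \<open>1 / ln z\<close> cross at
  \<open>ln y = (ln z)\<^sup>2\<close>; each is at most \<open>ln z / ln y\<close> on its side.\<close>

lemma moebius_frac_sum_uniform:
  obtains C where "C > 0" "\<And>z y. z \<ge> 2 \<Longrightarrow> y \<ge> 1 \<Longrightarrow> \<bar>moebius_frac_sum (primes_le z) y\<bar> \<le> C * ln z * (y / (1 + ln y))"
proof -
  obtain C where C: "C > 0" "\<And>z y. z \<ge> 2 \<Longrightarrow> y \<ge> 1 \<Longrightarrow> \<bar>moebius_frac_sum (primes_le z) y\<bar> \<le> C * (ln z) ^ 3 * y / (1 + ln y)\<^sup>2"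
    using moebius_frac_sum_primes_le_bound by blast
  have "\<bar>moebius_frac_sum (primes_le z) y\<bar> \<le> (20 + C) * ln z * (y / (1 + ln y))"
    if z: "z \<ge> 2" and y: "y \<ge> 1" for z y
  proof -
    define L where "L = ln z"
    define w where "w = 1 + ln y"
    have L: "L \<ge> 1/2" using ln_ge_half[OF z] by (simp add: L_def)
    have w: "w \<ge> 1" using y by (simp add: w_def)
    have "\<bar>moebius_frac_sum (primes_le z) y\<bar> \<le> (20 + C) * L * (y / w)"
    proof (cases "y < z")
      case True
      have "w \<le> y" using ln_le_minus_one[of y] y by (simp add: w_def)
      hence "1 \<le> y / w" using w by (simp add: field_simps)
      hence "1 * 1 \<le> ((20 + C) * L) * (y / w)"
        using L C(1) mult_mono[of 2 "20 + C" "1/2" L] by (intro mult_mono) auto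
      moreover have "real (card (rough_sqfree_upto z y)) \<le> 1"
        using card_rough_sqfree_small[OF True] by simp
      ultimately show ?thesis using moebius_frac_sum_le_card[of z y] by simp
    next
      case False
      have yw: "y / w \<ge> 0" using y w by simp
      show ?thesis
      proof (cases "w \<le> L\<^sup>2")
        case True
        have "\<bar>moebius_frac_sum (primes_le z) y\<bar> \<le> 20 * y / L"
          using moebius_frac_sum_le_card[of z y] card_rough_sqfree_le[OF z, of y] False by (simp add: L_def)
        also have "\<dots> \<le> 20 * L * (y / w)"
        proof -
          have "y * w \<le> y * L\<^sup>2" using True y by (intro mult_left_mono) auto
          thus ?thesis using L w by (simp add: field_simps power2_eq_square)
        qed
        also have "\<dots> \<le> (20 + C) * L * (y / w)" using C(1) L yw by (intro mult_right_mono) auto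
        finally show ?thesis .
      next
        case False
        have "\<bar>moebius_frac_sum (primes_le z) y\<bar> \<le> C * L ^ 3 * y / w\<^sup>2"
          using C(2)[OF z y] by (simp add: L_def w_def)
        also have "\<dots> = C * L * (y / w) * (L\<^sup>2 / w)"
          by (simp add: power2_eq_square power3_eq_cube)
        also have "\<dots> \<le> C * L * (y / w) * 1"
          using False C(1) L yw w by (intro mult_left_mono mult_nonneg_nonneg) auto
        also have "\<dots> \<le> (20 + C) * L * (y / w)"
          unfolding mult_1_right using C(1) L yw by (intro mult_right_mono) auto
        finally show ?thesis .
      qed
    qed
    thus ?thesis by (simp add: L_def w_def)
  qed
  thus ?thesis using C(1) by (intro that[of "20 + C"]) auto
qed

section \<open>Sums weighted with the number of prime factors\<close>

definition moebius_omega_frac_sum :: "nat set \<Rightarrow> real \<Rightarrow> real" where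
  "moebius_omega_frac_sum P y =
     (\<Sum>m\<in>rough_upto P y. real_of_int (moebius_mu m) * real (distinct_primes m) * frac (y / real m))"

lemma prime_factors_rough:
  assumes "m \<in> rough_upto (primes_le z) y"
  shows "prime_factors m = {q \<in> primes_le y - primes_le z. q dvd m}"
proof -
  have m: "m > 0" "real m \<le> y" "\<forall>q\<in>primes_le z. \<not> q dvd m"
    using assms by (auto simp: rough_upto_def coprime_set_def)
  have "real q \<le> y" if "q dvd m" for q
    using dvd_imp_le[OF that m(1)] m(2) by linarith
  thus ?thesis using m by (auto simp: primes_le_def prime_factors_dvd)
qed

lemma moebius_omega_frac_sum_eq:
  "moebius_omega_frac_sum (primes_le z) y
     = - (\<Sum>q\<in>primes_le y - primes_le z. moebius_frac_sum (insert q (primes_le z)) (y / real q))"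
proof -
  let ?R = "rough_upto (primes_le z) y" and ?D = "primes_le y - primes_le z"
  let ?f = "\<lambda>m. real_of_int (moebius_mu m) * frac (y / real m)"
  have "moebius_omega_frac_sum (primes_le z) y = (\<Sum>m\<in>?R. \<Sum>q | q \<in> ?D \<and> q dvd m. ?f m)"
    unfolding moebius_omega_frac_sum_def
  proof (rule sum.cong)
    fix m assume m: "m \<in> ?R"
    show "real_of_int (moebius_mu m) * real (distinct_primes m) * frac (y / real m) = (\<Sum>q | q \<in> ?D \<and> q dvd m. ?f m)"
      unfolding distinct_primes_def prime_factors_rough[OF m] by simp
  qed simp
  also have "\<dots> = (\<Sum>q\<in>?D. \<Sum>m | m \<in> ?R \<and> q dvd m. ?f m)"
    by (rule sum.swap_restrict) auto
  also have "\<dots> = (\<Sum>q\<in>?D. - moebius_frac_sum (insert q (primes_le z)) (y / real q))"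
  proof (rule sum.cong)
    fix q assume q: "q \<in> ?D"
    show "(\<Sum>m | m \<in> ?R \<and> q dvd m. ?f m) = - moebius_frac_sum (insert q (primes_le z)) (y / real q)"
      using q by (subst sum_moebius_rough_multiples) (auto simp: moebius_frac_sum_def dest: primes_leD)
  qed simp
  finally show ?thesis by (simp add: sum_negf)
qed

text \<open>The extreme case is \<open>q = 2\<close> with a quotient of about 0.847;
  \<open>6/7\<close> lies just above and produces the factor \<open>1 / (1 - 6/7) = 7\<close>
  later.\<close>

lemma one_plus_ln_div_le:
  assumes "q \<ge> (2::nat)"
  shows "(1 + ln (real q)) / real q \<le> 6/7"
proof -
  have "ln (real q) = ln 2 + ln (real q / 2)" using assms by (simp add: ln_div)
  also have "ln (real q / 2) \<le> real q / 2 - 1" using assms by (intro ln_le_minus_one) auto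
  finally have "1 + ln (real q) \<le> 25/36 + real q / 2" using ln2_le_25_over_36 by simp
  also have "\<dots> \<le> 6/7 * real q" using assms by simp
  finally show ?thesis using assms by (simp add: divide_le_eq)
qed

text \<open>Follows from \<open>1 + ln u \<le> (1 + ln (u / q)) * (1 + ln q)\<close>. A rate uniform
  in \<open>q\<close> is good enough because the weighted sum adds just one prime to the
  set.\<close>

lemma linear_log_shift:
  assumes "q \<ge> (2::nat)" "u \<ge> real q"
  shows "(u / real q) / (1 + ln (u / real q)) \<le> 6/7 * (u / (1 + ln u))"
proof -
  define w where "w = ln (u / real q)"
  have w: "w \<ge> 0" using assms by (simp add: w_def)
  have lq: "ln (real q) \<ge> 0" using assms by simp
  have lu: "ln u = w + ln (real q)" using assms by (simp add: w_def ln_div)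
  have u: "u > 0" using assms by linarith
  have "1 + ln u \<le> (1 + w) * (1 + ln (real q))"
    using mult_nonneg_nonneg[OF w lq] by (simp add: lu algebra_simps)
  hence "1 / (1 + w) \<le> (1 + ln (real q)) / (1 + ln u)"
    using w lq lu by (simp add: field_simps)
  hence "(u / real q) * (1 / (1 + w)) \<le> (u / real q) * ((1 + ln (real q)) / (1 + ln u))"
    using u by (intro mult_left_mono) auto
  also have "\<dots> = (1 + ln (real q)) / real q * (u / (1 + ln u))" by simp
  also have "\<dots> \<le> 6/7 * (u / (1 + ln u))"
    using one_plus_ln_div_le[OF assms(1)] u w lq lu by (intro mult_right_mono) auto
  finally show ?thesis by (simp add: w_def)
qed

lemma moebius_omega_frac_sum_bound:
  assumes C: "C > 0" "\<And>z y. z \<ge> 2 \<Longrightarrow> y \<ge> 1 \<Longrightarrow> \<bar>moebius_frac_sum (primes_le z) y\<bar> \<le> C * ln z * (y / (1 + ln y))"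
    and z: "z \<ge> 2" and y: "y \<ge> 1"
  shows "\<bar>moebius_omega_frac_sum (primes_le z) y\<bar> \<le> 7 * C * ln z * y * (\<Sum>q\<in>primes_le y. 1 / real q * (1 / (1 + ln (y / real q))))"
proof -
  let ?D = "primes_le y - primes_le z"
  have lz: "ln z \<ge> 0" using z by simp
  have ins: "\<bar>moebius_frac_sum (insert q (primes_le z)) (y / real q)\<bar> \<le> 7 * C * ln z * y * (1 / real q * (1 / (1 + ln (y / real q))))"
    if q: "q \<in> ?D" for q
  proof -
    have q2: "q \<ge> 2" "prime q" "q \<notin> primes_le z" "real q \<le> y" using q primes_le_ge_2 primes_leD by blast+
    have "\<bar>moebius_frac_sum (insert q (primes_le z)) (y / real q)\<bar> \<le> (C * ln z) / (1 - 6/7) * ((y / real q) / (1 + ln (y / real q)))"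
    proof (rule moebius_frac_sum_insert_bound[where H = "\<lambda>y. y / (1 + ln y)"])
      show "u / real q / (1 + ln (u / real q)) \<le> 6/7 * (u / (1 + ln u))" if "u \<ge> real q" for u
        using linear_log_shift[OF q2(1) that] .
      show "0 \<le> u / (1 + ln u)" if "1 \<le> u" for u :: real using that by (intro divide_nonneg_nonneg add_nonneg_nonneg) auto
    qed (use q2 C z lz in \<open>auto dest: primes_leD\<close>)
    thus ?thesis by (simp add: mult_ac)
  qed
  have "\<bar>moebius_omega_frac_sum (primes_le z) y\<bar> \<le> (\<Sum>q\<in>?D. \<bar>moebius_frac_sum (insert q (primes_le z)) (y / real q)\<bar>)"
    unfolding moebius_omega_frac_sum_eq abs_minus_cancel by (rule sum_abs)
  also have "\<dots> \<le> (\<Sum>q\<in>?D. 7 * C * ln z * y * (1 / real q * (1 / (1 + ln (y / real q)))))"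
    by (intro sum_mono ins)
  also have "\<dots> \<le> (\<Sum>q\<in>primes_le y. 7 * C * ln z * y * (1 / real q * (1 / (1 + ln (y / real q)))))"
  proof (rule sum_mono2)
    fix q assume "q \<in> primes_le y - ?D"
    hence "q \<ge> 2" "real q \<le> y" using primes_le_ge_2[of q y] primes_leD(2)[of q y] by auto
    hence "ln (y / real q) \<ge> 0" by simp
    thus "0 \<le> 7 * C * ln z * y * (1 / real q * (1 / (1 + ln (y / real q))))"
      using C(1) lz y by (intro mult_nonneg_nonneg) auto
  qed auto
  also have "\<dots> = 7 * C * ln z * y * (\<Sum>q\<in>primes_le y. 1 / real q * (1 / (1 + ln (y / real q))))"
    by (rule sum_distrib_left[symmetric])
  finally show ?thesis .
qed

text \<open>Of order \<open>ln ln y\<close>: a bound for the sum of \<open>1/q\<close>, plus three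
  times the bound of \<open>sum_ln_over_primes_weighted\<close>, so
  \<open>48 = 3 * 16\<close>.\<close>

definition log_log_majorant :: "real \<Rightarrow> real \<Rightarrow> real" where
  "log_log_majorant C y = ln (C * ln y) + 48 * (1 + ln (1 + 2 * ln y))"

text \<open>The split uses \<open>1 / (1 + a) = (1 + (1 + b) / (1 + a)) / (2 + a + b)\<close> with
  \<open>a = ln (y / q)\<close> and \<open>b = ln q\<close>.\<close>
lemma sum_inverse_primes_weighted:
  assumes C: "C > 0" "\<And>z. z \<ge> 2 \<Longrightarrow> (\<Sum>q\<in>primes_le z. 1 / real q) \<le> ln (C * ln z)"
    and y: "y \<ge> 2"
  shows "(\<Sum>q\<in>primes_le y. 1 / real q * (1 / (1 + ln (y / real q)))) \<le> log_log_majorant C y / (2 + ln y)"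
proof -
  have ly: "ln y \<ge> 0" using y by simp
  have "(\<Sum>q\<in>primes_le y. 1 / real q * (1 / (1 + ln (y / real q)))) * (2 + ln y)
      = (\<Sum>q\<in>primes_le y. 1 / real q * (1 / (1 + ln (y / real q))) * (2 + ln y))"
    by (rule sum_distrib_right)
  also have "\<dots> \<le> (\<Sum>q\<in>primes_le y. 1 / real q + 3 * (ln (real q) / real q * (1 / (1 + ln (y / real q)))))"
  proof (rule sum_mono)
    fix q assume q: "q \<in> primes_le y"
    have q2: "q \<ge> 2" "real q \<le> y" using primes_le_ge_2[OF q] primes_leD(2)[OF q] by auto
    define a where "a = ln (y / real q)"
    have a: "a \<ge> 0" using q2 by (simp add: a_def)
    have b: "ln (real q) \<ge> 1/2" using ln_ge_half[of "real q"] q2 by simp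
    have eq: "2 + ln y = (1 + a) + (1 + ln (real q))" using q2 y by (simp add: a_def ln_div)
    have "1 + a \<noteq> 0" using a by simp
    hence e: "1 / (1 + a) * (2 + ln y) = 1 + (1 + ln (real q)) * (1 / (1 + a))"
      unfolding eq by (simp add: field_simps)
    have "1 / real q * (1 / (1 + a)) * (2 + ln y) = 1 / real q * (1 / (1 + a) * (2 + ln y))"
      by (simp only: mult.assoc)
    also have "\<dots> = 1 / real q + (1 + ln (real q)) / real q * (1 / (1 + a))"
      unfolding e by (simp only: distrib_left mult_1_right) simp
    also have "(1 + ln (real q)) / real q * (1 / (1 + a)) \<le> 3 * ln (real q) / real q * (1 / (1 + a))"
      using a b by (intro mult_right_mono divide_right_mono) auto
    finally show "1 / real q * (1 / (1 + ln (y / real q))) * (2 + ln y) \<le> 1 / real q + 3 * (ln (real q) / real q * (1 / (1 + ln (y / real q))))"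
      by (simp add: a_def)
  qed
  also have "\<dots> = (\<Sum>q\<in>primes_le y. 1 / real q) + 3 * (\<Sum>q\<in>primes_le y. ln (real q) / real q * (1 / (1 + ln (y / real q))))"
    by (simp only: sum.distrib sum_distrib_left)
  also have "\<dots> \<le> ln (C * ln y) + 3 * (16 * (1 + ln (1 + 2 * ln y)))"
    using y by (intro add_mono C mult_left_mono sum_ln_over_primes_weighted) auto
  also have "\<dots> = log_log_majorant C y" by (simp add: log_log_majorant_def)
  finally show ?thesis using ly by (simp add: le_divide_eq)
qed

text \<open>\<open>z\<^sup>2 \<le> x\<close> gives \<open>x / p \<ge> z \<ge> p\<close>, hence
  \<open>ln (x / p) \<ge> ln x / 2\<close>, and each \<open>p\<close> contributes order
  \<open>x * ln p / (p * ln x)\<close> times the majorant. Summation over \<open>p\<close> costs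
  \<open>32 * ln z\<close>, and \<open>448 = 14 * 32\<close>.\<close>

lemma sum_frac_sums_small_primes:
  assumes C: "C > 0" "\<And>z y. z \<ge> 2 \<Longrightarrow> y \<ge> 1 \<Longrightarrow> \<bar>moebius_frac_sum (primes_le z) y\<bar> \<le> C * ln z * (y / (1 + ln y))"
    and D: "D > 0" "\<And>z. z \<ge> 2 \<Longrightarrow> (\<Sum>q\<in>primes_le z. 1 / real q) \<le> ln (D * ln z)"
    and z: "z \<ge> 2" "z\<^sup>2 \<le> x"
  shows "(\<Sum>p\<in>primes_le z. \<bar>moebius_frac_sum (primes_le (real p)) (x / real p)\<bar> + \<bar>moebius_omega_frac_sum (primes_le (real p)) (x / real p)\<bar>)
      \<le> 448 * C * (1 + log_log_majorant D x) * x * ln z / ln x"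
proof -
  let ?E = "log_log_majorant D x"
  have "z * 2 \<le> z * z" using z by (intro mult_left_mono) auto
  hence zx: "2 * z \<le> x" using z(2) by (simp add: power2_eq_square)
  have lx: "ln x \<ge> 1/2" using ln_ge_half[of x] zx z by simp
  have E0: "?E \<ge> 0"
  proof -
    have "0 \<le> (\<Sum>q\<in>primes_le x. 1 / real q)" by (intro sum_nonneg) auto
    also have "\<dots> \<le> ln (D * ln x)" using zx z by (intro D) auto
    finally show ?thesis using lx unfolding log_log_majorant_def by (intro add_nonneg_nonneg) auto
  qed
  have "\<bar>moebius_frac_sum (primes_le (real p)) (x / real p)\<bar> + \<bar>moebius_omega_frac_sum (primes_le (real p)) (x / real p)\<bar>
      \<le> 14 * C * (1 + ?E) * x / ln x * (ln (real p) / real p)" if p: "p \<in> primes_le z" for p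
  proof -
    have p2: "real p \<ge> 2" "real p \<le> z" using primes_le_ge_2[OF p] primes_leD(2)[OF p] by auto
    define y where "y = x / real p"
    have yz: "y \<ge> z"
    proof -
      have "z * real p \<le> z * z" using p2 z by (intro mult_left_mono) auto
      also have "\<dots> \<le> x" using z(2) by (simp add: power2_eq_square)
      finally show ?thesis using p2 by (simp add: y_def le_divide_eq)
    qed
    have yx: "y \<le> x" using p2 zx z by (simp add: y_def divide_le_eq mult_le_cancel_left1)
    have y2: "y \<ge> 2" "ln y > 0" using yz z by auto
    have "x \<le> y * y"
    proof -
      have "x = y * real p" using p2 by (simp add: y_def)
      also have "\<dots> \<le> y * y" using p2 yz y2 by (intro mult_left_mono) auto
      finally show ?thesis .
    qed
    hence "ln x \<le> ln (y * y)" using zx z by (intro ln_mono) auto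
    hence lyx: "ln x \<le> 2 * ln y" using y2 by (simp add: ln_mult)
    have inv: "1 / (1 + ln y) \<le> 2 / ln x" "1 / (2 + ln y) \<le> 2 / ln x"
      using lyx lx y2 by (auto simp: field_simps)
    have Ey: "log_log_majorant D y \<le> ?E"
    proof -
      have l: "ln y \<le> ln x" using yx y2 by (intro ln_mono) auto
      hence "ln (D * ln y) \<le> ln (D * ln x)" using D(1) y2 by (intro ln_mono) auto
      moreover have "ln (1 + 2 * ln y) \<le> ln (1 + 2 * ln x)" using l y2(2) by (intro ln_mono) linarith+
      ultimately show ?thesis by (simp add: log_log_majorant_def)
    qed
    have lp: "ln (real p) > 0" using p2 by simp
    have U: "\<bar>moebius_frac_sum (primes_le (real p)) y\<bar> \<le> C * ln (real p) * y * (2 / ln x)"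
    proof -
      have "\<bar>moebius_frac_sum (primes_le (real p)) y\<bar> \<le> C * ln (real p) * y * (1 / (1 + ln y))"
        using C(2)[of "real p" y] p2 y2 by simp
      also have "\<dots> \<le> C * ln (real p) * y * (2 / ln x)"
        using C(1) lp y2 by (intro mult_left_mono inv mult_nonneg_nonneg) auto
      finally show ?thesis .
    qed
    have V: "\<bar>moebius_omega_frac_sum (primes_le (real p)) y\<bar> \<le> 7 * C * ln (real p) * y * (?E * (2 / ln x))"
    proof -
      have "\<bar>moebius_omega_frac_sum (primes_le (real p)) y\<bar> \<le> 7 * C * ln (real p) * y * (\<Sum>q\<in>primes_le y. 1 / real q * (1 / (1 + ln (y / real q))))"
        using p2 y2 by (intro moebius_omega_frac_sum_bound C) auto
      also have "\<dots> \<le> 7 * C * ln (real p) * y * (?E * (2 / ln x))"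
      proof (rule mult_left_mono)
        have "(\<Sum>q\<in>primes_le y. 1 / real q * (1 / (1 + ln (y / real q)))) \<le> log_log_majorant D y / (2 + ln y)"
          using y2 by (intro sum_inverse_primes_weighted D) auto
        also have "\<dots> \<le> ?E / (2 + ln y)" using Ey y2 by (intro divide_right_mono) auto
        also have "\<dots> = ?E * (1 / (2 + ln y))" by simp
        also have "\<dots> \<le> ?E * (2 / ln x)" using E0 by (intro mult_left_mono inv) auto
        finally show "(\<Sum>q\<in>primes_le y. 1 / real q * (1 / (1 + ln (y / real q)))) \<le> ?E * (2 / ln x)" .
      qed (use C(1) lp y2 in auto)
      finally show ?thesis .
    qed
    have "C * ln (real p) * y * (2 / ln x) + 7 * C * ln (real p) * y * (?E * (2 / ln x))
        = (2 * C + 14 * C * ?E) * (x / ln x * (ln (real p) / real p))"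
      by (simp add: y_def algebra_simps)
    also have "\<dots> \<le> (14 * C * (1 + ?E)) * (x / ln x * (ln (real p) / real p))"
      using C(1) zx z lx lp by (intro mult_right_mono) (auto simp: algebra_simps)
    finally show ?thesis using U V by (simp add: y_def)
  qed
  hence "(\<Sum>p\<in>primes_le z. \<bar>moebius_frac_sum (primes_le (real p)) (x / real p)\<bar> + \<bar>moebius_omega_frac_sum (primes_le (real p)) (x / real p)\<bar>)
      \<le> (\<Sum>p\<in>primes_le z. 14 * C * (1 + ?E) * x / ln x * (ln (real p) / real p))"
    by (rule sum_mono)
  also have "\<dots> = 14 * C * (1 + ?E) * x / ln x * (\<Sum>p\<in>primes_le z. ln (real p) / real p)"
    by (rule sum_distrib_left[symmetric])
  also have "\<dots> \<le> 14 * C * (1 + ?E) * x / ln x * (32 * ln z)"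
    using C(1) E0 lx zx z by (intro mult_left_mono sum_ln_over_primes) auto
  also have "\<dots> = 448 * C * (1 + ?E) * x * ln z / ln x" by simp
  finally show ?thesis .
qed

text \<open>Sum over the prime factors \<open>q\<close> first and count the cofactors up to
  \<open>x / q\<close>. The sieve applies if \<open>x / q \<ge> z\<close>. Otherwise the cofactor
  can only be 1 and \<open>q > x / z\<close>; such primes are counted with the weight
  \<open>ln q / ln (x / z) \<ge> 1\<close> and Chebyshev's bound.\<close>

lemma sum_omega_rough_sqfree_le:
  assumes D: "D > 0" "\<And>z. z \<ge> 2 \<Longrightarrow> (\<Sum>q\<in>primes_le z. 1 / real q) \<le> ln (D * ln z)"
    and z: "2 \<le> z" "z < x"
  shows "(\<Sum>n\<in>rough_sqfree_upto z x. real (distinct_primes n)) \<le> 20 * x / ln z * ln (D * ln x) + 4 * x / ln (x / z)"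
proof -
  let ?Q = "rough_sqfree_upto z x" and ?D = "primes_le x - primes_le z"
  have lz: "ln z > 0" "ln (x / z) > 0" using z by auto
  have "(\<Sum>n\<in>?Q. real (distinct_primes n)) = (\<Sum>n\<in>?Q. \<Sum>q | q \<in> ?D \<and> q dvd n. 1)"
  proof (rule sum.cong)
    fix n assume "n \<in> ?Q"
    hence "n \<in> rough_upto (primes_le z) x" by (simp add: rough_sqfree_upto_def)
    thus "real (distinct_primes n) = (\<Sum>q | q \<in> ?D \<and> q dvd n. 1)"
      unfolding distinct_primes_def by (simp add: prime_factors_rough)
  qed simp
  also have "\<dots> = (\<Sum>q\<in>?D. \<Sum>n | n \<in> ?Q \<and> q dvd n. 1)"
    by (rule sum.swap_restrict) auto
  also have "\<dots> \<le> (\<Sum>q\<in>?D. 20 * x / ln z * (1 / real q) + ln (real q) / ln (x / z))"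
  proof (rule sum_mono)
    fix q assume q: "q \<in> ?D"
    have q2: "prime q" "q \<ge> 2" "real q \<le> x" using q primes_le_ge_2 primes_leD by blast+
    have inj: "inj_on (\<lambda>n. n div q) {n. n \<in> ?Q \<and> q dvd n}"
      by (rule inj_onI) (metis (no_types, lifting) dvd_mult_div_cancel mem_Collect_eq)
    have "(\<lambda>n. n div q) ` {n. n \<in> ?Q \<and> q dvd n} \<subseteq> rough_sqfree_upto z (x / real q)"
    proof clarify
      fix n assume n: "n \<in> ?Q" "q dvd n"
      note nD = rough_sqfree_uptoD[OF n(1)]
      note sq = squarefree_div_prime[OF nD(3,1) q2(1) n(2)]
      have "real n = real q * real (n div q)" using sq(3) by (metis of_nat_mult)
      show "n div q \<in> rough_sqfree_upto z (x / real q)"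
      proof (rule rough_sqfree_uptoI)
        show "n div q > 0" using sq(3) nD(1) by (metis mult_0_right neq0_conv)
        show "real (n div q) \<le> x / real q"
          using \<open>real n = _\<close> nD(2) q2 by (simp add: le_divide_eq mult.commute)
        show "z < real p" if "prime p" "p dvd n div q" for p
          using nD(4)[OF that(1)] that(2) sq(3) by (metis dvd_mult)
      qed (rule sq)
    qed
    hence "card {n. n \<in> ?Q \<and> q dvd n} \<le> card (rough_sqfree_upto z (x / real q))"
      by (intro card_inj_on_le[OF inj]) auto
    hence "(\<Sum>n | n \<in> ?Q \<and> q dvd n. 1) \<le> real (card (rough_sqfree_upto z (x / real q)))" by simp
    also have "\<dots> \<le> 20 * x / ln z * (1 / real q) + ln (real q) / ln (x / z)"
    proof (cases "x / real q \<ge> z")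
      case True
      have "real (card (rough_sqfree_upto z (x / real q))) \<le> 20 * (x / real q) / ln z"
        by (rule card_rough_sqfree_le[OF z(1) True])
      moreover have "ln (real q) / ln (x / z) \<ge> 0" using q2 lz by simp
      ultimately show ?thesis by (simp add: mult_ac)
    next
      case False
      hence "x / z < real q" using q2 z by (simp add: field_simps)
      hence "ln (x / z) \<le> ln (real q)" using z by (intro ln_mono) auto
      hence "1 \<le> ln (real q) / ln (x / z)" using lz by simp
      moreover have "real (card (rough_sqfree_upto z (x / real q))) \<le> 1"
        using card_rough_sqfree_small[of "x / real q" z] False by simp
      moreover have "20 * x / ln z * (1 / real q) \<ge> 0" using z lz by simp
      ultimately show ?thesis by linarith
    qed
    finally show "(\<Sum>n | n \<in> ?Q \<and> q dvd n. 1) \<le> 20 * x / ln z * (1 / real q) + ln (real q) / ln (x / z)" .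
  qed
  also have "\<dots> \<le> (\<Sum>q\<in>primes_le x. 20 * x / ln z * (1 / real q) + ln (real q) / ln (x / z))"
  proof (rule sum_mono2)
    fix q assume "q \<in> primes_le x - ?D"
    hence "ln (real q) \<ge> 0" by (auto intro: ln_primes_le_nonneg)
    thus "0 \<le> 20 * x / ln z * (1 / real q) + ln (real q) / ln (x / z)"
      using lz z by (intro add_nonneg_nonneg) auto
  qed auto
  also have "\<dots> = 20 * x / ln z * (\<Sum>q\<in>primes_le x. 1 / real q) + (\<Sum>q\<in>primes_le x. ln (real q)) / ln (x / z)"
    by (simp only: sum.distrib sum_distrib_left sum_divide_distrib)
  also have "\<dots> \<le> 20 * x / ln z * ln (D * ln x) + 4 * x / ln (x / z)"
    using z lz by (intro add_mono mult_left_mono divide_right_mono D sum_ln_primes_le) auto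
  finally show ?thesis .
qed

section \<open>Decomposition by the smallest prime factor\<close>

lemma smallest_prime_factor:
  assumes "n > 1"
  shows "prime (smallest_prime_factor n)" "smallest_prime_factor n dvd n"
    "\<And>q. prime q \<Longrightarrow> q dvd n \<Longrightarrow> smallest_prime_factor n \<le> q"
proof -
  obtain p where "prime p" "p dvd n" using assms prime_factor_nat[of n] by auto
  hence "prime_factors n \<noteq> {}" using assms by (auto simp: prime_factors_dvd)
  hence "smallest_prime_factor n \<in> prime_factors n"
    unfolding smallest_prime_factor_def by (intro Min_in) auto
  thus "prime (smallest_prime_factor n)" "smallest_prime_factor n dvd n" by auto
  show "smallest_prime_factor n \<le> q" if "prime q" "q dvd n" for q
    unfolding smallest_prime_factor_def using that assms by (intro Min_le) (auto simp: prime_factors_dvd)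
qed

lemma smallest_prime_factor_eqI:
  assumes "n > 1" "prime p" "p dvd n" "\<And>q. prime q \<Longrightarrow> q dvd n \<Longrightarrow> p \<le> q"
  shows "smallest_prime_factor n = p"
  using smallest_prime_factor[OF assms(1)] assms(2-4) by (intro antisym) auto

text \<open>If \<open>p\<close> divides \<open>m\<close>, then \<open>p * m\<close> has Moebius
  value 0, so \<open>m\<close> may be taken free of all primes up to and including \<open>p\<close>.
  The two sums come from \<open>\<omega>(p m) = 1 + \<omega>(m)\<close>.\<close>

lemma sum_smallest_prime_factor_eq:
  assumes p: "prime p"
  shows "(\<Sum>n | 1 < n \<and> real n \<le> x \<and> smallest_prime_factor n = p. real_of_int (moebius_mu n) * real (distinct_primes n) * frac (x / real n))
      = - (moebius_frac_sum (primes_le (real p)) (x / real p) + moebius_omega_frac_sum (primes_le (real p)) (x / real p))"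
    (is "sum ?t ?N = _")
proof -
  let ?R = "rough_upto (primes_le (real p)) (x / real p)"
  have p0: "p > 0" "p > 1" using p prime_gt_0_nat prime_gt_1_nat by blast+
  have R: "m > 0" "\<not> p dvd m" "real (p * m) \<le> x" "\<And>q. prime q \<Longrightarrow> q dvd m \<Longrightarrow> p < q" if "m \<in> ?R" for m
  proof -
    show "m > 0" using that by (simp add: rough_upto_def coprime_set_def)
    show "real (p * m) \<le> x" using that p0 by (simp add: rough_upto_def field_simps)
    have *: "\<forall>q\<in>primes_le (real p). \<not> q dvd m" using that by (simp add: rough_upto_def coprime_set_def)
    thus "\<not> p dvd m" using p by (simp add: primes_le_def)
    show "p < q" if "prime q" "q dvd m" for q
      using * that by (auto simp: primes_le_def not_le[symmetric])
  qed
  have finN: "finite ?N"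
    by (rule finite_subset[of _ "{..nat \<lfloor>x\<rfloor>}"]) (auto simp: le_nat_floor)
  have "sum ?t ?N = (\<Sum>n\<in>(\<lambda>m. p * m) ` ?R. ?t n)"
  proof (rule sum.mono_neutral_right[OF finN])
    show "(\<lambda>m. p * m) ` ?R \<subseteq> ?N"
    proof clarify
      fix m assume m: "m \<in> ?R"
      have gt: "1 < p * m" using R(1)[OF m] p0 by (metis less_le_trans mult.right_neutral mult_le_mono2 Suc_leI One_nat_def)
      moreover have "smallest_prime_factor (p * m) = p"
        using gt p R(4)[OF m] by (intro smallest_prime_factor_eqI) (auto simp: prime_dvd_mult_iff less_imp_le dest: primes_dvd_imp_eq)
      ultimately show "1 < p * m \<and> real (p * m) \<le> x \<and> smallest_prime_factor (p * m) = p"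
        using R(3)[OF m] by simp
    qed
    show "\<forall>n\<in>?N - (\<lambda>m. p * m) ` ?R. ?t n = 0"
    proof
      fix n assume n: "n \<in> ?N - (\<lambda>m. p * m) ` ?R"
      hence n1: "n > 1" "real n \<le> x" "smallest_prime_factor n = p" by auto
      then obtain m where m: "n = p * m" using smallest_prime_factor(2)[of n] by (auto elim: dvdE)
      have "p dvd m"
      proof (rule ccontr)
        assume ndvd: "\<not> p dvd m"
        have "\<not> q dvd m" if q: "q \<in> primes_le (real p)" for q
        proof
          assume "q dvd m"
          hence "q dvd n" by (simp add: m)
          moreover have "prime q" "q \<le> p" using q by (auto simp: primes_le_def)
          ultimately have "q = p" using smallest_prime_factor(3)[OF n1(1)] n1(3) by (intro antisym) auto
          thus False using \<open>q dvd m\<close> ndvd by simp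
        qed
        moreover have "m > 0" using n1(1) m by (auto intro: Nat.gr0I)
        ultimately have "m \<in> ?R" using n1 p0 by (auto simp: m rough_upto_def coprime_set_def field_simps)
        thus False using n m by auto
      qed
      hence "moebius_mu n = 0" using p m by (simp add: moebius_mu_prime_mult_eq_0)
      thus "?t n = 0" by simp
    qed
  qed
  also have "\<dots> = (\<Sum>m\<in>?R. ?t (p * m))"
    using p0 by (subst sum.reindex) (auto simp: inj_on_def)
  also have "\<dots> = (\<Sum>m\<in>?R. - (real_of_int (moebius_mu m) * frac (x / real p / real m)
       + real_of_int (moebius_mu m) * real (distinct_primes m) * frac (x / real p / real m)))"
  proof (rule sum.cong)
    fix m assume m: "m \<in> ?R"
    have "moebius_mu (p * m) = - moebius_mu m" "distinct_primes (p * m) = Suc (distinct_primes m)"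
      using moebius_mu_prime_mult[OF p R(2,1)[OF m]] distinct_primes_prime_mult[OF p R(2,1)[OF m]] .
    thus "?t (p * m) = - (real_of_int (moebius_mu m) * frac (x / real p / real m)
       + real_of_int (moebius_mu m) * real (distinct_primes m) * frac (x / real p / real m))"
      by (simp add: algebra_simps)
  qed simp
  finally show ?thesis
    by (simp only: sum_negf sum.distrib moebius_frac_sum_def moebius_omega_frac_sum_def)
qed

lemma restricted_sum_bound:
  fixes x z :: real
  shows "\<bar>\<Sum>n | 1 < n \<and> real n \<le> x \<and> R (smallest_prime_factor n). real_of_int (moebius_mu n) * real (distinct_primes n) * frac (x / real n)\<bar>
     \<le> (\<Sum>p\<in>primes_le z. \<bar>moebius_frac_sum (primes_le (real p)) (x / real p)\<bar> + \<bar>moebius_omega_frac_sum (primes_le (real p)) (x / real p)\<bar>)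
       + (\<Sum>n\<in>rough_sqfree_upto z x. real (distinct_primes n))"
proof -
  let ?t = "\<lambda>n. real_of_int (moebius_mu n) * real (distinct_primes n) * frac (x / real n)"
  let ?spf = smallest_prime_factor
  define A where "A = {n. 1 < n \<and> real n \<le> x \<and> R (?spf n)}"
  define A1 where "A1 = {n \<in> A. real (?spf n) \<le> z}"
  define A2 where "A2 = {n \<in> A. z < real (?spf n)}"
  have fin: "finite A"
    by (rule finite_subset[of _ "{..nat \<lfloor>x\<rfloor>}"]) (auto simp: A_def le_nat_floor)
  hence fin12: "finite A1" "finite A2" by (auto simp: A1_def A2_def)
  have "sum ?t A = sum ?t A1 + sum ?t A2"
    using fin12 by (subst sum.union_disjoint[symmetric]) (auto simp: A1_def A2_def intro!: sum.cong)
  moreover have "\<bar>sum ?t A1\<bar> \<le> (\<Sum>p\<in>primes_le z. \<bar>moebius_frac_sum (primes_le (real p)) (x / real p)\<bar> + \<bar>moebius_omega_frac_sum (primes_le (real p)) (x / real p)\<bar>)"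
  proof -
    have "sum ?t A1 = (\<Sum>p\<in>primes_le z. sum ?t {n \<in> A1. ?spf n = p})"
      using fin12 smallest_prime_factor(1)
      by (intro sum.group[symmetric]) (auto simp: A1_def A_def primes_le_def finite_primes_le[unfolded primes_le_def])
    also have "\<bar>\<dots>\<bar> \<le> (\<Sum>p\<in>primes_le z. \<bar>sum ?t {n \<in> A1. ?spf n = p}\<bar>)" by (rule sum_abs)
    also have "\<dots> \<le> (\<Sum>p\<in>primes_le z. \<bar>moebius_frac_sum (primes_le (real p)) (x / real p)\<bar> + \<bar>moebius_omega_frac_sum (primes_le (real p)) (x / real p)\<bar>)"
    proof (rule sum_mono)
      fix p assume p: "p \<in> primes_le z"
      show "\<bar>sum ?t {n \<in> A1. ?spf n = p}\<bar> \<le> \<bar>moebius_frac_sum (primes_le (real p)) (x / real p)\<bar> + \<bar>moebius_omega_frac_sum (primes_le (real p)) (x / real p)\<bar>"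
      proof (cases "R p")
        case True
        hence eq: "{n \<in> A1. ?spf n = p} = {n. 1 < n \<and> real n \<le> x \<and> ?spf n = p}"
          using primes_leD(2)[OF p] by (auto simp: A1_def A_def)
        show ?thesis unfolding eq sum_smallest_prime_factor_eq[OF primes_leD(1)[OF p]] by simp
      next
        case False
        hence eq: "{n \<in> A1. ?spf n = p} = {}" by (auto simp: A1_def A_def)
        show ?thesis unfolding eq by simp
      qed
    qed
    finally show ?thesis .
  qed
  moreover have "\<bar>sum ?t A2\<bar> \<le> (\<Sum>n\<in>rough_sqfree_upto z x. real (distinct_primes n))"
  proof -
    have le: "\<bar>?t n\<bar> \<le> real (distinct_primes n)" for n
    proof -
      have "\<bar>?t n\<bar> = \<bar>real_of_int (moebius_mu n)\<bar> * real (distinct_primes n) * frac (x / real n)"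
        by (simp add: abs_mult)
      also have "\<dots> \<le> 1 * real (distinct_primes n) * 1"
        using abs_moebius_mu_le_1[of n] frac_lt_1[of "x / real n"] by (intro mult_mono) auto
      finally show ?thesis by simp
    qed
    have "sum ?t A2 = sum ?t {n \<in> A2. squarefree n}"
      using fin12 by (intro sum.mono_neutral_right) (auto simp: moebius_mu_def)
    also have "\<bar>\<dots>\<bar> \<le> (\<Sum>n\<in>{n \<in> A2. squarefree n}. \<bar>?t n\<bar>)" by (rule sum_abs)
    also have "\<dots> \<le> (\<Sum>n\<in>{n \<in> A2. squarefree n}. real (distinct_primes n))" by (intro sum_mono le)
    also have "\<dots> \<le> (\<Sum>n\<in>rough_sqfree_upto z x. real (distinct_primes n))"
    proof (rule sum_mono2)
      show "{n \<in> A2. squarefree n} \<subseteq> rough_sqfree_upto z x"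
      proof
        fix n assume n: "n \<in> {n \<in> A2. squarefree n}"
        hence n1: "1 < n" "real n \<le> x" "z < real (?spf n)" "squarefree n" by (auto simp: A2_def A_def)
        show "n \<in> rough_sqfree_upto z x"
        proof (rule rough_sqfree_uptoI)
          fix q assume "prime q" "q dvd n"
          hence "?spf n \<le> q" using n1 by (intro smallest_prime_factor(3))
          thus "z < real q" using n1(3) by linarith
        qed (use n1 in auto)
      qed
    qed auto
    finally show ?thesis .
  qed
  ultimately show ?thesis unfolding A_def by linarith
qed

theorem theorem9:
  fixes k l :: nat
  assumes "k \<ge> 1" and "1 \<le> l" and "l \<le> k" and "coprime l k"
  shows "(\<lambda>x :: real. \<Sum>n | 1 < n \<and> real n \<le> x \<and> [smallest_prime_factor n = l] (mod k).
             real_of_int (moebius_mu n) * real (distinct_primes n) * frac (x / real n))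
           \<in> O[at_top](\<lambda>x. x * ln (ln x) powr (5 / 2) / sqrt (ln x))"
proof -
  let ?S = "\<lambda>x :: real. \<Sum>n | 1 < n \<and> real n \<le> x \<and> [smallest_prime_factor n = l] (mod k).
             real_of_int (moebius_mu n) * real (distinct_primes n) * frac (x / real n)"
  obtain C where C: "C > 0" "\<And>z y. z \<ge> 2 \<Longrightarrow> y \<ge> 1 \<Longrightarrow> \<bar>moebius_frac_sum (primes_le z) y\<bar> \<le> C * ln z * (y / (1 + ln y))"
    using moebius_frac_sum_uniform by blast
  obtain D where D: "D > 0" "\<And>z. z \<ge> 2 \<Longrightarrow> (\<Sum>q\<in>primes_le z. 1 / real q) \<le> ln (D * ln z)"
    using sum_inverse_primes by blast
  \<comment> \<open>The bounds for small and large smallest prime factors at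
    \<open>ln z = sqrt (ln x)\<close>, where \<open>ln (x / z) = ln x - sqrt (ln x)\<close>.\<close>
  define g where "g = (\<lambda>x. 448 * C * (1 + log_log_majorant D x) * x * sqrt (ln x) / ln x
      + (20 * x / sqrt (ln x) * ln (D * ln x) + 4 * x / (ln x - sqrt (ln x))))"
  have "\<forall>\<^sub>F x in at_top. exp (sqrt (ln x)) \<ge> 2" "\<forall>\<^sub>F x in at_top. exp (sqrt (ln x)) ^ 2 \<le> x"
    "\<forall>\<^sub>F x in at_top. exp (sqrt (ln x)) < x" "\<forall>\<^sub>F x::real in at_top. x > 1"
    by real_asymp+
  hence "\<forall>\<^sub>F x in at_top. \<bar>?S x\<bar> \<le> g x"
  proof eventually_elim
    case (elim x)
    define z where "z = exp (sqrt (ln x))"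
    have lz: "ln z = sqrt (ln x)" by (simp add: z_def)
    have lxz: "ln (x / z) = ln x - sqrt (ln x)" using elim(4) by (simp add: ln_div z_def)
    have "\<bar>?S x\<bar> \<le> (\<Sum>p\<in>primes_le z. \<bar>moebius_frac_sum (primes_le (real p)) (x / real p)\<bar> + \<bar>moebius_omega_frac_sum (primes_le (real p)) (x / real p)\<bar>)
       + (\<Sum>n\<in>rough_sqfree_upto z x. real (distinct_primes n))"
      by (rule restricted_sum_bound)
    also have "\<dots> \<le> 448 * C * (1 + log_log_majorant D x) * x * ln z / ln x + (20 * x / ln z * ln (D * ln x) + 4 * x / ln (x / z))"
      using elim by (intro add_mono sum_frac_sums_small_primes sum_omega_rough_sqfree_le C D) (auto simp: z_def)
    also have "\<dots> = g x" by (simp add: g_def lz lxz)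
    finally show ?case .
  qed
  hence "?S \<in> O[at_top](g)"
    by (intro bigoI[of _ 1]) (auto elim!: eventually_mono)
  also have "g \<in> O[at_top](\<lambda>x. x * ln (ln x) powr (5 / 2) / sqrt (ln x))"
    unfolding g_def log_log_majorant_def using C(1) D(1) by real_asymp
  finally show ?thesis .
qed

end
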